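(* Let $\Omega\subset\mathbb{R}^2$ be an exterior domain with Lipschitz boundary. For every $v\in\dot{H}_{0,\sigma}^1(\Omega)$ with $$\sup_{x\in\Omega}(|x|+1)|v(x)|<\infty,$$ there exists a sequence $\{v_n\}_{n=1}^\infty\subset C_{0,\sigma}^\infty(\Omega)$ such that, as $n\to\infty$, $$\nabla v_n\to\nabla v\quad\text{in }L^2(\Omega),\qquad(|x|+1)v_n\to(|x|+1)v\quad\text{weakly}*\text{ in }L^\infty(\Omega).$$
   Context: An exterior domain is a domain (connected open set) in $\mathbb{R}^2$ that is the complement of a nonempty compact set. $C_{0,\sigma}^\infty(\Omega)$ is the set of smooth vector fields $\varphi=(\varphi_1,\varphi_2)$ with compact support in $\Omega$ and $\operatorname{div}\varphi=0$ in $\Omega$. $\dot{H}_{0,\sigma}^1(\Omega)$ is the completion of $C_{0,\sigma}^\infty(\Omega)$ in the norm $\|\nabla\cdot\|_{L^2(\Omega)}$. No symmetry is assumed. Suprema of functions defined almost everywhere are essential suprema. *)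

theory Defs
  imports "HOL-Analysis.Analysis" "HOL-Probability.Essential_Supremum"
begin

definition exterior_domain :: "(real^2) set \<Rightarrow> bool" where
  "exterior_domain \<Omega> \<longleftrightarrow> open \<Omega> \<and> connected \<Omega> \<and> compact (- \<Omega>) \<and> - \<Omega> \<noteq> {}"

text \<open>Near every boundary point, after an orthogonal change of coordinates \<open>T\<close>, the set is
  the part of a ball lying strictly above the graph of a Lipschitz function.\<close>

definition lipschitz_boundary :: "(real^2) set \<Rightarrow> bool" where
  "lipschitz_boundary \<Omega> \<longleftrightarrow>
     (\<forall>p\<in>frontier \<Omega>. \<exists>r>0. \<exists>T :: real^2 \<Rightarrow> real^2. \<exists>\<gamma> :: real \<Rightarrow> real. \<exists>L.
        orthogonal_transformation T \<and> L-lipschitz_on UNIV \<gamma> \<and>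
        \<Omega> \<inter> ball p r = {x \<in> ball p r. \<gamma> (T x $ 1) < T x $ 2})"

primrec times_differentiable ::
    "nat \<Rightarrow> ('a::real_normed_vector \<Rightarrow> 'b::real_normed_vector) \<Rightarrow> bool" where
  "times_differentiable 0 f \<longleftrightarrow> continuous_on UNIV f"
| "times_differentiable (Suc k) f \<longleftrightarrow>
     (\<forall>x. f differentiable (at x)) \<and>
     (\<forall>h. times_differentiable k (\<lambda>x. frechet_derivative f (at x) h))"

definition smooth :: "('a::real_normed_vector \<Rightarrow> 'b::real_normed_vector) \<Rightarrow> bool" where
  "smooth f \<longleftrightarrow> (\<forall>k. times_differentiable k f)"

text \<open>Functions with compact support in \<open>\<Omega>\<close> are identified with their extensions by zero
  to the whole plane.\<close>

definition test_functions :: "(real^2) set \<Rightarrow> (real^2 \<Rightarrow> 'b::real_normed_vector) set" where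
  "test_functions \<Omega> =
     {f. smooth f \<and> compact (closure {x. f x \<noteq> 0}) \<and> closure {x. f x \<noteq> 0} \<subseteq> \<Omega>}"

definition grad :: "(real^2 \<Rightarrow> real^2) \<Rightarrow> real^2 \<Rightarrow> real^2^2" where
  "grad u x = jacobian u (at x)"

definition divergence :: "(real^2 \<Rightarrow> real^2) \<Rightarrow> real^2 \<Rightarrow> real" where
  "divergence u x = trace (grad u x)"

definition solenoidal_test_fields :: "(real^2) set \<Rightarrow> (real^2 \<Rightarrow> real^2) set" where
  "solenoidal_test_fields \<Omega> = {\<phi> \<in> test_functions \<Omega>. \<forall>x\<in>\<Omega>. divergence \<phi> x = 0}"

text \<open>In the following definitions, \<open>norm\<close> on \<^typ>\<open>real^2^2\<close> is the Frobenius norm.\<close>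

definition L2_space :: "'a measure \<Rightarrow> ('a \<Rightarrow> 'b::euclidean_space) set" where
  "L2_space M = {f \<in> borel_measurable M. integrable M (\<lambda>x. (norm (f x))\<^sup>2)}"

definition L2_norm :: "'a measure \<Rightarrow> ('a \<Rightarrow> 'b::euclidean_space) \<Rightarrow> real" where
  "L2_norm M f = sqrt (LINT x|M. (norm (f x))\<^sup>2)"

definition L2_tendsto ::
    "'a measure \<Rightarrow> (nat \<Rightarrow> 'a \<Rightarrow> 'b::euclidean_space) \<Rightarrow> ('a \<Rightarrow> 'b) \<Rightarrow> bool" where
  "L2_tendsto M f g \<longleftrightarrow>
     (\<forall>n. f n \<in> L2_space M) \<and> g \<in> L2_space M \<and>
     (\<lambda>n. L2_norm M (\<lambda>x. f n x - g x)) \<longlonglongrightarrow> 0"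

definition Linf_space :: "'a measure \<Rightarrow> ('a \<Rightarrow> 'b::euclidean_space) set" where
  "Linf_space M = {f \<in> borel_measurable M. esssup M (\<lambda>x. ereal (norm (f x))) < \<infinity>}"

definition Linf_weak_star_tendsto ::
    "'a measure \<Rightarrow> (nat \<Rightarrow> 'a \<Rightarrow> 'b::euclidean_space) \<Rightarrow> ('a \<Rightarrow> 'b) \<Rightarrow> bool" where
  "Linf_weak_star_tendsto M f g \<longleftrightarrow>
     (\<forall>n. f n \<in> Linf_space M) \<and> g \<in> Linf_space M \<and>
     (\<forall>h. integrable M h \<longrightarrow>
        (\<lambda>n. LINT x|M. f n x \<bullet> h x) \<longlonglongrightarrow> (LINT x|M. g x \<bullet> h x))"

definition locally_integrable :: "(real^2) set \<Rightarrow> (real^2 \<Rightarrow> 'b::euclidean_space) \<Rightarrow> bool" where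
  "locally_integrable \<Omega> f \<longleftrightarrow>
     (\<forall>K. compact K \<and> K \<subseteq> \<Omega> \<longrightarrow> integrable (lebesgue_on K) f)"

text \<open>\<open>D x $ i $ j\<close> is the weak derivative of the \<open>i\<close>-th component of \<open>v\<close> in direction \<open>j\<close>,
  which is the index convention of \<^const>\<open>jacobian\<close>.\<close>

definition weak_gradient ::
    "(real^2) set \<Rightarrow> (real^2 \<Rightarrow> real^2) \<Rightarrow> (real^2 \<Rightarrow> real^2^2) \<Rightarrow> bool" where
  "weak_gradient \<Omega> v D \<longleftrightarrow>
     locally_integrable \<Omega> v \<and> locally_integrable \<Omega> D \<and>
     (\<forall>\<psi> :: real^2 \<Rightarrow> real. \<psi> \<in> test_functions \<Omega> \<longrightarrow>
        (\<forall>i j. (LINT x|lebesgue_on \<Omega>. v x $ i * frechet_derivative \<psi> (at x) (axis j 1))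
             = - (LINT x|lebesgue_on \<Omega>. D x $ i $ j * \<psi> x)))"

definition dirichlet_norm :: "(real^2) set \<Rightarrow> (real^2 \<Rightarrow> real^2) \<Rightarrow> real" where
  "dirichlet_norm \<Omega> u = L2_norm (lebesgue_on \<Omega>) (grad u)"

text \<open>The completion of the solenoidal test fields in the Dirichlet norm, realised as a space
  of functions. In an exterior domain with Lipschitz boundary the complement has interior
  points, so by Poincare's inequality a Cauchy sequence in the Dirichlet norm converges in
  \<open>L\<^sup>2\<close> on every bounded part of \<open>\<Omega>\<close>. The element of the completion that the sequence
  represents is identified with this limit, which is determined up to null sets.\<close>

definition H1dot_0_sigma :: "(real^2) set \<Rightarrow> (real^2 \<Rightarrow> real^2) set" where
  "H1dot_0_sigma \<Omega> = {v. \<exists>\<phi>.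
     (\<forall>n. \<phi> n \<in> solenoidal_test_fields \<Omega>) \<and>
     (\<forall>e>0. \<exists>N. \<forall>m\<ge>N. \<forall>n\<ge>N. dirichlet_norm \<Omega> (\<lambda>x. \<phi> m x - \<phi> n x) < e) \<and>
     (\<forall>R>0. L2_tendsto (lebesgue_on (\<Omega> \<inter> ball 0 R)) \<phi> v)}"

end

theory Submission
  imports Defs
begin

text \<open>The approximating fields \<open>\<phi>\<^sub>n\<close> converge to \<open>v\<close> in the Dirichlet norm but carry no
  pointwise bound. Averaging \<open>\<phi>\<^sub>n\<close> over squares of side \<open>2 \<delta>\<close>, with \<open>n\<close> large depending
  on \<open>\<delta>\<close>, gives a smooth solenoidal field \<open>u\<close> that inherits the bound of \<open>v\<close> on large balls and
  vanishes at depth \<open>2 \<delta>\<close> inside the complement \<open>K\<close> of \<open>\<Omega>\<close>. Let \<open>\<psi>\<close> be its stream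
  function. Near \<open>K\<close> the function \<open>\<psi>\<close> is cut off at scale \<open>\<delta>\<close> towards the locally constant
  function given by its values inside \<open>K\<close>, and near infinity it is cut off at scale \<open>R\<close> towards a
  constant. Since the gradient of \<open>\<psi>\<close> is of order \<open>1 / (|x| + 1)\<close>, its distance to
  these constants is \<open>O(\<delta>)\<close> and \<open>O(1)\<close>, so both cutoffs respect the weighted sup bound. A
  Poincare inequality along rays entering \<open>K\<close>, which exist as the boundary is Lipschitz, bounds
  the change of the gradient by the Dirichlet integral of \<open>u\<close> near \<open>K\<close> and near infinity. This is
  small because a fixed \<open>\<phi>\<^sub>m\<close> vanishes there. Weak* convergence follows from the uniform bound,
  convergence almost everywhere and dominated convergence.\<close>

section \<open>Smooth functions\<close>

text \<open>Cutting off the field itself would destroy the divergence condition, so every cutoff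
  acts on a stream function. The test fields extended by zero are solenoidal in the whole plane, so
  this function exists globally; but on the complement it may take a different constant on each
  component, and these constants cannot all be removed at once. Hence a local value is subtracted
  near the complement and a single constant only near infinity. The outer cutoff is delicate in the
  plane: its second derivatives, of order 1/R^2 on a set of area of order R^2, meet a factor that is
  merely bounded, which leaves an energy of order 1/R^2. Near the complement, the negative powers of
  \<delta> from the cutoff are cancelled exactly by the Poincare inequality, so no smallness comes
  from \<delta> itself. This forces the order of choices m, \<delta>, R, n: the support of the field
  with index m determines \<delta> and R, and only then is n taken so large that the error of that
  field against v, averaged over a square of side 2 \<delta>, is of order 1/(2 R + 1) on the ball of
  radius 2 R.\<close>

definition pd :: "('a::real_normed_vector \<Rightarrow> 'b::real_normed_vector) \<Rightarrow> 'a \<Rightarrow> 'a \<Rightarrow> 'b"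
  where "pd f h x = frechet_derivative f (at x) h"

lemma pd_eqI: "(f has_derivative f') (at x) \<Longrightarrow> pd f h x = f' h"
  unfolding pd_def by (drule frechet_derivative_at) simp

lemma times_differentiable_Suc:
  "times_differentiable (Suc k) f \<longleftrightarrow>
     (\<forall>x. f differentiable (at x)) \<and> (\<forall>h. times_differentiable k (pd f h))"
  by (simp add: pd_def[abs_def])

declare times_differentiable.simps(2)[simp del]

lemma has_derivative_pd: "f differentiable (at x) \<Longrightarrow> (f has_derivative (\<lambda>h. pd f h x)) (at x)"
  unfolding pd_def by (simp add: frechet_derivative_works[symmetric])

lemma times_differentiable_SucI:
  assumes "\<And>x. (f has_derivative f' x) (at x)" "\<And>h. times_differentiable k (\<lambda>x. f' x h)"
  shows "times_differentiable (Suc k) f"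
proof -
  have "pd f h = (\<lambda>x. f' x h)" for h
    by (rule ext) (rule pd_eqI[OF assms(1)])
  then show ?thesis using assms unfolding times_differentiable_Suc differentiable_def by auto
qed

lemma times_differentiable_SucD:
  "times_differentiable (Suc k) f \<Longrightarrow> (f has_derivative (\<lambda>h. pd f h x)) (at x)"
  "times_differentiable (Suc k) f \<Longrightarrow> times_differentiable k (pd f h)"
  by (simp_all add: times_differentiable_Suc has_derivative_pd)

lemma times_differentiable_lower:
  "times_differentiable (Suc k) f \<Longrightarrow> times_differentiable k f"
proof (induction k arbitrary: f)
  case 0
  then show ?case
    using has_derivative_continuous[OF times_differentiable_SucD(1)[OF 0]]
    by (simp add: continuous_on_eq_continuous_at)
next
  case (Suc k)
  show ?case
    by (rule times_differentiable_SucI[OF times_differentiable_SucD(1)[OF Suc.prems]])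
      (rule Suc.IH[OF times_differentiable_SucD(2)[OF Suc.prems]])
qed

lemma smooth_has_derivative: "smooth f \<Longrightarrow> (f has_derivative (\<lambda>h. pd f h x)) (at x)"
  unfolding smooth_def using times_differentiable_SucD(1) by blast

lemma smooth_pd: "smooth f \<Longrightarrow> smooth (pd f h)"
  unfolding smooth_def using times_differentiable_SucD(2) by blast

lemma smooth_continuous_on: "smooth f \<Longrightarrow> continuous_on S f"
  unfolding smooth_def
  by (rule continuous_on_subset[of UNIV]) (drule spec[of _ 0], simp_all)

lemma smooth_bounded_linear_pd: "smooth f \<Longrightarrow> bounded_linear (\<lambda>h. pd f h x)"
  using smooth_has_derivative has_derivative_bounded_linear by blast

lemma smoothI:
  assumes "\<And>x. (f has_derivative f' x) (at x)" "\<And>h. smooth (\<lambda>x. f' x h)"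
  shows "smooth f"
  unfolding smooth_def
proof
  fix k
  have "times_differentiable (Suc k) f"
    by (rule times_differentiable_SucI[OF assms(1)]) (use assms(2) in \<open>simp add: smooth_def\<close>)
  then show "times_differentiable k f" by (rule times_differentiable_lower)
qed

lemma times_differentiable_const: "times_differentiable k (\<lambda>x. c)"
proof (induction k arbitrary: c)
  case (Suc k)
  show ?case by (rule times_differentiable_SucI[OF has_derivative_const]) (rule Suc)
qed auto

lemma smooth_const [simp]: "smooth (\<lambda>x. c)"
  by (simp add: smooth_def times_differentiable_const)

lemma smooth_bounded_linear: "bounded_linear f \<Longrightarrow> smooth f"
  by (rule smoothI[OF bounded_linear_imp_has_derivative]) simp_all

lemma times_differentiable_add:
  "times_differentiable k f \<Longrightarrow> times_differentiable k g \<Longrightarrow> times_differentiable k (\<lambda>x. f x + g x)"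
proof (induction k arbitrary: f g)
  case 0
  then show ?case by (simp add: continuous_on_add)
next
  case (Suc k)
  note f = times_differentiable_SucD[OF Suc.prems(1)] and g = times_differentiable_SucD[OF Suc.prems(2)]
  show ?case
    by (rule times_differentiable_SucI[OF has_derivative_add[OF f(1) g(1)]]) (rule Suc.IH[OF f(2) g(2)])
qed

text \<open>The derivative of \<open>B (f x) (g x)\<close> is a sum of two terms of the same form in
  which one factor is differentiated and the other only lowered by one order, so the induction
  closes on \<open>B\<close> itself.\<close>

lemma times_differentiable_bilinear:
  assumes "bounded_bilinear B"
  shows "times_differentiable k f \<Longrightarrow> times_differentiable k g \<Longrightarrow>
    times_differentiable k (\<lambda>x. B (f x) (g x))"
proof (induction k arbitrary: f g)
  case 0
  then show ?case by (simp add: bounded_bilinear.continuous_on[OF assms])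
next
  case (Suc k)
  note f = times_differentiable_SucD[OF Suc.prems(1)] and g = times_differentiable_SucD[OF Suc.prems(2)]
  show ?case
    by (rule times_differentiable_SucI[OF bounded_bilinear.FDERIV[OF assms f(1) g(1)]])
      (rule times_differentiable_add[OF Suc.IH[OF times_differentiable_lower[OF Suc.prems(1)] g(2)]
            Suc.IH[OF f(2) times_differentiable_lower[OF Suc.prems(2)]]])
qed

lemma smooth_add: "smooth f \<Longrightarrow> smooth g \<Longrightarrow> smooth (\<lambda>x. f x + g x)"
  by (simp add: smooth_def times_differentiable_add)

lemma smooth_bilinear:
  "bounded_bilinear B \<Longrightarrow> smooth f \<Longrightarrow> smooth g \<Longrightarrow> smooth (\<lambda>x. B (f x) (g x))"
  by (simp add: smooth_def times_differentiable_bilinear)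

lemmas smooth_mult = smooth_bilinear[OF bounded_bilinear_mult]
  and smooth_scaleR = smooth_bilinear[OF bounded_bilinear_scaleR]
  and smooth_inner = smooth_bilinear[OF bounded_bilinear_inner]

lemma smooth_linear_compose:
  assumes "bounded_linear L" "smooth f"
  shows "smooth (\<lambda>x. L (f x))"
proof -
  \<comment> \<open>A linear map is the bilinear map \<open>(c, y) \<mapsto> c *\<^sub>R L y\<close>
    with \<open>c\<close> frozen at 1, so the Leibniz induction covers it.\<close>
  have "bounded_bilinear (\<lambda>(c::real) y. c *\<^sub>R L y)"
    using bounded_bilinear.comp[OF bounded_bilinear_scaleR bounded_linear_ident assms(1)] .
  from smooth_bilinear[OF this smooth_const[of 1] assms(2)] show ?thesis by simp
qed

lemma smooth_minus: "smooth f \<Longrightarrow> smooth (\<lambda>x. - f x)"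
  by (rule smooth_linear_compose[OF bounded_linear_minus[OF bounded_linear_ident]])

lemma smooth_diff: "smooth f \<Longrightarrow> smooth g \<Longrightarrow> smooth (\<lambda>x. f x - g x)"
  unfolding diff_conv_add_uminus by (intro smooth_add smooth_minus)

lemma smooth_affine_compose:
  assumes "bounded_linear A" "smooth f"
  shows "smooth (\<lambda>x. f (A x + b))"
proof -
  have "times_differentiable k f \<Longrightarrow> times_differentiable k (\<lambda>x. f (A x + b))" for k
  proof (induction k arbitrary: f)
    case 0
    then show ?case
      by (auto intro!: continuous_on_compose2[of UNIV f] continuous_intros
          bounded_linear.continuous_on[OF assms(1)])
  next
    case (Suc k)
    have A: "((\<lambda>x. A x + b) has_derivative A) (at x)" for x
      using has_derivative_add[OF bounded_linear_imp_has_derivative[OF assms(1)] has_derivative_const]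
      by fastforce
    show ?case
      by (rule times_differentiable_SucI[OF has_derivative_compose[OF A times_differentiable_SucD(1)[OF Suc.prems]]])
        (rule Suc.IH[OF times_differentiable_SucD(2)[OF Suc.prems]])
  qed
  then show ?thesis using assms(2) by (simp add: smooth_def)
qed

text \<open>For a real outer function \<open>pd g s y\<close> is \<open>s * pd g 1 y\<close>, so the
  chain rule yields a product and the induction runs over all \<open>g\<close> with \<open>f\<close>
  fixed.\<close>

lemma smooth_real_compose:
  fixes g :: "real \<Rightarrow> real" and f :: "'a::real_normed_vector \<Rightarrow> real"
  assumes "smooth g" "smooth f"
  shows "smooth (\<lambda>x. g (f x))"
proof -
  have "times_differentiable k g \<Longrightarrow> times_differentiable k f \<Longrightarrow> times_differentiable k (\<lambda>x. g (f x))" for k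
  proof (induction k arbitrary: g)
    case 0
    then show ?case by (auto intro: continuous_on_compose2)
  next
    case (Suc k)
    note g = times_differentiable_SucD[OF Suc.prems(1)] and f = times_differentiable_SucD[OF Suc.prems(2)]
    have lin: "pd g s y = s * pd g 1 y" for s y
      using linear_scale[OF bounded_linear.linear[OF has_derivative_bounded_linear[OF g(1)[of y]]], of s 1] by simp
    have D: "((\<lambda>x. g (f x)) has_derivative (\<lambda>h. pd f h x * pd g 1 (f x))) (at x)" for x
      using has_derivative_compose[OF f(1) g(1)] by (simp add: lin[symmetric])
    show ?case
      by (rule times_differentiable_SucI[OF D])
        (rule times_differentiable_bilinear[OF bounded_bilinear_mult f(2)
            Suc.IH[OF g(2) times_differentiable_lower[OF Suc.prems(2)]]])
  qed
  then show ?thesis using assms by (simp add: smooth_def)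
qed

text \<open>Smoothness is local. The inner cutoff of the stream function relies on this, as it
  subtracts a constant that varies from place to place.\<close>

lemma smooth_locally:
  assumes "\<And>x. \<exists>U g. open U \<and> x \<in> U \<and> smooth g \<and> (\<forall>y\<in>U. f y = g y)"
  shows "smooth f"
proof -
  have "(\<And>x. \<exists>U g. open U \<and> x \<in> U \<and> times_differentiable k g \<and> (\<forall>y\<in>U. f y = g y)) \<Longrightarrow>
     times_differentiable k f" for k
  proof (induction k arbitrary: f)
    case 0
    have "isCont f x" for x
    proof -
      from 0[of x] obtain U g where U: "open U" "x \<in> U" "continuous_on UNIV g" "\<forall>y\<in>U. f y = g y" by auto
      then have "continuous_on U f" using continuous_on_subset continuous_on_cong by (metis subset_UNIV)
      then show ?thesis using U continuous_on_eq_continuous_at by blast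
    qed
    then show ?case by (simp add: continuous_on_eq_continuous_at)
  next
    case (Suc k)
    have D: "\<exists>U g. open U \<and> x \<in> U \<and> times_differentiable (Suc k) g \<and>
      (\<forall>y\<in>U. (f has_derivative (\<lambda>h. pd g h y)) (at y))" for x
    proof -
      from Suc.prems[of x] obtain U g where U: "open U" "x \<in> U" "times_differentiable (Suc k) g" "\<forall>y\<in>U. f y = g y" by auto
      have "\<forall>y\<in>U. (f has_derivative (\<lambda>h. pd g h y)) (at y)"
        using has_derivative_transform_within_open[OF times_differentiable_SucD(1)[OF U(3)] U(1)] U(4) by auto
      with U show ?thesis by blast
    qed
    have diff: "f differentiable (at x)" for x
      using D[of x] by (auto simp: differentiable_def)
    have "\<exists>U g. open U \<and> x \<in> U \<and> times_differentiable k g \<and> (\<forall>y\<in>U. pd f h y = g y)" for x h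
    proof -
      from D[of x] obtain U g where U: "open U" "x \<in> U" "times_differentiable (Suc k) g"
        "\<forall>y\<in>U. (f has_derivative (\<lambda>h. pd g h y)) (at y)" by auto
      then show ?thesis
        by (intro exI[of _ U] exI[of _ "pd g h"]) (auto intro: times_differentiable_SucD(2) dest: pd_eqI)
    qed
    then have "times_differentiable k (pd f h)" for h by (rule Suc.IH)
    then show ?case using diff by (simp add: times_differentiable_Suc)
  qed
  moreover have "\<exists>U g. open U \<and> x \<in> U \<and> times_differentiable k g \<and> (\<forall>y\<in>U. f y = g y)" for k x
    using assms[of x] unfolding smooth_def by blast
  ultimately show ?thesis unfolding smooth_def by blast
qed

lemma pd_cong_open: "open U \<Longrightarrow> x \<in> U \<Longrightarrow> (\<And>y. y \<in> U \<Longrightarrow> f y = g y) \<Longrightarrow> smooth g \<Longrightarrow> pd f h x = pd g h x"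
  by (rule pd_eqI) (rule has_derivative_transform_within_open[OF smooth_has_derivative], auto)

section \<open>A smooth bump function\<close>

text \<open>The classical flat function \<open>exp (- 1 / t)\<close> together with its quotients by
  powers of \<open>t\<close>: differentiation maps index \<open>k\<close> to a combination of the
  indices \<open>k + 1\<close> and \<open>k + 2\<close>, so smoothness of the whole family is one
  induction.\<close>

definition flat_exp :: "nat \<Rightarrow> real \<Rightarrow> real"
  where "flat_exp k t = (if t > 0 then exp (- 1 / t) / t ^ k else 0)"

lemma power_div_fact_le_exp:
  assumes "(x::real) \<ge> 0"
  shows "x ^ n / fact n \<le> exp x"
proof -
  have "(\<Sum>i\<in>{n}. inverse (fact i) * x ^ i) \<le> (\<Sum>i. inverse (fact i) * x ^ i)"
    by (rule sum_le_suminf[OF summable_exp]) (use assms in auto)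
  also have "\<dots> = exp x"
    using sums_unique[OF exp_converges[of x]] by simp
  finally show ?thesis by (simp add: field_simps)
qed

text \<open>A single term of the exponential series at \<open>1 / t\<close>, of order
  \<open>k + 2\<close>, beats the pole \<open>t ^ k\<close> and leaves \<open>t\<^sup>2\<close>,
  enough for a vanishing derivative at 0.\<close>

lemma flat_exp_le:
  assumes t: "t > 0"
  shows "\<bar>flat_exp k t\<bar> \<le> fact (k + 2) * t\<^sup>2"
proof -
  have "(1/t) ^ (k+2) / fact (k+2) \<le> exp (1/t)"
    using t by (intro power_div_fact_le_exp) auto
  then have "1 / exp (1/t) \<le> fact (k+2) * t^(k+2)"
    using t by (simp add: power_one_over pos_divide_le_eq divide_le_eq mult.commute mult.left_commute)
  then have "exp (-(1/t)) / t ^ k \<le> fact (k+2) * t^(k+2) / t ^ k"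
    using t by (intro divide_right_mono) (simp_all add: exp_minus inverse_eq_divide)
  also have "\<dots> = fact (k+2) * t\<^sup>2"
    using t by (simp add: power_add power2_eq_square)
  finally show ?thesis
    using t by (simp add: flat_exp_def)
qed

lemma flat_exp_has_derivative:
  "(flat_exp k has_derivative (\<lambda>h. h * (flat_exp (k+2) t - real k * flat_exp (k+1) t))) (at t)"
proof -
  have "(flat_exp k has_real_derivative (flat_exp (k+2) t - real k * flat_exp (k+1) t)) (at t)"
  proof (cases t "0::real" rule: linorder_cases)
    case less
    have "((\<lambda>x. 0) has_real_derivative 0) (at t)" by simp
    then have "(flat_exp k has_real_derivative 0) (at t)"
      by (rule has_field_derivative_transform_within_open[where S="{..<0}"]) (use less in \<open>auto simp: flat_exp_def\<close>)
    then show ?thesis using less by (simp add: flat_exp_def)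
  next
    case greater
    have "((\<lambda>x. exp (- 1 / x) / x ^ k) has_real_derivative
        (exp (-1/t) / t\<^sup>2 * t ^ k - exp (-1/t) * (real k * t ^ (k-1))) / (t ^ k * t ^ k)) (at t)"
      using greater by (auto intro!: derivative_eq_intros simp: power2_eq_square)
    moreover have "(e / t\<^sup>2 * t ^ k - e * (real k * t ^ (k-1))) / (t ^ k * t ^ k) =
        e / t ^ (k+2) - real k * (e / t ^ (k+1))" for e
    proof (cases k)
      case 0
      then show ?thesis by (simp add: power2_eq_square)
    next
      case (Suc m)
      define q where "q = t ^ m"
      have "q \<noteq> 0" using greater by (simp add: q_def)
      have tk: "t ^ k = t * q" "t ^ (k+1) = t * t * q" "t ^ (k+2) = t * t * t * q" "t ^ (k - 1) = q"
        by (simp_all add: Suc q_def)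
      show ?thesis
        unfolding tk power2_eq_square using greater \<open>q \<noteq> 0\<close> by (simp add: divide_simps) (simp add: algebra_simps)
    qed
    ultimately have "((\<lambda>x. exp (- 1 / x) / x ^ k) has_real_derivative
        (flat_exp (k+2) t - real k * flat_exp (k+1) t)) (at t)"
      using greater by (simp add: flat_exp_def)
    then show ?thesis
      by (rule has_field_derivative_transform_within_open[where S="{0<..}"]) (use greater in \<open>auto simp: flat_exp_def\<close>)
  next
    case equal
    have "((\<lambda>y. (flat_exp k y - flat_exp k 0) / (y - 0)) \<longlongrightarrow> 0) (at 0)"
    proof (rule Lim_null_comparison)
      show "\<forall>\<^sub>F y in at 0. norm ((flat_exp k y - flat_exp k 0) / (y - 0)) \<le> fact (k+2) * \<bar>y\<bar>"
      proof (rule eventuallyI)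
        fix y :: real
        show "norm ((flat_exp k y - flat_exp k 0) / (y - 0)) \<le> fact (k+2) * \<bar>y\<bar>"
        proof (cases "y > 0")
          case True
          with flat_exp_le[OF True, of k] show ?thesis
            by (simp add: flat_exp_def divide_le_eq power2_eq_square algebra_simps)
        next
          case False
          then have "flat_exp k y = 0" "flat_exp k 0 = 0" by (simp_all add: flat_exp_def)
          then show ?thesis by simp
        qed
      qed
      show "((\<lambda>y::real. fact (k+2) * \<bar>y\<bar>) \<longlongrightarrow> 0) (at 0)"
        by (auto intro!: tendsto_eq_intros)
    qed
    then show ?thesis
      using equal by (simp add: has_field_derivative_iff flat_exp_def)
  qed
  moreover have "(\<lambda>h. h * (flat_exp (k+2) t - real k * flat_exp (k+1) t)) =
      (*) (flat_exp (k+2) t - real k * flat_exp (k+1) t)"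
    by (rule ext) (rule mult.commute)
  ultimately show ?thesis
    unfolding has_field_derivative_def by simp
qed

lemma smooth_flat_exp: "smooth (flat_exp k)"
proof -
  have "times_differentiable n (flat_exp k)" for n
  proof (induction n arbitrary: k)
    case 0
    then show ?case
      using has_derivative_continuous[OF flat_exp_has_derivative] by (auto simp: continuous_on_eq_continuous_at)
  next
    case (Suc n)
    have "bounded_linear (\<lambda>x::real. c * x)" for c by (rule bounded_linear_mult_right)
    then have "times_differentiable n (\<lambda>t. h * (flat_exp (k+2) t + (- real k) * flat_exp (k+1) t))" for h
      by (intro times_differentiable_bilinear[OF bounded_bilinear_mult] times_differentiable_const
          times_differentiable_add Suc.IH)
    then show ?case
      by (intro times_differentiable_SucI[OF flat_exp_has_derivative]) simp
  qed
  then show ?thesis by (simp add: smooth_def)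
qed

definition bump :: "'a::real_inner \<Rightarrow> real"
  where "bump x = flat_exp 0 (1 - x \<bullet> x)"

lemma smooth_bump: "smooth bump"
  unfolding bump_def[abs_def]
  by (rule smooth_real_compose[OF smooth_flat_exp smooth_diff[OF smooth_const
        smooth_inner[OF smooth_bounded_linear smooth_bounded_linear]]]) (rule bounded_linear_ident)+

lemma bump_nonneg: "bump x \<ge> 0"
  by (simp add: bump_def flat_exp_def)

lemma bump_pos: "norm x < 1 \<Longrightarrow> bump x > 0"
  using power_less_one_iff[of "norm x" 2] by (simp add: bump_def flat_exp_def dot_square_norm)

lemma bump_eq_0: "norm x \<ge> 1 \<Longrightarrow> bump x = 0"
  by (simp add: not_less one_le_power bump_def flat_exp_def dot_square_norm)

section \<open>Integrals of translates\<close>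

text \<open>One construction serves three times: \<open>T = uminus\<close> gives a convolution, the
  identity with weight 1 gives an average over a box, and \<open>T t = t *\<^sub>R d\<close> an
  integral along a segment.\<close>

definition avg :: "'c::euclidean_space \<Rightarrow> 'c \<Rightarrow> ('c \<Rightarrow> real) \<Rightarrow> ('c \<Rightarrow> 'a::euclidean_space) \<Rightarrow>
    ('a \<Rightarrow> 'b::euclidean_space) \<Rightarrow> 'a \<Rightarrow> 'b"
  where "avg l r a T g x = integral (cbox l r) (\<lambda>y. a y *\<^sub>R g (x + T y))"

lemma continuous_on_Blinfun_pd:
  fixes g :: "'a::euclidean_space \<Rightarrow> 'b::euclidean_space"
  assumes "smooth g"
  shows "continuous_on S (\<lambda>x. Blinfun (\<lambda>h. pd g h x))"
  by (rule continuous_on_blinfun_componentwise)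
    (simp add: bounded_linear_Blinfun_apply[OF smooth_bounded_linear_pd[OF assms]]
      smooth_continuous_on smooth_pd assms)

context
  fixes l r :: "'c::euclidean_space" and a :: "'c \<Rightarrow> real" and T :: "'c \<Rightarrow> 'a::euclidean_space"
  assumes a: "continuous_on (cbox l r) a" and T: "continuous_on (cbox l r) T"
begin

lemma avg_integrable:
  fixes g :: "'a \<Rightarrow> 'b::euclidean_space"
  assumes "continuous_on UNIV g"
  shows "(\<lambda>y. a y *\<^sub>R g (x + T y)) integrable_on cbox l r"
  by (intro integrable_continuous continuous_intros a continuous_on_compose2[OF assms] T) auto

text \<open>Differentiation under the integral sign. The Leibniz rule for parameter integrals wants
  an operator-valued derivative that is jointly continuous, hence the passage through
  \<open>Blinfun\<close>.\<close>

lemma avg_has_derivative: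
  fixes g :: "'a \<Rightarrow> 'b::euclidean_space"
  assumes g: "smooth g"
  shows "(avg l r a T g has_derivative (\<lambda>h. avg l r a T (pd g h) x)) (at x)"
proof -
  note bl = smooth_bounded_linear_pd[OF g]
  let ?fx = "\<lambda>x y. a y *\<^sub>R Blinfun (\<lambda>h. pd g h (x + T y))"
  have D: "((\<lambda>x. integral (cbox l r) (\<lambda>y. a y *\<^sub>R g (x + T y))) has_derivative
      integral (cbox l r) (?fx x)) (at x within UNIV)"
  proof (rule leibniz_rule)
    fix x y
    have "((\<lambda>x. g (x + T y)) has_derivative (\<lambda>h. pd g h (x + T y))) (at x)"
      using has_derivative_compose[OF has_derivative_add[OF has_derivative_ident has_derivative_const] smooth_has_derivative[OF g], of "T y" x UNIV]
      by simp
    moreover have "blinfun_apply (?fx x y) = (\<lambda>h. a y *\<^sub>R pd g h (x + T y))"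
      by (rule ext) (simp add: blinfun.scaleR_left bounded_linear_Blinfun_apply[OF bl])
    ultimately show "((\<lambda>x. a y *\<^sub>R g (x + T y)) has_derivative blinfun_apply (?fx x y)) (at x within UNIV)"
      by (simp add: has_derivative_scaleR_right)
  next
    show "(\<lambda>y. a y *\<^sub>R g (x + T y)) integrable_on cbox l r" for x
      by (rule avg_integrable[OF smooth_continuous_on[OF g]])
    show "continuous_on (UNIV \<times> cbox l r) (\<lambda>(x, y). ?fx x y)"
      unfolding split_beta
      by (intro continuous_intros continuous_on_compose2[OF a]
          continuous_on_compose2[OF continuous_on_Blinfun_pd[OF g]] continuous_on_compose2[OF T])
        auto
  qed auto
  have int: "?fx x integrable_on cbox l r"
    by (intro integrable_continuous continuous_intros a T
          continuous_on_compose2[OF continuous_on_Blinfun_pd[OF g]]) auto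
  have "blinfun_apply (integral (cbox l r) (?fx x)) = (\<lambda>h. avg l r a T (pd g h) x)"
    by (rule ext) (simp add: blinfun_apply_integral[OF int] avg_def blinfun.scaleR_left
        bounded_linear_Blinfun_apply[OF bl])
  with D show ?thesis by (simp add: avg_def[abs_def])
qed

lemma pd_avg:
  fixes g :: "'a \<Rightarrow> 'b::euclidean_space"
  shows "smooth g \<Longrightarrow> pd (avg l r a T g) h x = avg l r a T (pd g h) x"
  by (rule pd_eqI[OF avg_has_derivative])

lemma smooth_avg:
  fixes g :: "'a \<Rightarrow> 'b::euclidean_space"
  assumes "smooth g"
  shows "smooth (avg l r a T g)"
proof -
  have "times_differentiable k (avg l r a T g)" if "smooth g" for k and g :: "'a \<Rightarrow> 'b"
    using that
  proof (induction k arbitrary: g)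
    case 0
    show ?case
      using has_derivative_continuous[OF avg_has_derivative[OF 0]] by (auto simp: continuous_on_eq_continuous_at)
  next
    case (Suc k)
    show ?case
      by (rule times_differentiable_SucI[OF avg_has_derivative[OF Suc.prems]])
        (rule Suc.IH[OF smooth_pd[OF Suc.prems]])
  qed
  then show ?thesis using assms by (simp add: smooth_def)
qed

end

section \<open>Symmetry of second derivatives and potentials\<close>

lemma smooth_line_has_vector_derivative:
  assumes "smooth f"
  shows "((\<lambda>t. f (x + t *\<^sub>R k)) has_vector_derivative pd f k (x + t *\<^sub>R k)) (at t within S)"
proof -
  have "((\<lambda>t. x + t *\<^sub>R k) has_derivative (\<lambda>t. t *\<^sub>R k)) (at t)"
    by (auto intro!: derivative_eq_intros)
  from has_derivative_compose[OF this smooth_has_derivative[OF assms]]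
  have "((\<lambda>t. f (x + t *\<^sub>R k)) has_derivative (\<lambda>s. pd f (s *\<^sub>R k) (x + t *\<^sub>R k))) (at t)" .
  moreover have "pd f (s *\<^sub>R k) y = s *\<^sub>R pd f k y" for s y
    using linear_scale[OF bounded_linear.linear[OF smooth_bounded_linear_pd[OF assms]]] by blast
  ultimately show ?thesis
    by (auto simp: has_vector_derivative_def intro: has_derivative_at_withinI)
qed

lemma smooth_line_integral:
  fixes f :: "'a::euclidean_space \<Rightarrow> 'b::euclidean_space"
  assumes "smooth f" "t \<ge> 0"
  shows "f (x + t *\<^sub>R k) - f x = avg 0 t (\<lambda>_. 1) (\<lambda>s. s *\<^sub>R k) (pd f k) x"
proof -
  have "((\<lambda>s. pd f k (x + s *\<^sub>R k)) has_integral (f (x + t *\<^sub>R k) - f (x + 0 *\<^sub>R k))) {0..t}"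
    by (rule fundamental_theorem_of_calculus[OF assms(2)])
      (rule smooth_line_has_vector_derivative[OF assms(1)])
  then show ?thesis by (simp add: avg_def integral_unique)
qed

text \<open>Differentiate \<open>f (x + t k) - f x = \<integral>\<^sub>0\<^sup>t \<partial>\<^sub>k f (x + s k) ds\<close> first in the direction
  \<open>h\<close> and then in \<open>t\<close>.\<close>

lemma pd_commute:
  fixes f :: "'a::euclidean_space \<Rightarrow> 'b::euclidean_space"
  assumes f: "smooth f"
  shows "pd (pd f h) k x = pd (pd f k) h x"
proof -
  let ?T = "\<lambda>s::real. s *\<^sub>R k"
  have eq: "pd f h (x + t *\<^sub>R k) - pd f h x = integral {0..t} (\<lambda>s. pd (pd f k) h (x + s *\<^sub>R k))"
    if "t \<ge> 0" for t
  proof -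
    have "((\<lambda>x. f (x + t *\<^sub>R k) - f x) has_derivative (\<lambda>h. pd f h (x + t *\<^sub>R k) - pd f h x)) (at x)"
      using has_derivative_diff[OF has_derivative_compose[OF has_derivative_add[OF has_derivative_ident
            has_derivative_const[of "t *\<^sub>R k"]] smooth_has_derivative[OF f]] smooth_has_derivative[OF f]]
      by simp
    moreover have "(\<lambda>x. f (x + t *\<^sub>R k) - f x) = avg 0 t (\<lambda>_. 1) ?T (pd f k)"
      by (rule ext) (rule smooth_line_integral[OF f that])
    ultimately have "pd f h (x + t *\<^sub>R k) - pd f h x = pd (avg 0 t (\<lambda>_. 1) ?T (pd f k)) h x"
      by (simp add: pd_eqI)
    also have "\<dots> = avg 0 t (\<lambda>_. 1) ?T (pd (pd f k) h) x"
      by (intro pd_avg continuous_intros smooth_pd f)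
    finally show ?thesis by (simp add: avg_def)
  qed
  have cont: "continuous_on {0..1} (\<lambda>s. pd (pd f k) h (x + s *\<^sub>R k))"
    by (intro continuous_on_compose2[OF smooth_continuous_on[OF smooth_pd[OF smooth_pd[OF f]], of UNIV]] continuous_intros) auto
  have "((\<lambda>t. integral {0..t} (\<lambda>s. pd (pd f k) h (x + s *\<^sub>R k))) has_vector_derivative
      pd (pd f k) h (x + 0 *\<^sub>R k)) (at 0 within {0..1})"
    by (rule integral_has_vector_derivative[OF cont]) auto
  then have *: "((\<lambda>t. integral {0..t} (\<lambda>s. pd (pd f k) h (x + s *\<^sub>R k))) has_vector_derivative
      pd (pd f k) h x) (at 0 within {0..1})" by simp
  have "((\<lambda>t. pd f h (x + t *\<^sub>R k) - pd f h x) has_vector_derivative pd (pd f k) h x) (at 0 within {0..1})"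
  proof (rule has_vector_derivative_transform[OF _ _ *])
    fix t :: real assume "t \<in> {0..1}"
    then show "pd f h (x + t *\<^sub>R k) - pd f h x = integral {0..t} (\<lambda>s. pd (pd f k) h (x + s *\<^sub>R k))"
      by (intro eq) simp
  qed simp
  moreover have "((\<lambda>t. pd f h (x + t *\<^sub>R k) - pd f h x) has_vector_derivative pd (pd f h) k x) (at 0 within {0..1})"
  proof -
    have 1: "((\<lambda>t. pd f h (x + t *\<^sub>R k)) has_vector_derivative pd (pd f h) k (x + 0 *\<^sub>R k)) (at 0 within {0..1})"
      by (rule smooth_line_has_vector_derivative[OF smooth_pd[OF f]])
    from has_vector_derivative_diff[OF 1 has_vector_derivative_const[of "pd f h x"]]
    show ?thesis by simp
  qed
  moreover have "at (0::real) within {0..1} \<noteq> bot"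
    by (simp add: at_within_Icc_at_right)
  ultimately show ?thesis
    using vector_derivative_unique_within by metis
qed

text \<open>The Poincare lemma on the whole space: a field with symmetric derivative is integrated
  along the rays from the origin.\<close>

lemma smooth_potential:
  fixes F :: "'a::euclidean_space \<Rightarrow> 'a"
  assumes F: "smooth F" and sym: "\<And>x h k. pd F h x \<bullet> k = pd F k x \<bullet> h"
  obtains \<Psi> :: "'a \<Rightarrow> real" where "smooth \<Psi>" "\<And>x h. pd \<Psi> h x = F x \<bullet> h"
proof -
  define \<Psi> where "\<Psi> x = integral (cbox 0 1) (\<lambda>t::real. F (t *\<^sub>R x) \<bullet> x)" for x
  note bl = smooth_bounded_linear_pd[OF F]
  note cont = continuous_on_compose2[OF smooth_continuous_on[OF F, of UNIV]]
  let ?fx = "\<lambda>x t. Blinfun (\<lambda>h. pd F (t *\<^sub>R h) (t *\<^sub>R x) \<bullet> x + F (t *\<^sub>R x) \<bullet> h)"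
  have pd_scale: "pd F (t *\<^sub>R h) y = t *\<^sub>R pd F h y" for t h y
    using linear_scale[OF bounded_linear.linear[OF bl]] by blast
  have D0: "((\<lambda>x. F (t *\<^sub>R x) \<bullet> x) has_derivative
      (\<lambda>h. pd F (t *\<^sub>R h) (t *\<^sub>R x) \<bullet> x + F (t *\<^sub>R x) \<bullet> h)) (at x)" for x t
  proof -
    have "((\<lambda>x. F (t *\<^sub>R x)) has_derivative (\<lambda>h. pd F (t *\<^sub>R h) (t *\<^sub>R x))) (at x)"
      by (rule has_derivative_compose[OF _ smooth_has_derivative[OF F]]) (auto intro!: derivative_eq_intros)
    from has_derivative_inner[OF this has_derivative_ident] show ?thesis by (simp add: add.commute)
  qed
  note bl2 = has_derivative_bounded_linear[OF D0]
  have contfx: "continuous_on S (\<lambda>p. ?fx (fst p) (snd p))" for S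
  proof (rule continuous_on_blinfun_componentwise)
    fix i :: 'a
    show "continuous_on S (\<lambda>p. blinfun_apply (?fx (fst p) (snd p)) i)"
      apply (simp only: bounded_linear_Blinfun_apply[OF bl2])
      apply (simp only: pd_scale)
      by (intro continuous_intros cont
        continuous_on_compose2[OF smooth_continuous_on[OF smooth_pd[OF F], of UNIV]]) auto
  qed
  have D: "(\<Psi> has_derivative (\<lambda>h. F x \<bullet> h)) (at x)" for x
  proof -
    have D1: "(\<Psi> has_derivative integral (cbox 0 1) (?fx x)) (at x within UNIV)"
      unfolding \<Psi>_def[abs_def]
    proof (rule leibniz_rule)
      show "((\<lambda>x. F (t *\<^sub>R x) \<bullet> x) has_derivative blinfun_apply (?fx x t)) (at x within UNIV)" for x t
        using D0 by (simp add: bounded_linear_Blinfun_apply[OF bl2])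
      show "(\<lambda>t. F (t *\<^sub>R x) \<bullet> x) integrable_on cbox 0 (1::real)" for x
        by (intro integrable_continuous continuous_intros cont) auto
      show "continuous_on (UNIV \<times> cbox 0 (1::real)) (\<lambda>(x, t). ?fx x t)"
        unfolding split_beta by (rule contfx)
    qed auto
    have int: "?fx x integrable_on cbox 0 (1::real)"
      by (intro integrable_continuous continuous_on_compose2[OF contfx[of UNIV], of _ "\<lambda>t. (x,t)", simplified] continuous_intros)
    have "blinfun_apply (integral (cbox 0 1) (?fx x)) h = F x \<bullet> h" for h
    proof -
      \<comment> \<open>Symmetry exchanges \<open>h\<close> and \<open>x\<close> in the term with
        \<open>pd F\<close>, so the differentiated integrand is the exact derivative of
        \<open>t *\<^sub>R (F (t *\<^sub>R x) \<bullet> h)\<close>, whose boundary values are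
        \<open>F x \<bullet> h\<close> and 0.\<close>
      have "((\<lambda>t. t *\<^sub>R (F (t *\<^sub>R x) \<bullet> h)) has_vector_derivative
          (pd F (t *\<^sub>R h) (t *\<^sub>R x) \<bullet> x + F (t *\<^sub>R x) \<bullet> h)) (at t within {0..1})" for t :: real
      proof -
        have 1: "((\<lambda>t. F (t *\<^sub>R x)) has_vector_derivative pd F x (t *\<^sub>R x)) (at t within {0..1})"
          using smooth_line_has_vector_derivative[OF F, of 0 x t] by simp
        have "((\<lambda>t. F (t *\<^sub>R x) \<bullet> h) has_vector_derivative pd F x (t *\<^sub>R x) \<bullet> h) (at t within {0..1})"
          by (rule bounded_linear.has_vector_derivative[OF bounded_linear_inner_left 1])
        from has_vector_derivative_scaleR[OF DERIV_ident this]
        show ?thesis by (simp add: pd_scale sym[of x "t *\<^sub>R x" h] algebra_simps)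
      qed
      then have "((\<lambda>t. pd F (t *\<^sub>R h) (t *\<^sub>R x) \<bullet> x + F (t *\<^sub>R x) \<bullet> h) has_integral
          (1 *\<^sub>R (F (1 *\<^sub>R x) \<bullet> h) - 0 *\<^sub>R (F (0 *\<^sub>R x) \<bullet> h))) {0..1::real}"
        by (intro fundamental_theorem_of_calculus) auto
      then show ?thesis
        unfolding blinfun_apply_integral[OF int] bounded_linear_Blinfun_apply[OF bl2]
        by (simp add: integral_unique)
    qed
    then have "blinfun_apply (integral (cbox 0 1) (?fx x)) = (\<lambda>h. F x \<bullet> h)" by blast
    with D1 show ?thesis by simp
  qed
  show thesis
  proof
    show "smooth \<Psi>" by (rule smoothI[OF D]) (intro smooth_inner F smooth_const)
    show "pd \<Psi> h x = F x \<bullet> h" for x h by (rule pd_eqI[OF D])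
  qed
qed

section \<open>Cutoff functions\<close>

lemma pd_add: "smooth f \<Longrightarrow> smooth g \<Longrightarrow> pd (\<lambda>x. f x + g x) h x = pd f h x + pd g h x"
  by (rule pd_eqI[OF has_derivative_add[OF smooth_has_derivative smooth_has_derivative]])

lemma pd_diff: "smooth f \<Longrightarrow> smooth g \<Longrightarrow> pd (\<lambda>x. f x - g x) h x = pd f h x - pd g h x"
  by (rule pd_eqI[OF has_derivative_diff[OF smooth_has_derivative smooth_has_derivative]])

lemma pd_const [simp]: "pd (\<lambda>x. c) h x = 0"
  by (rule pd_eqI[OF has_derivative_const])

lemma pd_mult:
  fixes f g :: "'a::real_normed_vector \<Rightarrow> real"
  shows "smooth f \<Longrightarrow> smooth g \<Longrightarrow> pd (\<lambda>x. f x * g x) h x = f x * pd g h x + pd f h x * g x"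
  by (rule pd_eqI[OF has_derivative_mult[OF smooth_has_derivative smooth_has_derivative]])

lemma pd_linear_compose:
  "bounded_linear L \<Longrightarrow> smooth f \<Longrightarrow> pd (\<lambda>x. L (f x)) h x = L (pd f h x)"
  by (rule pd_eqI[OF bounded_linear.has_derivative[OF _ smooth_has_derivative]])

lemma pd_affine_compose:
  assumes "bounded_linear A" "smooth f"
  shows "pd (\<lambda>x. f (A x + b)) h x = pd f (A h) (A x + b)"
proof -
  have A: "((\<lambda>x. A x + b) has_derivative A) (at x)"
    using has_derivative_add[OF bounded_linear_imp_has_derivative[OF assms(1)] has_derivative_const[of b]]
    by simp
  show ?thesis by (rule pd_eqI[OF has_derivative_compose[OF A smooth_has_derivative[OF assms(2)]]])
qed

lemma pd_scaleR_arg: "smooth f \<Longrightarrow> pd f (c *\<^sub>R h) x = c *\<^sub>R pd f h x"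
  using linear_scale[OF bounded_linear.linear[OF smooth_bounded_linear_pd]] by blast

lemma pd_eq_0_open:
  assumes "open U" "x \<in> U" "\<And>y. y \<in> U \<Longrightarrow> f y = c"
  shows "pd f h x = 0"
  using pd_cong_open[OF assms(1,2), of f "\<lambda>_. c"] assms(3) by simp

lemma pd_Basis_sum:
  fixes f :: "'a::euclidean_space \<Rightarrow> 'b::real_normed_vector"
  assumes "smooth f"
  shows "pd f h x = (\<Sum>b\<in>Basis. (h \<bullet> b) *\<^sub>R pd f b x)"
proof -
  have lin: "linear (\<lambda>h. pd f h x)" by (rule bounded_linear.linear[OF smooth_bounded_linear_pd[OF assms]])
  have "pd f h x = pd f (\<Sum>b\<in>Basis. (h \<bullet> b) *\<^sub>R b) x" by (simp only: euclidean_representation)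
  also have "\<dots> = (\<Sum>b\<in>Basis. (h \<bullet> b) *\<^sub>R pd f b x)"
    by (simp add: linear_sum[OF lin] pd_scaleR_arg[OF assms])
  finally show ?thesis .
qed

section \<open>Bounds for functions of compact support\<close>

lemma bounded_of_compact_support:
  fixes f :: "'a::euclidean_space \<Rightarrow> 'b::real_normed_vector"
  assumes "continuous_on UNIV f" "\<And>x. norm x > r \<Longrightarrow> f x = 0"
  obtains M where "M \<ge> 0" "\<And>x. norm (f x) \<le> M"
proof -
  have "bounded (f ` cball 0 r)"
    by (intro compact_imp_bounded compact_continuous_image continuous_on_subset[OF assms(1)]) auto
  then obtain M where M: "M > 0" "\<And>x. x \<in> cball 0 r \<Longrightarrow> norm (f x) \<le> M"
    by (auto simp: bounded_pos)
  have "norm (f x) \<le> M" for x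
    using M assms(2)[of x] by (cases "norm x \<le> r") auto
  then show thesis using M(1) that[of M] by auto
qed

lemma pd_eq_0_of_support:
  fixes f :: "'a::euclidean_space \<Rightarrow> 'b::real_normed_vector"
  assumes "\<And>x. norm x > r \<Longrightarrow> f x = 0" "norm x > r"
  shows "pd f h x = 0"
proof (rule pd_eq_0_open)
  show "open {x::'a. norm x > r}"
    by (intro open_Collect_less continuous_intros)
qed (use assms in auto)

lemma pd_bounded_of_compact_support:
  fixes f :: "'a::euclidean_space \<Rightarrow> 'b::real_normed_vector"
  assumes f: "smooth f" and r: "\<And>x. norm x > r \<Longrightarrow> f x = 0"
  obtains M where "M \<ge> 0" "\<And>h x. norm (pd f h x) \<le> M * norm h"
proof -
  have "\<exists>M\<ge>0. \<forall>x. norm (pd f b x) \<le> M" for b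
  proof -
    obtain M where "M \<ge> 0" "\<And>x. norm (pd f b x) \<le> M"
      by (rule bounded_of_compact_support[of "pd f b" r])
        (auto intro: smooth_continuous_on smooth_pd f pd_eq_0_of_support r)
    then show ?thesis by blast
  qed
  then obtain m where m: "\<And>b. m b \<ge> 0" "\<And>b x. norm (pd f b x) \<le> m b" by metis
  show thesis
  proof
    show "(\<Sum>b\<in>Basis. m b) \<ge> 0" by (intro sum_nonneg m)
    fix h x
    have "norm (pd f h x) \<le> (\<Sum>b\<in>Basis. norm ((h \<bullet> b) *\<^sub>R pd f b x))"
      unfolding pd_Basis_sum[OF f, of h] by (rule norm_sum)
    also have "\<dots> \<le> (\<Sum>b\<in>Basis. norm h * m b)"
      by (intro sum_mono) (auto intro!: mult_mono m Basis_le_norm)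
    finally show "norm (pd f h x) \<le> (\<Sum>b\<in>Basis. m b) * norm h"
      by (simp add: sum_distrib_left[symmetric] mult.commute)
  qed
qed

text \<open>The direction \<open>h\<close> selects which function is differentiated; commuting the
  derivatives turns it into the outer direction, where linearity and the expansion over the basis
  are available.\<close>

lemma pd_pd_bounded_of_compact_support:
  fixes f :: "'a::euclidean_space \<Rightarrow> 'b::euclidean_space"
  assumes f: "smooth f" and r: "\<And>x. norm x > r \<Longrightarrow> f x = 0"
  obtains M where "M \<ge> 0" "\<And>h k x. norm (pd (pd f h) k x) \<le> M * norm h * norm k"
proof -
  have "\<exists>M\<ge>0. \<forall>h x. norm (pd (pd f b) h x) \<le> M * norm h" for b
  proof -
    obtain M where "M \<ge> 0" "\<And>h x. norm (pd (pd f b) h x) \<le> M * norm h"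
      by (rule pd_bounded_of_compact_support[of "pd f b" r])
        (auto intro: smooth_pd f pd_eq_0_of_support r)
    then show ?thesis by blast
  qed
  then obtain m where m: "\<And>b. m b \<ge> 0" "\<And>b h x. norm (pd (pd f b) h x) \<le> m b * norm h" by metis
  show thesis
  proof
    show "(\<Sum>b\<in>Basis. m b) \<ge> 0" by (intro sum_nonneg m)
    fix h k x
    have "norm (pd (pd f h) k x) = norm (\<Sum>b\<in>Basis. (h \<bullet> b) *\<^sub>R pd (pd f b) k x)"
      unfolding pd_commute[OF f, of h k x] pd_Basis_sum[OF smooth_pd[OF f], of k h]
      by (simp add: pd_commute[OF f, of k])
    also have "\<dots> \<le> (\<Sum>b\<in>Basis. norm ((h \<bullet> b) *\<^sub>R pd (pd f b) k x))" by (rule norm_sum)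
    also have "\<dots> \<le> (\<Sum>b\<in>Basis. norm h * (m b * norm k))"
      by (intro sum_mono) (auto intro!: mult_mono m Basis_le_norm)
    also have "\<dots> = (\<Sum>b\<in>Basis. m b) * norm h * norm k"
      by (simp add: sum_distrib_left[symmetric] sum_distrib_right[symmetric] mult_ac)
    finally show "norm (pd (pd f h) k x) \<le> (\<Sum>b\<in>Basis. m b) * norm h * norm k" .
  qed
qed

text \<open>The factor \<open>g\<close> confines \<open>y\<close> to a cube of side 2 around
  \<open>z\<close>, so the bound is independent of the box of integration. This is the source of
  cutoff constants that do not depend on the set to be cut off.\<close>

lemma avg_norm_bound:
  fixes g :: "'a::euclidean_space \<Rightarrow> 'b::euclidean_space"
  assumes g: "continuous_on UNIV g" "\<And>x. norm x > 1 \<Longrightarrow> g x = 0" "\<And>x. norm (g x) \<le> M"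
    and a: "continuous_on (cbox l r) a" "\<And>y. \<bar>a y\<bar> \<le> 1"
  shows "norm (avg l r a uminus g z) \<le> M * measure lborel (cbox (- One) One :: 'a set)"
proof -
  let ?Q = "cbox (z - One) (z + One)"
  have M: "M \<ge> 0" using g(3)[of 0] norm_ge_zero order_trans by blast
  have int: "(\<lambda>y. if y \<in> ?Q then M else 0) integrable_on cbox l r"
    unfolding integrable_restrict_Int by (simp add: Int_interval integrable_const)
  have le: "norm (a y *\<^sub>R g (z + - y)) \<le> (if y \<in> ?Q then M else 0)" for y
  proof (cases "norm (z - y) > 1")
    case True
    then show ?thesis using g(2) M by auto
  next
    case False
    have "y \<in> ?Q"
      unfolding mem_box
    proof
      fix i :: 'a assume i: "i \<in> Basis"
      have "\<bar>(z - y) \<bullet> i\<bar> \<le> 1" using Basis_le_norm[OF i, of "z - y"] False by linarith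
      then show "(z - One) \<bullet> i \<le> y \<bullet> i \<and> y \<bullet> i \<le> (z + One) \<bullet> i"
        using i by (auto simp: inner_diff_left inner_add_left)
    qed
    moreover have "\<bar>a y\<bar> * norm (g (z - y)) \<le> 1 * M" by (intro mult_mono a g) auto
    ultimately show ?thesis by simp
  qed
  have "norm (avg l r a uminus g z) \<le> integral (cbox l r) (\<lambda>y. if y \<in> ?Q then M else 0)"
    unfolding avg_def
    by (rule integral_norm_bound_integral[OF avg_integrable[OF a(1) _ g(1)] int le]) (intro continuous_intros)
  also have "\<dots> = integral (?Q \<inter> cbox l r) (\<lambda>y. M)" by (rule integral_restrict_Int)
  also have "\<dots> \<le> integral ?Q (\<lambda>y. M)"
  proof (rule integral_subset_le)
    show "(\<lambda>y. M) integrable_on (?Q \<inter> cbox l r)" unfolding Int_interval by (rule integrable_const)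
  qed (use M in \<open>auto intro: integrable_const\<close>)
  also have "\<dots> = M * measure lborel ?Q" by simp
  also have "measure lborel ?Q = measure lborel (cbox (- One) One :: 'a set)"
    by (simp add: content_cbox_cases inner_diff_left inner_add_left)
  finally show ?thesis .
qed

text \<open>The substitution \<open>y \<mapsto> z - y\<close> preserves volume, and
  \<open>bump\<close> vanishes off the unit ball, so only the part of the domain inside that ball
  matters. Positivity of the mass comes from \<open>bump 0 > 0\<close> and continuity.\<close>

lemma bump_has_integral_translate:
  obtains c where "c > 0" "\<And>(z::'a::euclidean_space) S. (\<And>y. norm (z - y) < 1 \<Longrightarrow> y \<in> S) \<Longrightarrow>
     ((\<lambda>y. bump (z - y)) has_integral c) S"
proof -
  let ?Q = "cbox (- One) (One::'a)"
  define c where "c = integral ?Q (bump :: 'a \<Rightarrow> real)"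
  have int: "((bump :: 'a \<Rightarrow> real) has_integral c) ?Q"
    unfolding c_def
    by (intro integrable_integral integrable_continuous smooth_continuous_on smooth_bump)
  have nz: "c \<noteq> 0"
  proof
    assume "c = 0"
    then have int0: "(bump has_integral 0) ?Q" using int by simp
    have "box (- One) (One::'a) \<noteq> {}" "0 \<in> ?Q" by (simp_all add: mem_box box_ne_empty)
    then have "bump (0::'a) = 0"
      by (rule has_integral_0_cbox_imp_0[OF smooth_continuous_on[OF smooth_bump] bump_nonneg int0])
    then show False using bump_pos[of "0::'a"] by simp
  qed
  have "c \<ge> 0" using int by (rule has_integral_nonneg) (rule bump_nonneg)
  have outside: "bump x = 0" if "x \<notin> ?Q" for x :: 'a
  proof (rule bump_eq_0, rule ccontr)
    assume "\<not> 1 \<le> norm x"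
    then have "\<bar>x \<bullet> i\<bar> \<le> 1" if "i \<in> Basis" for i using Basis_le_norm[OF that, of x] by linarith
    then have "x \<in> ?Q" by (auto simp: mem_box abs_le_iff)
    with that show False by blast
  qed
  have U: "((\<lambda>y. bump (z - y)) has_integral c) UNIV" for z :: 'a
  proof -
    have "((\<lambda>y. bump ((-1) *\<^sub>R y + z)) has_integral (1 / \<bar>-1\<bar> ^ DIM('a)) *\<^sub>R c)
        ((\<lambda>x. (1 / -1) *\<^sub>R x + -((1 / -1) *\<^sub>R z)) ` ?Q)"
      by (rule has_integral_affinity[OF int]) simp
    then have *: "((\<lambda>y. bump (z - y)) has_integral c) ((\<lambda>x. z - x) ` ?Q)" by simp
    show ?thesis
    proof (rule has_integral_on_superset[OF *])
      fix y assume "y \<notin> (\<lambda>x. z - x) ` ?Q"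
      then have "z - y \<notin> ?Q" by (metis (no_types, lifting) diff_diff_eq2 add_diff_cancel_left' image_eqI)
      then show "bump (z - y) = 0" by (rule outside)
    qed auto
  qed
  show thesis
  proof
    show "c > 0" using nz \<open>c \<ge> 0\<close> by simp
    fix z :: 'a and S :: "'a set"
    assume S: "\<And>y. norm (z - y) < 1 \<Longrightarrow> y \<in> S"
    have eq: "(\<lambda>y. if y \<in> S then bump (z - y) else 0) = (\<lambda>y. bump (z - y))"
    proof
      fix y show "(if y \<in> S then bump (z - y) else 0) = bump (z - y)"
        using S[of y] bump_eq_0[of "z - y"] by (cases "norm (z - y) < 1") auto
    qed
    show "((\<lambda>y. bump (z - y)) has_integral c) S"
      using U[of z] unfolding has_integral_restrict_UNIV[of S, symmetric] eq .
  qed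
qed

text \<open>The scaling of a cutoff that varies over a length \<open>\<delta>\<close>: each
  derivative costs a factor \<open>1 / \<delta>\<close>, with one constant for all orders up to
  two.\<close>

definition controlled :: "real \<Rightarrow> real \<Rightarrow> ('a::real_normed_vector \<Rightarrow> real) \<Rightarrow> bool"
  where "controlled C \<delta> \<zeta> \<longleftrightarrow> smooth \<zeta> \<and> (\<forall>x. \<bar>\<zeta> x\<bar> \<le> C) \<and>
      (\<forall>x h. \<bar>pd \<zeta> h x\<bar> \<le> C / \<delta> * norm h) \<and>
      (\<forall>x h k. \<bar>pd (pd \<zeta> h) k x\<bar> \<le> C / \<delta>\<^sup>2 * norm h * norm k)"

text \<open>A clamped function of the distance to \<open>A\<close>, rescaled to unit length, is
  convolved with the fixed \<open>bump\<close>. All derivatives fall on \<open>bump\<close>, so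
  \<open>C\<close> can be chosen before \<open>A\<close> and \<open>\<delta>\<close>.\<close>

lemma uniform_cutoffs:
  obtains C where "C > 0" "\<And>(A::'a::euclidean_space set) \<delta>. compact A \<Longrightarrow> A \<noteq> {} \<Longrightarrow> \<delta> > 0 \<Longrightarrow>
    \<exists>\<zeta>. controlled C \<delta> \<zeta> \<and>
      (\<forall>x. infdist x A < \<delta> \<longrightarrow> \<zeta> x = 1) \<and> (\<forall>x. infdist x A \<ge> 4 * \<delta> \<longrightarrow> \<zeta> x = 0)"
proof -
  let ?b = "bump :: 'a \<Rightarrow> real"
  have b0: "?b x = 0" if "norm x > 1" for x using that by (simp add: bump_eq_0 less_imp_le)
  note sb = smooth_bump[where 'a='a]
  obtain c where c: "c > 0" "\<And>(z::'a) S. (\<And>y. norm (z - y) < 1 \<Longrightarrow> y \<in> S) \<Longrightarrow>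
     ((\<lambda>y. bump (z - y)) has_integral c) S" by (rule bump_has_integral_translate[where 'a='a]) blast
  obtain M0 where M0: "M0 \<ge> 0" "\<And>x. norm (?b x) \<le> M0"
    by (rule bounded_of_compact_support[OF smooth_continuous_on[OF sb] b0]) auto
  obtain M1 where M1: "M1 \<ge> 0" "\<And>h x. norm (pd ?b h x) \<le> M1 * norm h"
    by (rule pd_bounded_of_compact_support[OF sb b0]) auto
  obtain M2 where M2: "M2 \<ge> 0" "\<And>h k x. norm (pd (pd ?b h) k x) \<le> M2 * norm h * norm k"
    by (rule pd_pd_bounded_of_compact_support[OF sb b0]) auto
  define V where "V = measure lborel (cbox (- One) (One::'a))"
  have V: "V \<ge> 0" unfolding V_def by (rule measure_nonneg)
  define C where "C = (M0 + M1 + M2 + 1) * (V + 1) / c"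
  have C: "C > 0" using c(1) M0 M1 M2 V by (auto simp: C_def intro!: divide_pos_pos mult_pos_pos)
  have leC: "m * V / c \<le> C" if "m \<le> M0 + M1 + M2 + 1" "m \<ge> 0" for m
    unfolding C_def using that c(1) V M0 M1 M2 by (intro divide_right_mono mult_mono) auto
  have "\<exists>\<zeta>. controlled C \<delta> \<zeta> \<and>
      (\<forall>x. infdist x A < \<delta> \<longrightarrow> \<zeta> x = 1) \<and> (\<forall>x. infdist x A \<ge> 4 * \<delta> \<longrightarrow> \<zeta> x = 0)"
    if A: "compact A" "A \<noteq> {}" and \<delta>: "\<delta> > 0" for A :: "'a set" and \<delta> :: real
  proof -
    \<comment> \<open>Equal to 1 up to distance \<open>2 * \<delta>\<close> and to 0 from
      \<open>3 * \<delta>\<close> on; smoothing over a further distance \<open>\<delta>\<close>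
      leaves the two plateaus required.\<close>
    define a where "a y = max 0 (min 1 (3 - infdist (\<delta> *\<^sub>R y) A / \<delta>))" for y
    have ca: "continuous_on S a" for S unfolding a_def using \<delta> by (intro continuous_intros) auto
    have a1: "\<bar>a y\<bar> \<le> 1" for y by (auto simp: a_def)
    have lip: "infdist (\<delta> *\<^sub>R y) A \<le> infdist (\<delta> *\<^sub>R z) A + \<delta> * norm (z - y)" for y z
    proof -
      have "infdist (\<delta> *\<^sub>R y) A \<le> infdist (\<delta> *\<^sub>R z) A + dist (\<delta> *\<^sub>R y) (\<delta> *\<^sub>R z)" by (rule infdist_triangle)
      also have "dist (\<delta> *\<^sub>R y) (\<delta> *\<^sub>R z) = \<delta> * norm (z - y)"
        using \<delta> by (simp add: dist_norm norm_minus_commute flip: scaleR_diff_right)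
      finally show ?thesis .
    qed
    have "bounded {y. infdist (\<delta> *\<^sub>R y) A \<le> 2 * \<delta>}"
    proof -
      obtain m where m: "\<And>x. x \<in> A \<Longrightarrow> norm x \<le> m" using compact_imp_bounded[OF A(1)] bounded_iff by blast
      have "norm y \<le> (m + 2 * \<delta>) / \<delta>" if "infdist (\<delta> *\<^sub>R y) A \<le> 2 * \<delta>" for y
      proof -
        obtain x where x: "x \<in> A" "infdist (\<delta> *\<^sub>R y) A = dist (\<delta> *\<^sub>R y) x"
          using infdist_attains_inf[OF compact_imp_closed[OF A(1)] A(2)] by blast
        have "norm (\<delta> *\<^sub>R y) \<le> norm x + dist (\<delta> *\<^sub>R y) x"
          unfolding dist_norm using norm_triangle_sub by blast
        then have "\<delta> * norm y \<le> m + 2 * \<delta>" using m[OF x(1)] x(2) that \<delta> by simp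
        then show ?thesis using \<delta> by (simp add: field_simps)
      qed
      then show ?thesis unfolding bounded_iff by auto
    qed
    \<comment> \<open>It is enough that the box contains the plateau of \<open>a\<close>: for points
      within \<open>\<delta>\<close> of \<open>A\<close> the kernel sees nothing else, and elsewhere
      truncating the weight is harmless.\<close>
    then obtain l r where lr: "{y. infdist (\<delta> *\<^sub>R y) A \<le> 2 * \<delta>} \<subseteq> cbox l r"
      using bounded_subset_cbox_symmetric by metis
    define X where "X = avg l r a uminus ?b"
    have cu: "continuous_on (cbox l r) (uminus :: 'a \<Rightarrow> 'a)" by (intro continuous_intros)
    have sX: "smooth X" unfolding X_def by (rule smooth_avg[OF ca cu sb])
    have pX: "pd X h z = avg l r a uminus (pd ?b h) z" for h z unfolding X_def by (rule pd_avg[OF ca cu sb])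
    have ppX: "pd (pd X h) k z = avg l r a uminus (pd (pd ?b h) k) z" for h k z
      using pd_avg[OF ca cu smooth_pd[OF sb]] pX[of h] by (metis ext)
    have bX: "\<bar>X z\<bar> \<le> M0 * V" for z
      using avg_norm_bound[OF smooth_continuous_on[OF sb] b0 M0(2) ca a1] by (simp add: X_def V_def)
    have bpX: "\<bar>pd X h z\<bar> \<le> M1 * norm h * V" for z h
      using avg_norm_bound[OF smooth_continuous_on[OF smooth_pd[OF sb]] pd_eq_0_of_support[OF b0] M1(2) ca a1]
      by (simp add: pX V_def)
    have bppX: "\<bar>pd (pd X h) k z\<bar> \<le> M2 * norm h * norm k * V" for z h k
      using avg_norm_bound[OF smooth_continuous_on[OF smooth_pd[OF smooth_pd[OF sb]]]
          pd_eq_0_of_support[OF pd_eq_0_of_support[OF b0]] M2(2) ca a1]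
      by (simp add: ppX V_def)
    have X1: "X z = c" if "infdist (\<delta> *\<^sub>R z) A < \<delta>" for z
    proof -
      have *: "infdist (\<delta> *\<^sub>R y) A \<le> 2 * \<delta>" if "norm (z - y) < 1" for y
      proof -
        have "\<delta> * norm (z - y) \<le> \<delta> * 1" using \<delta> that by (intro mult_left_mono) auto
        with lip[of y z] \<open>infdist (\<delta> *\<^sub>R z) A < \<delta>\<close> show ?thesis by linarith
      qed
      have "a y *\<^sub>R ?b (z + - y) = ?b (z - y)" for y
      proof (cases "norm (z - y) < 1")
        case True
        from *[OF this] have "infdist (\<delta> *\<^sub>R y) A / \<delta> \<le> 2" using \<delta> by (simp add: field_simps)
        then have "a y = 1" by (auto simp: a_def)
        then show ?thesis by simp
      qed (use bump_eq_0[of "z - y"] in auto)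
      then have "X z = integral (cbox l r) (\<lambda>y. ?b (z - y))" unfolding X_def avg_def by (simp only:)
      also have "\<dots> = c" by (intro integral_unique c(2)) (use * lr in auto)
      finally show ?thesis .
    qed
    have X0: "X z = 0" if "infdist (\<delta> *\<^sub>R z) A \<ge> 4 * \<delta>" for z
    proof -
      have "a y *\<^sub>R ?b (z + - y) = 0" for y
      proof (cases "norm (z - y) < 1")
        case True
        then have "\<delta> * norm (y - z) \<le> \<delta> * 1"
          using \<delta> by (intro mult_left_mono) (auto simp: norm_minus_commute)
        with lip[of z y] that have "3 * \<delta> \<le> infdist (\<delta> *\<^sub>R y) A" by linarith
        then have "infdist (\<delta> *\<^sub>R y) A / \<delta> \<ge> 3" using \<delta> by (simp add: field_simps)
        then show ?thesis by (auto simp: a_def)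
      qed (use bump_eq_0[of "z - y"] in auto)
      then show ?thesis unfolding X_def avg_def by (simp only: integral_0)
    qed
    have bl: "bounded_linear (\<lambda>x::'a. (1/\<delta>) *\<^sub>R x)" by (rule bounded_linear_scaleR_right)
    \<comment> \<open>The rescaling is undone and the mass \<open>c\<close> divided out; the summand
      0 fits the rule for affine arguments.\<close>
    define \<zeta> where "\<zeta> x = X ((1/\<delta>) *\<^sub>R x + 0) * (1/c)" for x
    have p\<zeta>: "pd \<zeta> h x = pd X h ((1/\<delta>) *\<^sub>R x + 0) * (1 / (\<delta> * c))" for h x
      unfolding \<zeta>_def[abs_def] pd_mult[OF smooth_affine_compose[OF bl sX] smooth_const]
        pd_affine_compose[OF bl sX] pd_scaleR_arg[OF sX] by simp
    have pp\<zeta>: "pd (pd \<zeta> h) k x = pd (pd X h) k ((1/\<delta>) *\<^sub>R x + 0) * (1 / (\<delta>\<^sup>2 * c))" for h k x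
      unfolding p\<zeta>[abs_def] pd_mult[OF smooth_affine_compose[OF bl smooth_pd[OF sX]] smooth_const]
        pd_affine_compose[OF bl smooth_pd[OF sX]] pd_scaleR_arg[OF smooth_pd[OF sX]]
      by (simp add: power2_eq_square)
    show ?thesis
      unfolding controlled_def
    proof (intro exI[of _ \<zeta>] conjI allI impI)
      show "smooth \<zeta>" unfolding \<zeta>_def[abs_def] by (intro smooth_mult smooth_affine_compose[OF bl sX] smooth_const)
      show "\<bar>\<zeta> x\<bar> \<le> C" for x
      proof -
        have "\<bar>\<zeta> x\<bar> \<le> M0 * V / c" using bX c(1) by (simp add: \<zeta>_def abs_mult divide_right_mono)
        also have "\<dots> \<le> C" using M0 M1 M2 by (intro leC) auto
        finally show ?thesis .
      qed
      show "\<zeta> x = 1" if "infdist x A < \<delta>" for x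
        using X1[of "(1/\<delta>) *\<^sub>R x"] that \<delta> c(1) by (simp add: \<zeta>_def)
      show "\<zeta> x = 0" if "4 * \<delta> \<le> infdist x A" for x
        using X0[of "(1/\<delta>) *\<^sub>R x"] that \<delta> c(1) by (simp add: \<zeta>_def)
      show "\<bar>pd \<zeta> h x\<bar> \<le> C / \<delta> * norm h" for x h
      proof -
        have "\<bar>pd \<zeta> h x\<bar> \<le> (M1 * norm h * V) / (\<delta> * c)"
          using bpX c(1) \<delta> by (simp add: p\<zeta> abs_mult divide_right_mono)
        also have "\<dots> = (M1 * V / c) * (norm h / \<delta>)" by (simp add: mult_ac)
        also have "\<dots> \<le> C * (norm h / \<delta>)" using M0 M1 M2 \<delta> by (intro mult_right_mono leC) auto
        finally show ?thesis by simp
      qed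
      show "\<bar>pd (pd \<zeta> h) k x\<bar> \<le> C / \<delta>\<^sup>2 * norm h * norm k" for x h k
      proof -
        have "\<bar>pd (pd \<zeta> h) k x\<bar> \<le> (M2 * norm h * norm k * V) / (\<delta>\<^sup>2 * c)"
          using bppX c(1) \<delta> by (simp add: pp\<zeta> abs_mult divide_right_mono)
        also have "\<dots> = (M2 * V / c) * (norm h * norm k / \<delta>\<^sup>2)" by (simp add: mult_ac)
        also have "\<dots> \<le> C * (norm h * norm k / \<delta>\<^sup>2)" using M0 M1 M2 \<delta> by (intro mult_right_mono leC) auto
        finally show ?thesis by simp
      qed
    qed
  qed
  with C that show thesis by blast
qed

section \<open>Square integrals\<close>

text \<open>A squared \<open>L\<^sup>2\<close> norm with values in \<open>ennreal\<close>, so that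
  estimates can be chained before finiteness is known.\<close>

definition energy :: "'a::euclidean_space set \<Rightarrow> ('a \<Rightarrow> 'b::real_normed_vector) \<Rightarrow> ennreal"
  where "energy S f = (\<integral>\<^sup>+x. ennreal ((norm (f x))\<^sup>2) * indicator S x \<partial>lebesgue)"

lemma energy_lborel: "energy S f = (\<integral>\<^sup>+x. ennreal ((norm (f x))\<^sup>2) * indicator S x \<partial>lborel)"
  unfolding energy_def by (rule nn_integral_completion)

lemma energy_cong: "(\<And>x. x \<in> S \<Longrightarrow> norm (f x) = norm (g x)) \<Longrightarrow> energy S f = energy S g"
  unfolding energy_def by (intro nn_integral_cong) (auto simp: indicator_def)

lemma energy_mono: "(\<And>x. x \<in> S \<Longrightarrow> norm (f x) \<le> norm (g x)) \<Longrightarrow> energy S f \<le> energy S g"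
  unfolding energy_def
  by (intro nn_integral_mono) (auto simp: indicator_def intro!: ennreal_leI power_mono)

lemma energy_mono_set: "S \<subseteq> S' \<Longrightarrow> energy S f \<le> energy S' f"
  unfolding energy_def by (intro nn_integral_mono) (auto simp: indicator_def)

lemma energy_eq_0: "(\<And>x. x \<in> S \<Longrightarrow> f x = 0) \<Longrightarrow> energy S f = 0"
  unfolding energy_def by (subst nn_integral_cong[of _ _ "\<lambda>_. 0"]) (auto simp: indicator_def)

lemma energy_integrand_measurable:
  assumes "f \<in> borel_measurable lebesgue" "S \<in> sets lebesgue"
  shows "(\<lambda>x. ennreal ((norm (f x))\<^sup>2) * indicator S x) \<in> borel_measurable lebesgue"
  by (intro borel_measurable_times_ennreal borel_measurable_indicator assms
      measurable_compose[OF _ measurable_ennreal] borel_measurable_power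
      measurable_compose[OF assms(1) borel_measurable_continuous_onI[OF continuous_on_norm_id]])

lemma energy_scaleR:
  assumes "f \<in> borel_measurable lebesgue" "S \<in> sets lebesgue"
  shows "energy S (\<lambda>x. c *\<^sub>R f x) = ennreal (c\<^sup>2) * energy S f"
proof -
  have "energy S (\<lambda>x. c *\<^sub>R f x) = (\<integral>\<^sup>+x. ennreal (c\<^sup>2) * (ennreal ((norm (f x))\<^sup>2) * indicator S x) \<partial>lebesgue)"
    unfolding energy_def by (intro nn_integral_cong) (auto simp: power_mult_distrib ennreal_mult mult.assoc)
  also have "\<dots> = ennreal (c\<^sup>2) * energy S f"
    unfolding energy_def by (intro nn_integral_cmult energy_integrand_measurable assms)
  finally show ?thesis .
qed

text \<open>The pointwise bound is quadratic in a finite family; this form admits a family that runs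
  over all ray directions at once.\<close>

lemma energy_add_le_sq:
  fixes f :: "'a::euclidean_space \<Rightarrow> 'b::real_normed_vector"
    and g :: "'i \<Rightarrow> 'a \<Rightarrow> 'c::real_normed_vector"
  assumes "finite I" "\<And>i. i \<in> I \<Longrightarrow> g i \<in> borel_measurable lebesgue" "S \<in> sets lebesgue"
    and "\<And>i. i \<in> I \<Longrightarrow> c i \<ge> 0"
    and "\<And>x. x \<in> S \<Longrightarrow> (norm (f x))\<^sup>2 \<le> (\<Sum>i\<in>I. c i * (norm (g i x))\<^sup>2)"
  shows "energy S f \<le> (\<Sum>i\<in>I. ennreal (c i) * energy S (g i))"
proof -
  have "energy S f \<le> (\<integral>\<^sup>+x. (\<Sum>i\<in>I. ennreal (c i) * (ennreal ((norm (g i x))\<^sup>2) * indicator S x)) \<partial>lebesgue)"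
    unfolding energy_def
  proof (rule nn_integral_mono)
    fix x
    show "ennreal ((norm (f x))\<^sup>2) * indicator S x \<le>
      (\<Sum>i\<in>I. ennreal (c i) * (ennreal ((norm (g i x))\<^sup>2) * indicator S x))"
    proof (cases "x \<in> S")
      case True
      have "ennreal ((norm (f x))\<^sup>2) \<le> ennreal (\<Sum>i\<in>I. c i * (norm (g i x))\<^sup>2)"
        by (intro ennreal_leI assms True)
      also have "\<dots> = (\<Sum>i\<in>I. ennreal (c i) * ennreal ((norm (g i x))\<^sup>2))"
        using assms(4) by (simp add: sum_ennreal[symmetric] ennreal_mult)
      finally show ?thesis using True by simp
    qed simp
  qed
  also have "\<dots> = (\<Sum>i\<in>I. \<integral>\<^sup>+x. ennreal (c i) * (ennreal ((norm (g i x))\<^sup>2) * indicator S x) \<partial>lebesgue)"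
    by (intro nn_integral_sum borel_measurable_times_ennreal borel_measurable_const
        energy_integrand_measurable assms(2,3))
  also have "\<dots> = (\<Sum>i\<in>I. ennreal (c i) * energy S (g i))"
    unfolding energy_def
    by (intro sum.cong refl nn_integral_cmult energy_integrand_measurable assms(2,3))
  finally show ?thesis .
qed

lemma energy_add_le:
  fixes f g :: "'a::euclidean_space \<Rightarrow> 'b::euclidean_space"
  assumes "f \<in> borel_measurable lebesgue" "g \<in> borel_measurable lebesgue" "S \<in> sets lebesgue"
  shows "energy S (\<lambda>x. f x + g x) \<le> 2 * (energy S f + energy S g)"
proof -
  have "(norm (f x + g x))\<^sup>2 \<le> (\<Sum>b\<in>(UNIV::bool set). 2 * (norm ((if b then f else g) x))\<^sup>2)" for x
  proof -
    have "(norm (f x + g x))\<^sup>2 \<le> (norm (f x) + norm (g x))\<^sup>2" by (intro power_mono norm_triangle_ineq) auto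
    also have "\<dots> \<le> 2 * (norm (f x))\<^sup>2 + 2 * (norm (g x))\<^sup>2" 
      using zero_le_power2[of "norm (f x) - norm (g x)"] by (simp add: power2_eq_square algebra_simps)
    finally show ?thesis by (simp add: UNIV_bool)
  qed
  then have "energy S (\<lambda>x. f x + g x) \<le> (\<Sum>b\<in>(UNIV::bool set). ennreal 2 * energy S (if b then f else g))"
    using assms by (intro energy_add_le_sq) auto
  then show ?thesis by (simp add: UNIV_bool distrib_left add.commute)
qed

lemma energy_bounded:
  assumes "\<And>x. norm (f x) \<le> M" "\<And>x. x \<in> S \<Longrightarrow> x \<notin> B \<Longrightarrow> f x = 0" "B \<in> sets lebesgue"
  shows "energy S f \<le> ennreal (M\<^sup>2) * emeasure lebesgue B"
proof -
  have "energy S f \<le> (\<integral>\<^sup>+x. ennreal (M\<^sup>2) * indicator B x \<partial>lebesgue)"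
    unfolding energy_def
  proof (rule nn_integral_mono)
    fix x
    have "(norm (f x))\<^sup>2 \<le> M\<^sup>2" using assms(1) by (intro power_mono) auto
    then show "ennreal ((norm (f x))\<^sup>2) * indicator S x \<le> ennreal (M\<^sup>2) * indicator B x"
      using assms(2)[of x] by (auto simp: indicator_def intro: ennreal_leI)
  qed
  also have "\<dots> = ennreal (M\<^sup>2) * emeasure lebesgue B" using assms(3) by (intro nn_integral_cmult_indicator)
  finally show ?thesis .
qed

text \<open>Cauchy-Schwarz against the constant 1, read off from the nonnegativity of the variance:
  integrate \<open>(q y - m)\<^sup>2\<close> for the mean \<open>m\<close> of
  \<open>q\<close>.\<close>

lemma integral_square_le:
  fixes q :: "'c::euclidean_space \<Rightarrow> real"
  assumes q: "continuous_on (cbox l r) q"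
  shows "(integral (cbox l r) q)\<^sup>2 \<le> measure lborel (cbox l r) * integral (cbox l r) (\<lambda>y. (q y)\<^sup>2)"
proof -
  let ?c = "measure lborel (cbox l r)"
  show ?thesis
  proof (cases "?c = 0")
    case True
    then show ?thesis by (simp add: integral_null)
  next
    case False
    then have c: "?c > 0" by (simp add: zero_less_measure_iff measure_nonneg less_le)
    define I where "I = integral (cbox l r) q"
    define m where "m = I / ?c"
    have q1: "q integrable_on cbox l r" and q2: "(\<lambda>y. (q y)\<^sup>2) integrable_on cbox l r"
      by (intro integrable_continuous continuous_intros q)+
    have "0 \<le> integral (cbox l r) (\<lambda>y. (q y - m)\<^sup>2)"
      by (intro integral_nonneg integrable_continuous continuous_intros q) auto
    also have "(\<lambda>y. (q y - m)\<^sup>2) = (\<lambda>y. ((q y)\<^sup>2 - 2 * m * q y) + m\<^sup>2)"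
      by (rule ext) (simp add: power2_diff)
    also have "integral (cbox l r) \<dots> = integral (cbox l r) (\<lambda>y. (q y)\<^sup>2) - 2 * m * I + m\<^sup>2 * ?c"
    proof (rule integral_unique)
      show "((\<lambda>y. ((q y)\<^sup>2 - 2 * m * q y) + m\<^sup>2) has_integral
          (integral (cbox l r) (\<lambda>y. (q y)\<^sup>2) - 2 * m * I + m\<^sup>2 * ?c)) (cbox l r)"
        using has_integral_add[OF has_integral_diff[OF integrable_integral[OF q2]
            has_integral_mult_right[OF integrable_integral[OF q1], of "2 * m"]] has_integral_const[of "m\<^sup>2" l r]]
        by (simp add: I_def mult.commute)
    qed
    also have "\<dots> = integral (cbox l r) (\<lambda>y. (q y)\<^sup>2) - I\<^sup>2 / ?c"
      using c by (simp add: m_def field_simps power2_eq_square)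
    finally show ?thesis using c by (simp add: I_def field_simps)
  qed
qed

lemma avg_norm_le:
  assumes "continuous_on (cbox l r) a" "continuous_on (cbox l r) T" "continuous_on UNIV g"
    and "\<And>y. y \<in> cbox l r \<Longrightarrow> \<bar>a y\<bar> \<le> 1"
  shows "norm (avg l r a T g x) \<le> integral (cbox l r) (\<lambda>y. norm (g (x + T y)))"
  unfolding avg_def
proof (rule integral_norm_bound_integral)
  show "(\<lambda>y. a y *\<^sub>R g (x + T y)) integrable_on cbox l r" by (rule avg_integrable[OF assms(1-3)])
  show "(\<lambda>y. norm (g (x + T y))) integrable_on cbox l r"
    by (intro integrable_continuous continuous_intros continuous_on_compose2[OF assms(3)] assms(2)) auto
  show "norm (a y *\<^sub>R g (x + T y)) \<le> norm (g (x + T y))" if "y \<in> cbox l r" for y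
    using assms(4)[OF that] mult_right_mono[of "\<bar>a y\<bar>" 1 "norm (g (x + T y))"] by simp
qed

lemma nn_integral_cbox:
  fixes h :: "'a::euclidean_space \<Rightarrow> real"
  assumes h: "continuous_on UNIV h" "\<And>y. h y \<ge> 0"
  shows "ennreal (integral (cbox l r) h) = (\<integral>\<^sup>+y. ennreal (h y) * indicator (cbox l r) y \<partial>lborel)"
proof -
  have "h integrable_on cbox l r"
    by (intro integrable_continuous continuous_on_subset[OF h(1)]) simp
  then have "((\<lambda>y. if y \<in> cbox l r then h y else 0) has_integral integral (cbox l r) h) UNIV"
    unfolding has_integral_restrict_UNIV by (rule integrable_integral)
  moreover have "(\<lambda>y. if y \<in> cbox l r then h y else 0) = (\<lambda>y. h y * indicator (cbox l r) y)"
    by (auto simp: indicator_def)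
  ultimately have hi: "((\<lambda>y. h y * indicator (cbox l r) y) has_integral integral (cbox l r) h) UNIV"
    by simp
  have "ennreal (integral (cbox l r) h) = (\<integral>\<^sup>+y. ennreal (h y * indicator (cbox l r) y) \<partial>lborel)"
    by (rule nn_integral_has_integral_lborel[OF _ _ hi, symmetric])
      (use h in \<open>auto intro!: borel_measurable_times[OF borel_measurable_continuous_onI borel_measurable_indicator]\<close>)
  also have "\<dots> = (\<integral>\<^sup>+y. ennreal (h y) * indicator (cbox l r) y \<partial>lborel)"
    by (intro nn_integral_cong) (auto simp: indicator_def)
  finally show ?thesis .
qed

lemma nn_integral_translate:
  fixes f :: "'a::euclidean_space \<Rightarrow> ennreal"
  assumes "f \<in> borel_measurable borel"
  shows "(\<integral>\<^sup>+z. f (x + z) \<partial>lborel) = (\<integral>\<^sup>+z. f z \<partial>lborel)"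
proof -
  have "(\<integral>\<^sup>+z. f z \<partial>lborel) = (\<integral>\<^sup>+z. f z \<partial>distr lborel borel ((+) x))" by (simp only: lborel_distr_plus)
  also have "\<dots> = (\<integral>\<^sup>+z. f (x + z) \<partial>lborel)" using assms by (subst nn_integral_distr) auto
  finally show ?thesis ..
qed

text \<open>Cauchy-Schwarz in \<open>y\<close>, then Tonelli and translation invariance in
  \<open>x\<close>. Each of the two steps contributes one factor of the measure of the box.\<close>

lemma energy_avg_le:
  fixes g :: "'a::euclidean_space \<Rightarrow> 'b::euclidean_space" and T :: "'c::euclidean_space \<Rightarrow> 'a"
  assumes a: "continuous_on (cbox l r) a" "\<And>y. y \<in> cbox l r \<Longrightarrow> \<bar>a y\<bar> \<le> 1"
    and T: "continuous_on UNIV T" and g: "continuous_on UNIV g"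
    and S: "S \<in> sets borel" "S' \<in> sets borel"
    and sub: "\<And>x y. x \<in> S \<Longrightarrow> y \<in> cbox l r \<Longrightarrow> x + T y \<in> S'"
  shows "energy S (avg l r a T g) \<le> ennreal ((measure lborel (cbox l r))\<^sup>2) * energy S' g"
proof -
  let ?c = "measure lborel (cbox l r)"
  let ?G = "\<lambda>x. ennreal ((norm (g x))\<^sup>2)"
  have T': "continuous_on A T" for A using T by (rule continuous_on_subset) simp
  have g': "g \<in> borel_measurable borel" by (rule borel_measurable_continuous_onI[OF g])
  have pt: "ennreal ((norm (avg l r a T g x))\<^sup>2) \<le> ennreal ?c * (\<integral>\<^sup>+y. ?G (x + T y) * indicator (cbox l r) y \<partial>lborel)" for x
  proof -
    have cont: "continuous_on (cbox l r) (\<lambda>y. norm (g (x + T y)))"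
      by (intro continuous_intros continuous_on_compose2[OF g] T') auto
    have "(norm (avg l r a T g x))\<^sup>2 \<le> (integral (cbox l r) (\<lambda>y. norm (g (x + T y))))\<^sup>2"
      by (intro power_mono avg_norm_le a T' g) auto
    also have "\<dots> \<le> ?c * integral (cbox l r) (\<lambda>y. (norm (g (x + T y)))\<^sup>2)"
      by (rule integral_square_le[OF cont])
    finally have "ennreal ((norm (avg l r a T g x))\<^sup>2) \<le>
        ennreal (?c * integral (cbox l r) (\<lambda>y. (norm (g (x + T y)))\<^sup>2))" by (rule ennreal_leI)
    also have "\<dots> = ennreal ?c * ennreal (integral (cbox l r) (\<lambda>y. (norm (g (x + T y)))\<^sup>2))"
      by (intro ennreal_mult) (auto intro!: integral_nonneg integrable_continuous continuous_intros cont)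
    also have "ennreal (integral (cbox l r) (\<lambda>y. (norm (g (x + T y)))\<^sup>2)) =
        (\<integral>\<^sup>+y. ?G (x + T y) * indicator (cbox l r) y \<partial>lborel)"
      by (rule nn_integral_cbox) (auto intro!: continuous_intros continuous_on_compose2[OF g] T)
    finally show ?thesis .
  qed
  have m: "(\<lambda>(x, y). ?G (x + T y) * indicator (cbox l r) y * indicator S x) \<in> borel_measurable (lborel \<Otimes>\<^sub>M lborel)"
  proof -
    have "(\<lambda>p. g (fst p + T (snd p))) \<in> borel_measurable (borel :: ('a \<times> 'c) measure)"
      by (intro borel_measurable_continuous_onI continuous_on_compose2[OF g] continuous_intros
          continuous_on_compose2[OF T]) auto
    moreover have "h \<in> borel_measurable (lborel \<Otimes>\<^sub>M lborel)"
      if "h \<in> borel_measurable (borel :: ('a \<times> 'c) measure)" for h :: "'a \<times> 'c \<Rightarrow> 'b"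
    proof -
      have "sets (lborel \<Otimes>\<^sub>M lborel) = sets (borel \<Otimes>\<^sub>M borel :: ('a \<times> 'c) measure)"
        by (intro sets_pair_measure_cong) auto
      then have "sets (lborel \<Otimes>\<^sub>M lborel) = sets (borel :: ('a \<times> 'c) measure)"
        unfolding borel_prod .
      from measurable_cong_sets[OF this refl] that show ?thesis by blast
    qed
    ultimately have *: "(\<lambda>p. g (fst p + T (snd p))) \<in> borel_measurable (lborel \<Otimes>\<^sub>M lborel)" by blast
    show ?thesis using * S by (simp add: split_beta) measurable
  qed
  have "(\<integral>\<^sup>+x. (\<integral>\<^sup>+y. ?G (x + T y) * indicator (cbox l r) y * indicator S x \<partial>lborel) \<partial>lborel) =
      (\<integral>\<^sup>+y. (\<integral>\<^sup>+x. ?G (x + T y) * indicator (cbox l r) y * indicator S x \<partial>lborel) \<partial>lborel)"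
    using lborel_pair.Fubini'[OF m] by simp
  also have "\<dots> \<le> (\<integral>\<^sup>+y. energy S' g * indicator (cbox l r) y \<partial>(lborel :: 'c measure))"
  proof (rule nn_integral_mono)
    fix y :: 'c
    show "(\<integral>\<^sup>+x. ?G (x + T y) * indicator (cbox l r) y * indicator S x \<partial>lborel) \<le> energy S' g * indicator (cbox l r) y"
    proof (cases "y \<in> cbox l r")
      case True
      have "(\<integral>\<^sup>+x. ?G (x + T y) * indicator (cbox l r) y * indicator S x \<partial>lborel) \<le>
          (\<integral>\<^sup>+x. ?G (T y + x) * indicator S' (T y + x) \<partial>lborel)"
        using sub[OF _ True] by (intro nn_integral_mono) (auto simp: indicator_def add.commute)
      also have "\<dots> = energy S' g"
        unfolding energy_lborel using g' S by (intro nn_integral_translate) auto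
      finally show ?thesis using True by simp
    qed simp
  qed
  also have "\<dots> = energy S' g * ennreal ?c"
    using emeasure_eq_ennreal_measure[of lborel "cbox l r"] emeasure_lborel_cbox_finite[of l r]
    by (subst nn_integral_cmult_indicator) auto
  finally have le: "(\<integral>\<^sup>+x. (\<integral>\<^sup>+y. ?G (x + T y) * indicator (cbox l r) y * indicator S x \<partial>lborel) \<partial>lborel)
      \<le> energy S' g * ennreal ?c" .
  have "energy S (avg l r a T g) \<le>
      (\<integral>\<^sup>+x. ennreal ?c * (\<integral>\<^sup>+y. ?G (x + T y) * indicator (cbox l r) y * indicator S x \<partial>lborel) \<partial>lborel)"
    unfolding energy_lborel
  proof (rule nn_integral_mono)
    fix x
    show "ennreal ((norm (avg l r a T g x))\<^sup>2) * indicator S x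
      \<le> ennreal ?c * (\<integral>\<^sup>+y. ?G (x + T y) * indicator (cbox l r) y * indicator S x \<partial>lborel)"
      using pt[of x] by (cases "x \<in> S") auto
  qed
  also have "\<dots> = ennreal ?c * (\<integral>\<^sup>+x. (\<integral>\<^sup>+y. ?G (x + T y) * indicator (cbox l r) y * indicator S x \<partial>lborel) \<partial>lborel)"
    using lborel.borel_measurable_nn_integral[OF m] by (intro nn_integral_cmult) simp
  also have "\<dots> \<le> ennreal ?c * (energy S' g * ennreal ?c)"
    by (rule mult_left_mono[OF le]) simp
  also have "\<dots> = ennreal (?c\<^sup>2) * energy S' g"
    by (simp add: power2_eq_square ennreal_mult mult_ac)
  finally show ?thesis .
qed

section \<open>Lipschitz charts\<close>

text \<open>The chart is condensed into the height \<open>h\<close> above the graph, which falls at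
  unit speed along \<open>- e\<close> and whose sign decides membership. Its Lipschitz constant
  \<open>1 + L\<close> takes 1 from the vertical coordinate and \<open>L\<close> from the
  graph.\<close>

lemma lipschitz_chart:
  assumes "lipschitz_boundary \<Omega>" "p \<in> frontier \<Omega>"
  obtains r L h e where "r > 0" "L \<ge> 1" "norm (e::real^2) = 1"
    "\<And>x y. \<bar>h x - h y\<bar> \<le> L * dist x y" "\<And>x t. h (x - t *\<^sub>R e) = h x - t"
    "\<And>x. x \<in> ball p r \<Longrightarrow> x \<in> - \<Omega> \<longleftrightarrow> h x \<le> (0::real)"
proof -
  obtain r and T :: "real^2 \<Rightarrow> real^2" and \<gamma> :: "real \<Rightarrow> real" and L where r: "r > 0" and T: "orthogonal_transformation T"
    and \<gamma>: "L-lipschitz_on UNIV \<gamma>"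
    and \<Omega>: "\<Omega> \<inter> ball p r = {x \<in> ball p r. \<gamma> (T x $ 1) < T x $ 2}"
    using bspec[OF assms(1)[unfolded lipschitz_boundary_def] assms(2)] by blast
  define h where "h x = T x $ 2 - \<gamma> (T x $ 1)" for x
  have lin: "linear T" using T by (rule orthogonal_transformation_linear)
  have L0: "L \<ge> 0" using \<gamma> by (rule lipschitz_on_nonneg)
  obtain e where e: "T e = axis 2 1"
    using surjD[OF orthogonal_transformation_surj[OF T], of "axis 2 1"] by metis
  show thesis
  proof
    show "r > 0" by fact
    show "1 + L \<ge> 1" using L0 by simp
    show "norm e = 1" using orthogonal_transformation_norm[OF T, of e] e by simp
    show "\<bar>h x - h y\<bar> \<le> (1 + L) * dist x y" for x y
    proof -
      have n: "\<bar>T x $ i - T y $ i\<bar> \<le> dist x y" for i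
      proof -
        have "\<bar>T x $ i - T y $ i\<bar> \<le> norm (T (x - y))"
          using component_le_norm_cart[of "T (x - y)" i] by (simp add: linear_diff[OF lin])
        then show ?thesis using orthogonal_transformation_norm[OF T] by (simp add: dist_norm)
      qed
      have "\<bar>\<gamma> (T x $ 1) - \<gamma> (T y $ 1)\<bar> \<le> L * \<bar>T x $ 1 - T y $ 1\<bar>"
        using lipschitz_onD[OF \<gamma>, of "T x $ 1" "T y $ 1"] by (simp add: dist_real_def)
      also have "\<dots> \<le> L * dist x y" by (intro mult_left_mono n L0)
      finally show ?thesis using n[of 2] by (simp add: h_def algebra_simps)
    qed
    show "h (x - t *\<^sub>R e) = h x - t" for x t
      by (simp add: h_def linear_diff[OF lin] linear_scale[OF lin] e axis_def)
    show "x \<in> - \<Omega> \<longleftrightarrow> h x \<le> 0" if "x \<in> ball p r" for x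
    proof -
      have "x \<in> \<Omega> \<longleftrightarrow> \<gamma> (T x $ 1) < T x $ 2" using that \<Omega> by blast
      then show ?thesis by (simp add: h_def not_less)
    qed
  qed
qed

lemma ball_subset_of_no_frontier:
  fixes z :: "'a::real_normed_vector"
  assumes "z \<in> S" "ball z d \<inter> frontier S = {}" "(0::real) < d"
  shows "ball z d \<subseteq> S"
proof -
  have "z \<in> ball z d \<inter> S" using assms by simp
  then show ?thesis using connected_Int_frontier[OF connected_ball, of z d S] assms(2) by blast
qed

text \<open>Below every point close to the complement \<open>K\<close> there is, at distance \<open>s \<delta>\<close> in one of
  finitely many directions, a point at depth at least \<open>\<kappa> \<delta>\<close> inside \<open>K\<close>, and nearby points at
  this depth are joined inside \<open>K\<close> by a polygonal path of depth at least \<open>2 \<delta>\<close>.\<close>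

lemma exterior_geometry:
  assumes "exterior_domain \<Omega>" "lipschitz_boundary \<Omega>"
  obtains s r0 d0 \<kappa> :: real and E :: "(real^2) set" where
    "s > 0" "r0 > 0" "d0 > 0" "\<kappa> \<ge> 2" "finite E" "\<And>e. e \<in> E \<Longrightarrow> norm e = 1"
    "\<And>\<delta> z. 0 < \<delta> \<Longrightarrow> \<delta> < d0 \<Longrightarrow> infdist z (- \<Omega>) \<le> 4 * \<delta> \<Longrightarrow>
       \<exists>e\<in>E. ball (z - (s * \<delta>) *\<^sub>R e) (\<kappa> * \<delta>) \<subseteq> - \<Omega>"
    "\<And>\<delta> x y. 0 < \<delta> \<Longrightarrow> \<delta> < d0 \<Longrightarrow> ball x (\<kappa> * \<delta>) \<subseteq> - \<Omega> \<Longrightarrow> ball y (\<kappa> * \<delta>) \<subseteq> - \<Omega> \<Longrightarrow>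
       dist x y < r0 \<Longrightarrow>
       \<exists>a b. \<forall>q\<in>closed_segment x a \<union> closed_segment a b \<union> closed_segment b y. ball q (2 * \<delta>) \<subseteq> - \<Omega>"
proof -
  let ?K = "- \<Omega>" and ?F = "frontier \<Omega>"
  have K: "compact ?K" "?K \<noteq> {}" using assms(1) by (auto simp: exterior_domain_def)
  have FK: "frontier ?K = ?F" by (rule frontier_complement)
  have F: "compact ?F" using compact_frontier[OF K(1)] unfolding FK .
  define ch where "ch p r L h e \<longleftrightarrow> r > 0 \<and> L \<ge> 1 \<and> norm (e::real^2) = 1 \<and>
    (\<forall>x y. \<bar>h x - h y\<bar> \<le> L * dist x y) \<and> (\<forall>x t. h (x - t *\<^sub>R e) = h x - t) \<and>
    (\<forall>x \<in> ball p r. x \<in> - \<Omega> \<longleftrightarrow> h x \<le> (0::real))" for p r L h e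
  have "\<exists>c. ch p (fst c) (fst (snd c)) (fst (snd (snd c))) (snd (snd (snd c)))" if pF: "p \<in> ?F" for p
  proof -
    show ?thesis
    proof (rule lipschitz_chart[OF assms(2) pF])
      fix r L :: real and e :: "real^2" and h :: "real^2 \<Rightarrow> real"
      assume a: "r > 0" "L \<ge> 1" "norm e = 1" "\<And>x y. \<bar>h x - h y\<bar> \<le> L * dist x y"
        "\<And>x t. h (x - t *\<^sub>R e) = h x - t" "\<And>x. x \<in> ball p r \<Longrightarrow> x \<in> - \<Omega> \<longleftrightarrow> h x \<le> 0"
      have "ch p r L h e" unfolding ch_def by (intro conjI allI ballI a)
      then show ?thesis by (intro exI[of _ "(r, L, h, e)"]) simp
    qed
  qed
  then have "\<forall>p\<in>?F. \<exists>c. ch p (fst c) (fst (snd c)) (fst (snd (snd c))) (snd (snd (snd c)))" by blast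
  from bchoice[OF this] obtain c where
    c: "\<forall>p\<in>?F. ch p (fst (c p)) (fst (snd (c p))) (fst (snd (snd (c p)))) (snd (snd (snd (c p))))" ..
  define r where "r p = fst (c p)" for p
  define L where "L p = fst (snd (c p))" for p
  define h where "h p = fst (snd (snd (c p)))" for p
  define e where "e p = snd (snd (snd (c p)))" for p
  have ch: "r p > 0 \<and> L p \<ge> 1 \<and> norm (e p) = 1 \<and>
    (\<forall>x y. \<bar>h p x - h p y\<bar> \<le> L p * dist x y) \<and> (\<forall>x t. h p (x - t *\<^sub>R e p) = h p x - t) \<and>
    (\<forall>x \<in> ball p (r p). x \<in> - \<Omega> \<longleftrightarrow> h p x \<le> (0::real))" if "p \<in> ?F" for p
    using bspec[OF c that] unfolding ch_def r_def L_def h_def e_def .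
  have rp: "r p > 0" and Lp: "L p \<ge> 1" and ep: "norm (e p) = 1" if "p \<in> ?F" for p
    using ch[OF that] by blast+
  \<comment> \<open>The factor 16 lets a point within \<open>2 * \<rho> p\<close> of
    \<open>p\<close> descend by \<open>4 * (L p * \<rho> p)\<close> and carry a small ball along
    without leaving the chart.\<close>
  define \<rho> where "\<rho> p = r p / (16 * L p)" for p
  have \<rho>: "\<rho> p > 0" "r p = 16 * L p * \<rho> p" if "p \<in> ?F" for p
    using rp[OF that] Lp[OF that] by (simp_all add: \<rho>_def)
  obtain I where I: "I \<subseteq> ?F" "finite I" "?F \<subseteq> (\<Union>p\<in>I. ball p (\<rho> p))"
  proof (rule compactE_image[OF F, of ?F "\<lambda>p. ball p (\<rho> p)"])
    show "?F \<subseteq> (\<Union>p\<in>?F. ball p (\<rho> p))" using \<rho>(1) by (meson UN_I centre_in_ball subsetI)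
  qed auto
  define \<Lambda> where "\<Lambda> = 1 + (\<Sum>p\<in>I. L p)"
  have L0: "L p \<ge> 0" if "p \<in> I" for p using Lp[of p] that I(1) by fastforce
  have \<Lambda>: "L p \<le> \<Lambda>" if "p \<in> I" for p
    using member_le_sum[of p I L, OF that _ I(2)] L0 by (simp add: \<Lambda>_def)
  have \<Lambda>1: "\<Lambda> \<ge> 1" using sum_nonneg[of I L] L0 by (simp add: \<Lambda>_def)
  define \<rho>0 where "\<rho>0 = Min (insert 1 (\<rho> ` I))"
  have \<rho>0: "\<rho>0 > 0" "\<And>p. p \<in> I \<Longrightarrow> \<rho>0 \<le> \<rho> p"
    using I \<rho>(1) by (auto simp: \<rho>0_def)
  \<comment> \<open>A Lebesgue number of the cover: a point whose \<open>d\<close>-ball meets the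
    boundary lies in one of the chosen charts.\<close>
  obtain d where d: "d > 0" "(\<Union>x\<in>?F. ball x d) \<subseteq> (\<Union>p\<in>I. ball p (\<rho> p))"
    using compact_subset_open_imp_ball_epsilon_subset[OF F _ I(3)] by blast
  \<comment> \<open>In a chart \<open>h\<close> varies by at most \<open>\<Lambda>\<close> times the
    distance. Depth \<open>2 * \<Lambda> * \<delta>\<close> in terms of \<open>h\<close> thus
    protects a ball of radius \<open>2 * \<delta>\<close>. The descent \<open>s * \<delta>\<close>
    absorbs \<open>4 * \<Lambda> * \<delta>\<close>, since \<open>z\<close> is within
    \<open>4 * \<delta>\<close> of the complement, and another
    \<open>2 * \<Lambda>\<^sup>2 * \<delta>\<close> for the ball of radius
    \<open>\<kappa> * \<delta>\<close>.\<close>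
  define \<kappa> where "\<kappa> = 2 * \<Lambda>"
  define s where "s = 4 * \<Lambda> + 2 * \<Lambda>\<^sup>2"
  define d0 where "d0 = min (d/2) \<rho>0 / (s + \<kappa> + 4)"
  have s: "s > 0" using \<Lambda>1 by (auto simp: s_def intro!: add_pos_nonneg)
  have \<kappa>: "\<kappa> \<ge> 2" using \<Lambda>1 by (simp add: \<kappa>_def)
  have d0: "d0 > 0" using d \<rho>0 s \<kappa> by (auto simp: d0_def)
  have small: "s * \<delta> + \<kappa> * \<delta> + 4 * \<delta> < d / 2" "s * \<delta> + \<kappa> * \<delta> + 4 * \<delta> < \<rho>0" "s * \<delta> > 0" "\<kappa> * \<delta> > 0"
    if "0 < \<delta>" "\<delta> < d0" for \<delta>
  proof -
    have "\<delta> * (s + \<kappa> + 4) < min (d/2) \<rho>0"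
      using that(2) s \<kappa> by (simp add: d0_def pos_less_divide_eq)
    then show "s * \<delta> + \<kappa> * \<delta> + 4 * \<delta> < d / 2" "s * \<delta> + \<kappa> * \<delta> + 4 * \<delta> < \<rho>0"
      by (auto simp: algebra_simps)
    show "s * \<delta> > 0" "\<kappa> * \<delta> > 0" using that(1) s \<kappa> by auto
  qed
  have near: "\<exists>p\<in>I. z \<in> ball p (\<rho> p)" if "ball z d \<inter> ?F \<noteq> {}" for z
  proof -
    from that obtain k where "k \<in> ?F" "z \<in> ball k d" by (auto simp: dist_commute)
    then show ?thesis using d(2) by blast
  qed
  have far: "ball z d \<subseteq> ?K" if "z \<in> ?K" "ball z d \<inter> ?F = {}" for z
    using ball_subset_of_no_frontier[OF that(1) _ d(1)] that(2) FK by simp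
  \<comment> \<open>\<open>axis 1 1\<close> is an arbitrary unit vector for points far inside the
    complement, where every direction works.\<close>
  let ?E = "insert (axis 1 1) (e ` I)"
  show thesis
  proof (rule that[of s "min \<rho>0 (d/2)" d0 \<kappa> ?E])
    show "s > 0" "min \<rho>0 (d/2) > 0" "d0 > 0" "\<kappa> \<ge> 2" "finite ?E" using s d0 \<kappa> \<rho>0 d I(2) by auto
    show "norm u = 1" if "u \<in> ?E" for u using that ep I(1) by auto
  next
    fix \<delta> z assume \<delta>: "0 < \<delta>" "\<delta> < d0" and z: "infdist z ?K \<le> 4 * \<delta>"
    obtain k where k: "k \<in> ?K" "dist z k \<le> 4 * \<delta>"
      using infdist_attains_inf[OF compact_imp_closed[OF K(1)] K(2)] z by metis
    show "\<exists>e\<in>?E. ball (z - (s * \<delta>) *\<^sub>R e) (\<kappa> * \<delta>) \<subseteq> ?K"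
    proof (cases "ball z d \<inter> ?F = {}")
      case True
      have "z \<in> ?K"
      proof (rule ccontr)
        assume "z \<notin> ?K"
        moreover have "k \<in> ball z d" using k(2) small[OF \<delta>] \<delta>(1) d(1) unfolding mem_ball by linarith
        moreover have "z \<in> ball z d" using d(1) by simp
        ultimately have "ball z d \<inter> frontier ?K \<noteq> {}"
          using connected_Int_frontier[OF connected_ball, of z d ?K] k(1) by blast
        then show False using True FK by simp
      qed
      then have "ball z d \<subseteq> ?K" using far True by blast
      moreover have "ball (z - (s * \<delta>) *\<^sub>R axis 1 1) (\<kappa> * \<delta>) \<subseteq> ball z d"
        using small[OF \<delta>] \<delta>(1) by (simp add: ball_subset_ball_iff dist_norm)
      ultimately show ?thesis by blast
    next
      case False
      then obtain p where p: "p \<in> I" "z \<in> ball p (\<rho> p)" using near by blast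
      then have pF: "p \<in> ?F" using I(1) by blast
      note c = ch[OF pF] and cs = rp[OF pF] Lp[OF pF] ep[OF pF]
      have hl: "h p q \<le> h p w + L p * dist q w" for q w
      proof -
        have "\<bar>h p q - h p w\<bar> \<le> L p * dist q w" using c by blast
        then show ?thesis by linarith
      qed
      have rr: "r p \<ge> 16 * \<rho> p" using \<rho>[OF pF] cs by simp
      have \<rho>p: "\<rho>0 \<le> \<rho> p" using \<rho>0 p by blast
      have "k \<in> ball p (r p)"
        using p(2) k(2) rr \<rho>p \<rho>0(1) small[OF \<delta>] \<delta>(1) dist_triangle[of p k z] unfolding mem_ball by linarith
      then have hk: "h p k \<le> 0" using c k(1) by blast
      have "L p * dist z k \<le> \<Lambda> * (4 * \<delta>)"
        using \<Lambda>[OF p(1)] L0[OF p(1)] k(2) \<Lambda>1 by (intro mult_mono) auto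
      then have hz: "h p z \<le> 4 * \<Lambda> * \<delta>" using hl[of z k] hk by (simp add: mult_ac)
      have "q \<in> ?K" if q: "q \<in> ball (z - (s * \<delta>) *\<^sub>R e p) (\<kappa> * \<delta>)" for q
      proof -
        let ?y = "z - (s * \<delta>) *\<^sub>R e p"
        have "dist z ?y = s * \<delta>" using cs small(3)[OF \<delta>] by (simp add: dist_norm)
        then have "q \<in> ball p (r p)"
          using p(2) q rr \<rho>p \<rho>0(1) small[OF \<delta>] \<delta>(1) dist_triangle[of p q z] dist_triangle[of z q ?y]
          unfolding mem_ball by linarith
        moreover have "h p q \<le> 0"
        proof -
          have "h p q \<le> h p ?y + L p * dist q ?y" by (rule hl)
          also have "L p * dist q ?y \<le> \<Lambda> * (\<kappa> * \<delta>)"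
            using \<Lambda>[OF p(1)] L0[OF p(1)] q \<Lambda>1 by (intro mult_mono) (auto simp: dist_commute)
          also have "h p ?y = h p z - s * \<delta>" using c by blast
          finally show ?thesis using hz by (simp add: s_def \<kappa>_def algebra_simps power2_eq_square)
        qed
        ultimately show ?thesis using c by blast
      qed
      then show ?thesis using p(1) by blast
    qed
  next
    fix \<delta> x y assume \<delta>: "0 < \<delta>" "\<delta> < d0" and bx: "ball x (\<kappa> * \<delta>) \<subseteq> ?K" and "by": "ball y (\<kappa> * \<delta>) \<subseteq> ?K"
      and xy: "dist x y < min \<rho>0 (d/2)"
    have \<kappa>\<delta>: "\<kappa> * \<delta> > 0" using small[OF \<delta>] \<delta>(1) by simp
    show "\<exists>a b. \<forall>q\<in>closed_segment x a \<union> closed_segment a b \<union> closed_segment b y. ball q (2 * \<delta>) \<subseteq> ?K"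
    proof (cases "ball x d \<inter> ?F = {}")
      case True
      have "x \<in> ?K" using subsetD[OF bx, of x] \<kappa>\<delta> by simp
      then have "ball x d \<subseteq> ?K" using far True by blast
      moreover have "ball q (2 * \<delta>) \<subseteq> ball x d" if "q \<in> closed_segment x y" for q
      proof -
        have "dist x q \<le> dist x y" using dist_in_closed_segment[OF that] by (simp add: dist_commute)
        then show ?thesis using xy small[OF \<delta>] \<delta>(1) by (simp add: ball_subset_ball_iff dist_commute)
      qed
      ultimately show ?thesis
        by (intro exI[of _ y]) (simp, blast)
    next
      case False
      then obtain p where p: "p \<in> I" "x \<in> ball p (\<rho> p)" using near by blast
      then have pF: "p \<in> ?F" using I(1) by blast
      note c = ch[OF pF] and cs = rp[OF pF] Lp[OF pF] ep[OF pF]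
      have hl: "h p q \<le> h p w + L p * dist q w" for q w
      proof -
        have "\<bar>h p q - h p w\<bar> \<le> L p * dist q w" using c by blast
        then show ?thesis by linarith
      qed
      have rr: "r p = 16 * (L p * \<rho> p)" "L p * \<rho> p \<ge> \<rho> p" "\<rho> p > 0" using \<rho>[OF pF] cs by auto
      have \<rho>p: "\<rho>0 \<le> \<rho> p" using \<rho>0 p by blast
      have py: "dist p y < 2 * \<rho> p" and px: "dist p x < \<rho> p"
        using p(2) xy \<rho>p dist_triangle[of p y x] unfolding mem_ball by linarith+
      have deep: "h p z \<le> - (\<kappa> * \<delta>)" if z: "ball z (\<kappa> * \<delta>) \<subseteq> ?K" "dist p z < 2 * \<rho> p" for z
      proof (rule ccontr)
        assume *: "\<not> ?thesis"
        have inr: "w \<in> ball p (r p)" if "w \<in> ball z (\<kappa> * \<delta>)" for w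
          using that z(2) rr \<rho>p small[OF \<delta>] \<delta>(1) dist_triangle[of p w z] unfolding mem_ball by linarith
        have "z \<in> ball z (\<kappa> * \<delta>)" using \<kappa>\<delta> by simp
        then have hz: "h p z \<le> 0" using inr c z(1) by blast
        \<comment> \<open>The midpoint between \<open>- h p z\<close> and
          \<open>\<kappa> * \<delta>\<close>: a rise by \<open>t\<close> stays in the ball, hence in
          the complement, and yet crosses the graph.\<close>
        define t where "t = (\<kappa> * \<delta> - h p z) / 2"
        have t: "0 \<le> t" "t < \<kappa> * \<delta>" "h p z + t > 0" proof -
          define m where "m = \<kappa> * \<delta>"
          show "0 \<le> t" "t < \<kappa> * \<delta>" "h p z + t > 0"
            using * hz \<kappa>\<delta> unfolding t_def m_def[symmetric] by (simp_all add: field_simps)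
        qed
        have "z - (- t) *\<^sub>R e p \<in> ball z (\<kappa> * \<delta>)" using t cs by (simp add: dist_norm)
        then have "h p (z - (- t) *\<^sub>R e p) \<le> 0" using inr c z(1) by blast
        moreover have "h p (z - (- t) *\<^sub>R e p) = h p z - (- t)" using c by blast
        ultimately show False using t by simp
      qed
      have good: "ball q (2 * \<delta>) \<subseteq> ?K" if q: "h p q \<le> - (\<kappa> * \<delta>)" "dist p q < 8 * (L p * \<rho> p)" for q
      proof
        fix w assume w: "w \<in> ball q (2 * \<delta>)"
        have "w \<in> ball p (r p)"
          using w q(2) rr \<rho>p small[OF \<delta>] \<delta>(1) dist_triangle[of p w q] unfolding mem_ball by linarith
        moreover have "h p w \<le> 0"
        proof -
          have "h p w \<le> h p q + L p * dist w q" by (rule hl)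
          also have "L p * dist w q \<le> \<Lambda> * (2 * \<delta>)"
            using \<Lambda>[OF p(1)] L0[OF p(1)] w \<Lambda>1 by (intro mult_mono) (auto simp: dist_commute)
          finally show ?thesis using q(1) by (simp add: \<kappa>_def algebra_simps)
        qed
        ultimately show "w \<in> ?K" using c by blast
      qed
      \<comment> \<open>The descent exceeds \<open>L p * (3 * \<rho> p)\<close>, the most that
        \<open>h\<close> can gain along the middle leg of the path, so that leg is as deep as its
        starting point was before the descent.\<close>
      define \<tau> where "\<tau> = 4 * (L p * \<rho> p)"
      have \<tau>: "\<tau> > 0" using rr by (simp add: \<tau>_def)
      let ?a = "x - \<tau> *\<^sub>R e p" and ?b = "y - \<tau> *\<^sub>R e p"
      have down: "ball q (2 * \<delta>) \<subseteq> ?K"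
        if q: "q \<in> closed_segment z (z - \<tau> *\<^sub>R e p)" and z: "ball z (\<kappa> * \<delta>) \<subseteq> ?K" "dist p z < 2 * \<rho> p" for q z
      proof -
        obtain u where u: "0 \<le> u" "u \<le> 1" "q = (1 - u) *\<^sub>R z + u *\<^sub>R (z - \<tau> *\<^sub>R e p)"
          using q by (auto simp: in_segment)
        then have q': "q = z - (u * \<tau>) *\<^sub>R e p" by (simp add: algebra_simps)
        have u\<tau>: "0 \<le> u * \<tau>" "u * \<tau> \<le> \<tau>" using u \<tau> mult_right_mono[of u 1 \<tau>] by auto
        have "h p q = h p z - u * \<tau>" using c q' by blast
        then have "h p q \<le> - (\<kappa> * \<delta>)" using deep[OF z] u\<tau> by simp
        moreover have "dist z q = u * \<tau>" using cs u\<tau> by (simp add: q' dist_norm)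
        then have "dist p q < 8 * (L p * \<rho> p)"
          using z(2) u\<tau> rr(2) \<tau>_def dist_triangle[of p q z] by linarith
        ultimately show ?thesis by (rule good)
      qed
      have across: "ball q (2 * \<delta>) \<subseteq> ?K" if q: "q \<in> closed_segment ?a ?b" for q
      proof -
        have ab: "dist ?a ?b = dist x y" by (simp add: dist_norm)
        have "dist p x < 2 * \<rho> p" using px rr by simp
        have "L p * dist q ?a \<le> L p * (3 * \<rho> p)"
        proof (intro mult_left_mono L0 p)
          have "dist ?a q \<le> dist ?a ?b" using dist_in_closed_segment[OF q] by (simp add: dist_commute)
          then show "dist q ?a \<le> 3 * \<rho> p"
            using ab px py dist_triangle[of x y p] by (simp add: dist_commute)
        qed
        moreover have "h p q \<le> h p ?a + L p * dist q ?a" by (rule hl)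
        moreover have "h p ?a = h p x - \<tau>" using c by blast
        moreover have "L p * (3 * \<rho> p) \<le> \<tau>" using rr by (simp add: \<tau>_def algebra_simps)
        ultimately have "h p q \<le> - (\<kappa> * \<delta>)" using deep[OF bx \<open>dist p x < 2 * \<rho> p\<close>] by linarith
        moreover have "dist p q < 8 * (L p * \<rho> p)"
        proof -
          have "dist x ?a = \<tau>" using cs \<tau> by (simp add: dist_norm)
          moreover have "dist ?a q \<le> dist ?a ?b" using dist_in_closed_segment[OF q] by (simp add: dist_commute)
          ultimately show ?thesis
            using ab px xy[unfolded min_less_iff_conj] \<rho>p rr(2,3) \<tau>_def dist_triangle[of p q x] dist_triangle[of x q ?a] by linarith
        qed
        ultimately show ?thesis by (rule good)
      qed
      show ?thesis
      proof (rule exI[of _ ?a], rule exI[of _ ?b], rule ballI)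
        fix q assume "q \<in> closed_segment x ?a \<union> closed_segment ?a ?b \<union> closed_segment ?b y"
        then show "ball q (2 * \<delta>) \<subseteq> ?K"
          using down[of q x, OF _ bx] down[of q y, OF _ "by" py] across[of q] px rr(3)
          unfolding closed_segment_commute[of ?b y] by auto
      qed
    qed
  qed
qed

section \<open>Plane vector fields\<close>

abbreviation "e1 \<equiv> axis 1 1 :: real^2"
abbreviation "e2 \<equiv> axis 2 1 :: real^2"

lemma axis_decomp: "(h::real^2) = h $ 1 *\<^sub>R e1 + h $ 2 *\<^sub>R e2"
  by (simp add: vec_eq_iff forall_2 axis_def)

lemma grad_nth: "grad u x $ i $ j = pd u (axis j 1) x $ i"
  by (simp add: grad_def jacobian_def matrix_def pd_def)

lemma norm_grad: "(norm (grad u x))\<^sup>2 = (norm (pd u e1 x))\<^sup>2 + (norm (pd u e2 x))\<^sup>2"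
  by (simp add: norm_vec_def L2_set_def sum_2 grad_nth sum_nonneg power2_eq_square[symmetric])

lemma divergence_pd: "divergence u x = pd u e1 x $ 1 + pd u e2 x $ 2"
  by (simp add: divergence_def trace_def sum_2 grad_nth)

lemma pd_decomp:
  assumes "smooth (u :: real^2 \<Rightarrow> 'b::real_normed_vector)"
  shows "pd u h x = h $ 1 *\<^sub>R pd u e1 x + h $ 2 *\<^sub>R pd u e2 x"
proof -
  have lin: "linear (\<lambda>h. pd u h x)" by (rule bounded_linear.linear[OF smooth_bounded_linear_pd[OF assms]])
  show ?thesis
    by (subst axis_decomp[of h]) (simp only: linear_add[OF lin] linear_scale[OF lin])
qed

lemma norm_pd_axis_le: "norm (pd u (axis j 1) x) \<le> norm (grad u x)"
proof -
  have "(norm (pd u (axis j 1) x))\<^sup>2 \<le> (norm (grad u x))\<^sup>2"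
    using exhaust_2[of j] by (auto simp: norm_grad)
  then show ?thesis by (rule power2_le_imp_le) simp
qed

lemma norm_pd_le:
  fixes u :: "real^2 \<Rightarrow> real^2"
  assumes "smooth u"
  shows "norm (pd u h x) \<le> 2 * norm h * norm (grad u x)"
proof -
  have "norm (pd u h x) \<le> \<bar>h $ 1\<bar> * norm (pd u e1 x) + \<bar>h $ 2\<bar> * norm (pd u e2 x)"
    unfolding pd_decomp[OF assms, of h] by (rule order_trans[OF norm_triangle_ineq]) simp
  also have "\<dots> \<le> norm h * norm (grad u x) + norm h * norm (grad u x)"
    by (intro add_mono mult_mono component_le_norm_cart norm_pd_axis_le) auto
  finally show ?thesis by simp
qed

lemma solenoidal_test_fieldD:
  assumes "\<phi> \<in> solenoidal_test_fields \<Omega>"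
  obtains S where "smooth \<phi>" "compact S" "S \<subseteq> \<Omega>" "\<And>x. x \<notin> S \<Longrightarrow> \<phi> x = 0" "\<And>x h. x \<notin> S \<Longrightarrow> pd \<phi> h x = 0"
    "\<And>x. divergence \<phi> x = 0"
proof -
  define S where "S = closure {x. \<phi> x \<noteq> 0}"
  have S: "compact S" "S \<subseteq> \<Omega>" and s: "smooth \<phi>" and d: "\<And>x. x \<in> \<Omega> \<Longrightarrow> divergence \<phi> x = 0"
    using assms by (auto simp: solenoidal_test_fields_def test_functions_def S_def)
  have 0: "\<phi> x = 0" if "x \<notin> S" for x
    using that closure_subset[of "{x. \<phi> x \<noteq> 0}"] by (auto simp: S_def)
  have pd0: "pd \<phi> h x = 0" if "x \<notin> S" for x h
  proof (rule pd_eq_0_open)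
    show "open (- S)" by (simp add: S_def open_Compl)
  qed (use that 0 in auto)
  have "divergence \<phi> x = 0" for x
    using d[of x] pd0[of x] S(2) by (cases "x \<in> S") (auto simp: divergence_pd)
  then show thesis using that s S 0 pd0 by blast
qed

lemma solenoidal_test_fieldI:
  assumes "smooth \<phi>" "compact S" "S \<subseteq> \<Omega>" "\<And>x. x \<notin> S \<Longrightarrow> \<phi> x = 0" "\<And>x. divergence \<phi> x = 0"
  shows "\<phi> \<in> solenoidal_test_fields \<Omega>"
proof -
  have sub: "closure {x. \<phi> x \<noteq> 0} \<subseteq> S"
    by (rule closure_minimal) (use assms compact_imp_closed in auto)
  moreover have "compact (closure {x. \<phi> x \<noteq> 0})"
    using compact_Int_closed[OF assms(2) closed_closure] sub by (metis inf.absorb_iff2)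
  ultimately show ?thesis
    using assms by (auto simp: solenoidal_test_fields_def test_functions_def)
qed

section \<open>Stream functions and their cutoffs\<close>

definition curl :: "(real^2 \<Rightarrow> real) \<Rightarrow> real^2 \<Rightarrow> real^2"
  where "curl w x = pd w e2 x *\<^sub>R e1 - pd w e1 x *\<^sub>R e2"

lemma smooth_curl: "smooth w \<Longrightarrow> smooth (curl w)"
  unfolding curl_def[abs_def] by (intro smooth_diff smooth_scaleR smooth_pd smooth_const)

lemma bounded_linear_scaleR_axis: "bounded_linear (\<lambda>t::real. t *\<^sub>R (c::real^2))"
  by (rule bounded_linear_scaleR_left)

lemma pd_curl:
  assumes "smooth w"
  shows "pd (curl w) h x = pd (pd w e2) h x *\<^sub>R e1 - pd (pd w e1) h x *\<^sub>R e2"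
proof -
  note s = smooth_pd[OF assms]
  note bl = bounded_linear_scaleR_axis
  show ?thesis
    unfolding curl_def[abs_def] pd_diff[OF smooth_linear_compose[OF bl s] smooth_linear_compose[OF bl s]]
      pd_linear_compose[OF bl s] ..
qed

lemma divergence_curl: "smooth w \<Longrightarrow> divergence (curl w) x = 0"
  using pd_commute[of w e2 e1 x] by (simp add: divergence_pd pd_curl axis_def)

lemma curl_diff: "smooth f \<Longrightarrow> smooth g \<Longrightarrow> curl (\<lambda>x. f x - g x) x = curl f x - curl g x"
  by (simp add: curl_def pd_diff algebra_simps)

lemma curl_cong_open:
  "open U \<Longrightarrow> x \<in> U \<Longrightarrow> (\<And>y. y \<in> U \<Longrightarrow> f y = g y) \<Longrightarrow> smooth g \<Longrightarrow> curl f x = curl g x"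
  by (simp add: curl_def pd_cong_open[of U x f g])

lemma curl_eq_0_open:
  assumes "open U" "x \<in> U" "\<And>y. y \<in> U \<Longrightarrow> f y = c"
  shows "curl f x = 0"
  using pd_eq_0_open[OF assms] by (simp add: curl_def)

lemma norm_axis_comb_le: "norm (a *\<^sub>R e1 - b *\<^sub>R e2) \<le> \<bar>a\<bar> + \<bar>b\<bar>"
  by (rule order_trans[OF norm_triangle_ineq4]) simp

text \<open>The quarter turn \<open>R\<close> makes the vanishing divergence of \<open>u\<close>
  into symmetry of the derivative of \<open>R (u x)\<close>, so the Poincare lemma applies; as the
  field lives on the whole plane, holes cause no flux obstruction. The bounds hold because
  \<open>R\<close> is an isometry.\<close>

lemma stream_function:
  fixes u :: "real^2 \<Rightarrow> real^2"
  assumes u: "smooth u" and div: "\<And>x. divergence u x = 0"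
  obtains \<psi> where "smooth \<psi>" "\<And>x. curl \<psi> x = u x" "\<And>h x. \<bar>pd \<psi> h x\<bar> \<le> norm (u x) * norm h"
    "\<And>h k x. \<bar>pd (pd \<psi> h) k x\<bar> \<le> norm (pd u k x) * norm h"
proof -
  define R where "R z = (z $ 1) *\<^sub>R e2 - (z $ 2) *\<^sub>R e1" for z :: "real^2"
  have lR: "bounded_linear R"
    unfolding R_def[abs_def]
    by (intro bounded_linear_sub bounded_linear_compose[OF bounded_linear_scaleR_left] bounded_linear_vec_nth)
  have nR: "norm (R z) = norm z" for z
  proof -
    have "(norm (R z))\<^sup>2 = (norm z)\<^sup>2"
      unfolding power2_norm_eq_inner by (simp add: R_def inner_vec_def sum_2 axis_def)
    then show ?thesis by simp
  qed
  have sR: "smooth (\<lambda>x. R (u x))" by (rule smooth_linear_compose[OF lR u])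
  have pR: "pd (\<lambda>x. R (u x)) h x = R (pd u h x)" for h x by (rule pd_linear_compose[OF lR u])
  obtain \<psi> where \<psi>: "smooth \<psi>" "\<And>x h. pd \<psi> h x = R (u x) \<bullet> h"
  proof (rule smooth_potential[OF sR])
    fix x h k
    have "pd u e1 x $ 1 = - pd u e2 x $ 2" using div[of x] by (simp add: divergence_pd)
    then show "pd (\<lambda>x. R (u x)) h x \<bullet> k = pd (\<lambda>x. R (u x)) k x \<bullet> h"
      unfolding pR pd_decomp[OF u, of h] pd_decomp[OF u, of k]
      by (simp add: R_def inner_vec_def sum_2 axis_def algebra_simps)
  qed blast
  have pp: "pd (pd \<psi> h) k x = R (pd u k x) \<bullet> h" for h k x
  proof -
    have "pd \<psi> h = (\<lambda>x. R (u x) \<bullet> h)" by (rule ext) (rule \<psi>(2))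
    then show ?thesis using pd_linear_compose[OF bounded_linear_inner_left sR] pR by simp
  qed
  show thesis
  proof
    show "smooth \<psi>" by fact
    show "curl \<psi> x = u x" for x
      by (simp add: curl_def \<psi>(2) R_def inner_vec_def sum_2 axis_def vec_eq_iff forall_2)
    show "\<bar>pd \<psi> h x\<bar> \<le> norm (u x) * norm h" for h x
      unfolding \<psi>(2) using Cauchy_Schwarz_ineq2[of "R (u x)" h] nR by simp
    show "\<bar>pd (pd \<psi> h) k x\<bar> \<le> norm (pd u k x) * norm h" for h k x
      unfolding pp using Cauchy_Schwarz_ineq2[of "R (pd u k x)" h] nR by simp
  qed
qed

text \<open>Leibniz rule: every derivative that hits \<open>\<zeta>\<close> costs
  \<open>1 / \<delta>\<close>, every one that hits \<open>\<psi>\<close> is paid by \<open>u\<close>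
  or its derivative. The constant \<open>c\<close> is free and can be fitted to
  \<open>\<psi>\<close> where \<open>\<zeta>\<close> varies. The leading 2 counts the two components
  of \<open>curl\<close>.\<close>

lemma curl_cutoff_bounds:
  fixes \<psi> \<zeta> :: "real^2 \<Rightarrow> real" and u :: "real^2 \<Rightarrow> real^2" and c :: real
  assumes \<zeta>: "controlled C \<delta> \<zeta>" and C: "C \<ge> 0" "\<delta> > 0" and \<psi>: "smooth \<psi>"
    and p1: "\<And>h x. \<bar>pd \<psi> h x\<bar> \<le> norm (u x) * norm h"
    and p2: "\<And>h k x. \<bar>pd (pd \<psi> h) k x\<bar> \<le> norm (pd u k x) * norm h"
  defines "g \<equiv> \<lambda>x. \<zeta> x * (\<psi> x - c)"
  shows "smooth g" "norm (curl g x) \<le> 2 * C * (\<bar>\<psi> x - c\<bar> / \<delta> + norm (u x))"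
    "norm k = 1 \<Longrightarrow> norm (pd (curl g) k x) \<le>
      2 * C * (\<bar>\<psi> x - c\<bar> / \<delta>\<^sup>2 + 2 * norm (u x) / \<delta> + norm (pd u k x))"
proof -
  have s: "smooth \<zeta>" and b0: "\<bar>\<zeta> x\<bar> \<le> C" and b1: "\<bar>pd \<zeta> h x\<bar> \<le> C / \<delta> * norm h"
    and b2: "\<bar>pd (pd \<zeta> h) k x\<bar> \<le> C / \<delta>\<^sup>2 * norm h * norm k" for x h k
    using \<zeta> unfolding controlled_def by blast+
  have s': "smooth (\<lambda>x. \<psi> x - c)" by (intro smooth_diff \<psi> smooth_const)
  show sg: "smooth g" unfolding g_def by (intro smooth_mult s s')
  have pg: "pd g h = (\<lambda>x. \<zeta> x * pd \<psi> h x + pd \<zeta> h x * (\<psi> x - c))" for h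
    unfolding g_def by (rule ext) (simp add: pd_mult[OF s s'] pd_diff[OF \<psi> smooth_const])
  have ppg: "pd (pd g h) k x = \<zeta> x * pd (pd \<psi> h) k x + pd \<zeta> k x * pd \<psi> h x
      + (pd \<zeta> h x * pd \<psi> k x + pd (pd \<zeta> h) k x * (\<psi> x - c))" for h k x
    unfolding pg
    by (simp add: pd_add[OF smooth_mult[OF s smooth_pd[OF \<psi>]] smooth_mult[OF smooth_pd[OF s] s']]
        pd_mult[OF s smooth_pd[OF \<psi>]] pd_mult[OF smooth_pd[OF s] s'] pd_diff[OF \<psi> smooth_const])
  have "\<bar>pd g h x\<bar> \<le> C * (\<bar>\<psi> x - c\<bar> / \<delta> + norm (u x))" if "norm h = 1" for h
  proof -
    have "\<bar>pd g h x\<bar> \<le> \<bar>\<zeta> x\<bar> * \<bar>pd \<psi> h x\<bar> + \<bar>pd \<zeta> h x\<bar> * \<bar>\<psi> x - c\<bar>"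
      unfolding pg by (rule order_trans[OF abs_triangle_ineq]) (simp add: abs_mult)
    also have "\<dots> \<le> C * norm (u x) + (C / \<delta>) * \<bar>\<psi> x - c\<bar>"
    proof -
      have "\<bar>pd \<zeta> h x\<bar> \<le> C / \<delta>" "\<bar>pd \<psi> h x\<bar> \<le> norm (u x)"
        using b1[of h x] p1[of h x] that by simp_all
      then show ?thesis using C by (intro add_mono mult_mono b0) simp_all
    qed
    finally show ?thesis by (simp add: algebra_simps)
  qed
  from this[of e1] this[of e2] norm_axis_comb_le[of "pd g e2 x" "pd g e1 x"]
  show "norm (curl g x) \<le> 2 * C * (\<bar>\<psi> x - c\<bar> / \<delta> + norm (u x))" by (simp add: curl_def)
  assume k: "norm k = 1"
  have "\<bar>pd (pd g h) k x\<bar> \<le> C * (\<bar>\<psi> x - c\<bar> / \<delta>\<^sup>2 + 2 * norm (u x) / \<delta> + norm (pd u k x))" if "norm h = 1" for h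
  proof -
    have "\<bar>pd (pd g h) k x\<bar> \<le> \<bar>\<zeta> x\<bar> * \<bar>pd (pd \<psi> h) k x\<bar> + \<bar>pd \<zeta> k x\<bar> * \<bar>pd \<psi> h x\<bar>
        + (\<bar>pd \<zeta> h x\<bar> * \<bar>pd \<psi> k x\<bar> + \<bar>pd (pd \<zeta> h) k x\<bar> * \<bar>\<psi> x - c\<bar>)"
      unfolding ppg abs_mult[symmetric] by linarith
    also have "\<dots> \<le> C * norm (pd u k x) + (C / \<delta>) * norm (u x) + ((C / \<delta>) * norm (u x) + (C / \<delta>\<^sup>2) * \<bar>\<psi> x - c\<bar>)"
    proof -
      have "\<bar>pd \<zeta> h x\<bar> \<le> C / \<delta>" "\<bar>pd \<zeta> k x\<bar> \<le> C / \<delta>" "\<bar>pd (pd \<zeta> h) k x\<bar> \<le> C / \<delta>\<^sup>2"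
        "\<bar>pd \<psi> h x\<bar> \<le> norm (u x)" "\<bar>pd \<psi> k x\<bar> \<le> norm (u x)" "\<bar>pd (pd \<psi> h) k x\<bar> \<le> norm (pd u k x)"
        using b1[of h x] b1[of k x] b2[of h k x] p1[of h x] p1[of k x] p2[of h k x] that k by simp_all
      then show ?thesis using C by (intro add_mono mult_mono b0) simp_all
    qed
    finally show ?thesis by (simp add: algebra_simps)
  qed
  from this[of e1] this[of e2] norm_axis_comb_le[of "pd (pd g e2) k x" "pd (pd g e1) k x"]
  show "norm (pd (curl g) k x) \<le> 2 * C * (\<bar>\<psi> x - c\<bar> / \<delta>\<^sup>2 + 2 * norm (u x) / \<delta> + norm (pd u k x))"
    by (simp add: pd_curl[OF sg])
qed

section \<open>Averages over squares\<close>

text \<open>An indicator kernel is enough for smooth averages, because the fields that are averaged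
  are already smooth; it makes averaging a contraction by Cauchy-Schwarz alone.\<close>

definition mean :: "real \<Rightarrow> (real^2 \<Rightarrow> 'b::euclidean_space) \<Rightarrow> real^2 \<Rightarrow> 'b"
  where "mean \<delta> f x = (1 / (2 * \<delta>)\<^sup>2) *\<^sub>R avg (- \<delta> *\<^sub>R One) (\<delta> *\<^sub>R One) (\<lambda>_. 1) (\<lambda>y. y) f x"

lemma measure_cube: "\<delta> > 0 \<Longrightarrow> measure lborel (cbox (- \<delta> *\<^sub>R One) (\<delta> *\<^sub>R One :: real^2)) = (2 * \<delta>)\<^sup>2"
  by (simp add: content_cbox_cases)

text \<open>The half-diagonal \<open>sqrt 2 * \<delta>\<close> is below \<open>2 * \<delta>\<close>.
  This is the reach of \<open>mean\<close> in all support arguments, and hence the depth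
  \<open>2 * \<delta>\<close> asked of the paths inside the complement.\<close>

lemma norm_cube:
  assumes "\<delta> > 0" "y \<in> cbox (- \<delta> *\<^sub>R One) (\<delta> *\<^sub>R One :: real^2)"
  shows "norm y < 2 * \<delta>"
proof -
  have "\<bar>y $ i\<bar> \<le> \<delta>" for i
  proof -
    have ax: "axis i 1 \<in> (Basis :: (real^2) set)" by simp
    have One: "One \<bullet> (axis i 1 :: real^2) = 1"
      using inner_sum_left_Basis[OF ax, of "\<lambda>_. 1"] by simp
    show ?thesis
      using bspec[OF assms(2)[unfolded mem_box] ax] unfolding inner_scaleR_left inner_minus_left One
      by (simp add: inner_axis abs_le_iff)
  qed
  then have sq: "(y $ i)\<^sup>2 \<le> \<delta>\<^sup>2" for i using assms(1) by (simp add: abs_le_square_iff[symmetric])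
  have "(norm y)\<^sup>2 = (y $ 1)\<^sup>2 + (y $ 2)\<^sup>2"
    unfolding power2_norm_eq_inner by (simp add: inner_vec_def sum_2 power2_eq_square)
  with sq[of 1] sq[of 2] have "(norm y)\<^sup>2 \<le> 2 * \<delta>\<^sup>2" by linarith
  also have "\<dots> < (2 * \<delta>)\<^sup>2" using assms(1) by (simp add: power2_eq_square)
  finally show ?thesis by (rule power2_less_imp_less) (use assms(1) in simp)
qed

lemma continuous_on_const1: "continuous_on S (\<lambda>_. 1 :: real)"
  and continuous_on_ident': "continuous_on S (\<lambda>y. y)"
  by (intro continuous_intros)+

lemmas cube_cont = continuous_on_const1 continuous_on_ident'

lemma smooth_mean: "smooth f \<Longrightarrow> smooth (mean \<delta> f)"
  unfolding mean_def[abs_def]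
  by (intro smooth_scaleR smooth_const smooth_avg[OF cube_cont])

lemma pd_mean: "smooth f \<Longrightarrow> pd (mean \<delta> f) h x = mean \<delta> (pd f h) x"
  unfolding mean_def[abs_def]
  by (simp add: pd_linear_compose[OF bounded_linear_scaleR_right smooth_avg[OF cube_cont]] pd_avg[OF cube_cont])

lemma mean_integrable:
  fixes f :: "real^2 \<Rightarrow> 'b::euclidean_space"
  assumes "continuous_on UNIV f"
  shows "(\<lambda>y. f (x + y)) integrable_on cbox (- \<delta> *\<^sub>R One) (\<delta> *\<^sub>R One :: real^2)"
  using avg_integrable[OF cube_cont assms] by simp

lemma mean_diff:
  assumes "continuous_on UNIV f" "continuous_on UNIV g"
  shows "mean \<delta> (\<lambda>x. f x - g x) x = mean \<delta> f x - mean \<delta> g x"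
  using integral_diff[OF mean_integrable[OF assms(1)] mean_integrable[OF assms(2)]]
  by (simp add: mean_def avg_def scaleR_diff_right)

lemma mean_linear:
  assumes "continuous_on UNIV f" "bounded_linear L"
  shows "mean \<delta> (\<lambda>x. L (f x)) x = L (mean \<delta> f x)"
  using integral_linear[OF mean_integrable[OF assms(1), of x \<delta>] assms(2)]
  by (simp add: mean_def avg_def o_def linear_scale[OF bounded_linear.linear[OF assms(2)]])

lemma mean_norm_le:
  assumes "continuous_on UNIV f" "\<delta> > 0" "\<And>y. norm y < 2 * \<delta> \<Longrightarrow> norm (f (x + y)) \<le> \<eta>"
  shows "norm (mean \<delta> f x) \<le> \<eta>"
proof -
  let ?Q = "cbox (- \<delta> *\<^sub>R One) (\<delta> *\<^sub>R One :: real^2)"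
  have "norm (integral ?Q (\<lambda>y. f (x + y))) \<le> integral ?Q (\<lambda>y. \<eta>)"
    by (rule integral_norm_bound_integral[OF mean_integrable[OF assms(1)]])
      (use norm_cube[OF assms(2)] assms(3) in auto)
  also have "\<dots> = (2 * \<delta>)\<^sup>2 * \<eta>" by (simp add: measure_cube[OF assms(2)] del: scaleR_minus_left)
  finally show ?thesis
    using assms(2) by (simp add: mean_def avg_def divide_le_eq mult.commute)
qed

lemma mean_eq_0:
  assumes "continuous_on UNIV f" "\<delta> > 0" "\<And>y. dist x y < 2 * \<delta> \<Longrightarrow> f y = 0"
  shows "mean \<delta> f x = 0"
  using mean_norm_le[OF assms(1,2), of x 0] assms(3)[of "x + _"] by (simp add: dist_norm)

lemma mean_minus_le:
  assumes "continuous_on UNIV f" "\<delta> > 0" "\<And>y. norm y < 2 * \<delta> \<Longrightarrow> norm (f (x + y) - f x) \<le> \<eta>"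
  shows "norm (mean \<delta> f x - f x) \<le> \<eta>"
proof -
  have "(2 * \<delta>)\<^sup>2 \<noteq> 0" using assms(2) by simp
  then have 1: "mean \<delta> (\<lambda>_. f x) x = f x"
    unfolding mean_def avg_def integral_const measure_cube[OF assms(2)] by simp
  have 2: "mean \<delta> (\<lambda>z. f z - f x) x = mean \<delta> f x - mean \<delta> (\<lambda>_. f x) x"
    by (rule mean_diff[OF assms(1) continuous_on_const])
  have "norm (mean \<delta> (\<lambda>z. f z - f x) x) \<le> \<eta>"
    by (rule mean_norm_le[OF continuous_on_diff[OF assms(1) continuous_on_const] assms(2,3)])
  then show ?thesis unfolding 2 1 .
qed

lemma divergence_mean:
  assumes f: "smooth f" and "\<And>x. divergence f x = 0"
  shows "divergence (mean \<delta> f) x = 0"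
proof -
  note c = smooth_continuous_on[OF smooth_pd[OF f]]
  have bl: "bounded_linear (\<lambda>z::real^2. - (z $ 2))"
    by (intro bounded_linear_minus bounded_linear_vec_nth)
  have 1: "mean \<delta> (\<lambda>x. pd f e1 x $ 1) x = mean \<delta> (pd f e1) x $ 1"
    by (rule mean_linear[OF c bounded_linear_vec_nth])
  have 2: "mean \<delta> (\<lambda>x. - (pd f e2 x $ 2)) x = - (mean \<delta> (pd f e2) x $ 2)"
    by (rule mean_linear[OF c bl])
  have "pd f e1 z $ 1 - - (pd f e2 z $ 2) = 0" for z
    using assms(2)[of z] by (simp add: divergence_pd)
  then have "mean \<delta> (\<lambda>x. pd f e1 x $ 1 - - (pd f e2 x $ 2)) x = 0"
    unfolding mean_def avg_def by (simp only: scaleR_zero_right integral_0)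
  moreover have "mean \<delta> (\<lambda>x. pd f e1 x $ 1 - - (pd f e2 x $ 2)) x =
      mean \<delta> (\<lambda>x. pd f e1 x $ 1) x - mean \<delta> (\<lambda>x. - (pd f e2 x $ 2)) x"
    by (rule mean_diff) (intro continuous_intros c)+
  ultimately show ?thesis
    unfolding 1 2 divergence_pd pd_mean[OF f] by simp
qed

lemma continuous_on_mean:
  fixes f :: "real^2 \<Rightarrow> 'b::euclidean_space"
  assumes f: "continuous_on UNIV f"
  shows "continuous_on UNIV (\<lambda>x. integral (cbox l r) (\<lambda>y. f (x + y)))"
proof -
  have "continuous_on (UNIV \<times> cbox l r) (\<lambda>(x, y). f (x + y))"
    unfolding split_beta by (intro continuous_on_compose2[OF f] continuous_intros) auto
  then show ?thesis by (rule integral_continuous_on_param)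
qed

lemma borel_measurable_lebesgueI: "f \<in> borel_measurable borel \<Longrightarrow> f \<in> borel_measurable lebesgue"
  by (rule measurable_completion) simp

lemma continuous_lebesgue:
  fixes f :: "'a::euclidean_space \<Rightarrow> 'b::topological_space"
  shows "continuous_on UNIV f \<Longrightarrow> f \<in> borel_measurable lebesgue"
  by (rule borel_measurable_lebesgueI) (rule borel_measurable_continuous_onI)

text \<open>The normalisation of \<open>mean\<close> cancels both factors of the measure in the
  general bound, so averaging is a contraction up to an enlargement of the domain.\<close>

lemma energy_mean_le:
  assumes f: "continuous_on UNIV f" and \<delta>: "\<delta> > 0" and S: "S \<in> sets borel" "S' \<in> sets borel"
    and sub: "\<And>x y. x \<in> S \<Longrightarrow> norm y < 2 * \<delta> \<Longrightarrow> x + y \<in> S'"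
  shows "energy S (mean \<delta> f) \<le> energy S' f"
proof -
  let ?Q = "cbox (- \<delta> *\<^sub>R One) (\<delta> *\<^sub>R One) :: (real^2) set"
  let ?A = "avg (- \<delta> *\<^sub>R One) (\<delta> *\<^sub>R One) (\<lambda>_. 1) (\<lambda>y::real^2. y) f"
  let ?c = "(2 * \<delta>)\<^sup>2"
  have c: "?c > 0" using \<delta> by simp
  have "?A = (\<lambda>x. integral ?Q (\<lambda>y. f (x + y)))" by (rule ext) (simp add: avg_def)
  then have m: "?A \<in> borel_measurable lebesgue"
    using continuous_lebesgue[OF continuous_on_mean[OF f]] by simp
  have "energy S (mean \<delta> f) = ennreal ((1 / ?c)\<^sup>2) * energy S ?A"
    unfolding mean_def[abs_def] using S by (intro energy_scaleR m) auto
  also have "\<dots> \<le> ennreal ((1 / ?c)\<^sup>2) * (ennreal (?c\<^sup>2) * energy S' f)"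
  proof (rule mult_left_mono)
    show "energy S ?A \<le> ennreal (?c\<^sup>2) * energy S' f"
      unfolding measure_cube[OF \<delta>, symmetric]
      by (rule energy_avg_le[OF cube_cont(1) _ cube_cont(2) f S]) (use norm_cube[OF \<delta>] sub in auto)
  qed simp
  also have "\<dots> = (ennreal ((1 / ?c)\<^sup>2) * ennreal (?c\<^sup>2)) * energy S' f" by (rule mult.assoc[symmetric])
  also have "ennreal ((1 / ?c)\<^sup>2) * ennreal (?c\<^sup>2) = 1"
    using c by (subst ennreal_mult[symmetric]) (simp_all add: power_divide)
  finally show ?thesis by simp
qed

text \<open>Uniform continuity makes the error small everywhere, and the support of \<open>g\<close>
  confines it to a ball of radius \<open>r + 2\<close>, so a small supremum gives a small
  energy.\<close>

lemma mean_approx: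
  fixes g :: "real^2 \<Rightarrow> 'b::euclidean_space"
  assumes g: "continuous_on UNIV g" "\<And>x. norm x > r \<Longrightarrow> g x = 0" and r: "r \<ge> 0" and \<epsilon>: "(\<epsilon>::real) > 0"
  obtains d where "d > 0" "\<And>\<delta>. 0 < \<delta> \<Longrightarrow> \<delta> < d \<Longrightarrow> energy UNIV (\<lambda>x. mean \<delta> g x - g x) \<le> ennreal \<epsilon>"
proof -
  define V where "V = measure lebesgue (cball (0::real^2) (r + 2)) + 1"
  have V: "V > 0" by (simp add: V_def add_nonneg_pos)
  define \<eta> where "\<eta> = sqrt (\<epsilon> / V)"
  have \<eta>: "\<eta> > 0" "\<eta>\<^sup>2 = \<epsilon> / V" using \<epsilon> V by (simp_all add: \<eta>_def)
  have "uniformly_continuous_on (cball 0 (r + 4)) g"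
    by (intro compact_uniformly_continuous continuous_on_subset[OF g(1)]) auto
  then obtain d0 where d0: "d0 > 0" "\<And>x y. x \<in> cball 0 (r + 4) \<Longrightarrow> y \<in> cball 0 (r + 4) \<Longrightarrow> dist y x < d0 \<Longrightarrow> dist (g y) (g x) < \<eta>"
    using \<eta>(1) unfolding uniformly_continuous_on_def by metis
  define d where "d = min (d0 / 2) 1"
  show thesis
  proof (rule that)
    show "d > 0" using d0 by (simp add: d_def)
    fix \<delta> assume \<delta>: "0 < \<delta>" "\<delta> < d"
    then have \<delta>': "2 * \<delta> < d0" "2 * \<delta> < 2" by (auto simp: d_def)
    have 0: "mean \<delta> g x - g x = 0" if "norm x > r + 2" for x
    proof -
      have "mean \<delta> g x = 0"
      proof (rule mean_eq_0[OF g(1) \<delta>(1)])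
        fix y assume "dist x y < 2 * \<delta>"
        then have "norm y > r" using that \<delta>'(2) norm_triangle_ineq2[of x y] by (simp add: dist_norm)
        then show "g y = 0" by (rule g(2))
      qed
      moreover have "g x = 0" using that by (intro g(2)) simp
      ultimately show ?thesis by simp
    qed
    have b: "norm (mean \<delta> g x - g x) \<le> \<eta>" for x
    proof (cases "norm x > r + 2")
      case True
      then show ?thesis using 0 \<eta>(1) by simp
    next
      case False
      show ?thesis
      proof (rule mean_minus_le[OF g(1) \<delta>(1)])
        fix y :: "real^2" assume y: "norm y < 2 * \<delta>"
        have "dist (g (x + y)) (g x) < \<eta>"
        proof (rule d0(2))
          show "x \<in> cball 0 (r + 4)" using False by simp
          show "x + y \<in> cball 0 (r + 4)" using False y \<delta>'(2) norm_triangle_ineq[of x y] by simp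
          show "dist (x + y) x < d0" using y \<delta>'(1) by (simp add: dist_norm)
        qed
        then show "norm (g (x + y) - g x) \<le> \<eta>" by (simp add: dist_norm)
      qed
    qed
    have "energy UNIV (\<lambda>x. mean \<delta> g x - g x) \<le> ennreal (\<eta>\<^sup>2) * emeasure lebesgue (cball (0::real^2) (r + 2))"
      by (rule energy_bounded[OF b]) (use 0 in auto)
    also have "emeasure lebesgue (cball (0::real^2) (r + 2)) = ennreal (measure lebesgue (cball (0::real^2) (r + 2)))"
      by (rule emeasure_eq_measure2) (rule lmeasurable_cball)
    also have "ennreal (\<eta>\<^sup>2) * \<dots> = ennreal (\<eta>\<^sup>2 * measure lebesgue (cball (0::real^2) (r + 2)))"
      by (simp add: ennreal_mult)
    also have "\<dots> \<le> ennreal \<epsilon>"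
    proof (rule ennreal_leI)
      have "\<eta>\<^sup>2 * measure lebesgue (cball (0::real^2) (r + 2)) \<le> \<eta>\<^sup>2 * V"
        by (intro mult_left_mono) (auto simp: V_def)
      then show "\<eta>\<^sup>2 * measure lebesgue (cball (0::real^2) (r + 2)) \<le> \<epsilon>" using V by (simp add: \<eta>(2))
    qed
    finally show "energy UNIV (\<lambda>x. mean \<delta> g x - g x) \<le> ennreal \<epsilon>" .
  qed
qed

section \<open>Truncation of a stream function\<close>

lemma continuous_on_grad: "smooth u \<Longrightarrow> continuous_on S (grad u)"
proof -
  assume u: "smooth u"
  have "grad u = (\<lambda>x. \<chi> i j. pd u (axis j 1) x $ i)" by (simp add: fun_eq_iff vec_eq_iff grad_nth)
  then show ?thesis
    by (simp only:) (intro continuous_on_vec_lambda continuous_on_component smooth_continuous_on smooth_pd u)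
qed

lemma energy_pd_le_grad:
  fixes u :: "real^2 \<Rightarrow> real^2"
  assumes u: "smooth u" and S: "S \<in> sets borel" and h: "norm h = 1"
  shows "energy S (pd u h) \<le> 4 * energy S (grad u)"
proof -
  have "energy S (pd u h) \<le> energy S (\<lambda>x. 2 *\<^sub>R grad u x)"
    by (rule energy_mono) (use norm_pd_le[OF u, of h] h in simp)
  also have "\<dots> = ennreal (2\<^sup>2) * energy S (grad u)"
    by (rule energy_scaleR) (use S in \<open>auto intro: continuous_lebesgue continuous_on_grad u\<close>)
  finally show ?thesis by simp
qed

lemma ennreal_mult_assoc: "a \<ge> 0 \<Longrightarrow> b \<ge> 0 \<Longrightarrow> ennreal a * (ennreal b * X) = ennreal (a * b) * X"
  by (simp add: ennreal_mult mult.assoc)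

lemma ennreal_add_mult: "a \<ge> 0 \<Longrightarrow> b \<ge> 0 \<Longrightarrow> ennreal a * X + ennreal b * X = ennreal (a + b) * X"
  by (simp add: ennreal_plus distrib_right)

lemma sum_const_ennreal: "a \<ge> 0 \<Longrightarrow> (\<Sum>e\<in>E. ennreal a * X) = ennreal (real (card E) * a) * X"
  by (simp add: ennreal_mult ennreal_of_nat_eq_real_of_nat mult.assoc)

lemma energy_Un_le:
  fixes f :: "'a::euclidean_space \<Rightarrow> 'b::euclidean_space"
  assumes "f \<in> borel_measurable lebesgue" "S \<in> sets lebesgue" "T \<in> sets lebesgue"
  shows "energy (S \<union> T) f \<le> energy S f + energy T f"
proof -
  have "energy (S \<union> T) f \<le> (\<integral>\<^sup>+x. ennreal ((norm (f x))\<^sup>2) * indicator S x + ennreal ((norm (f x))\<^sup>2) * indicator T x \<partial>lebesgue)"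
    unfolding energy_def by (intro nn_integral_mono) (auto simp: indicator_def)
  also have "\<dots> = energy S f + energy T f"
    unfolding energy_def by (intro nn_integral_add energy_integrand_measurable assms)
  finally show ?thesis .
qed

lemma energy_UNIV_le: "(\<And>x. x \<notin> S \<Longrightarrow> f x = 0) \<Longrightarrow> energy T f \<le> energy (S \<inter> T) f"
  unfolding energy_def by (intro nn_integral_mono) (auto simp: indicator_def)

section \<open>Stream functions along segments and rays\<close>

lemma segment_difference_le:
  fixes \<psi> :: "'a::euclidean_space \<Rightarrow> real"
  assumes \<psi>: "smooth \<psi>" "\<And>h x. \<bar>pd \<psi> h x\<bar> \<le> norm (u x :: 'b::real_normed_vector) * norm h"
    and M: "\<And>q. q \<in> closed_segment a b \<Longrightarrow> norm (u q) \<le> M"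
  shows "\<bar>\<psi> b - \<psi> a\<bar> \<le> M * dist a b"
proof -
  let ?d = "b - a"
  have seg: "a + t *\<^sub>R ?d \<in> closed_segment a b" if "t \<in> {0..1}" for t
    using that unfolding in_segment by (intro exI[of _ t]) (auto simp: algebra_simps)
  have "\<bar>\<psi> (a + 1 *\<^sub>R ?d) - \<psi> a\<bar> = norm (integral {0..1} (\<lambda>t. pd \<psi> ?d (a + t *\<^sub>R ?d)))"
    using smooth_line_integral[OF \<psi>(1), of 1 a ?d] by (simp add: avg_def)
  also have "\<dots> \<le> (M * dist a b) * (1 - 0)"
  proof (rule integral_bound)
    show "continuous_on {0..1} (\<lambda>t. pd \<psi> ?d (a + t *\<^sub>R ?d))"
      by (intro continuous_on_compose2[OF smooth_continuous_on[OF smooth_pd[OF \<psi>(1)], of UNIV]] continuous_intros) auto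
    fix t :: real assume t: "t \<in> {0..1}"
    have "\<bar>pd \<psi> ?d (a + t *\<^sub>R ?d)\<bar> \<le> norm (u (a + t *\<^sub>R ?d)) * norm ?d" by (rule \<psi>(2))
    also have "\<dots> \<le> M * norm ?d" by (intro mult_right_mono M seg t) simp
    finally show "norm (pd \<psi> ?d (a + t *\<^sub>R ?d)) \<le> M * dist a b" by (simp add: dist_norm norm_minus_commute)
  qed simp
  finally show ?thesis by simp
qed

definition ray_integral :: "(real^2 \<Rightarrow> real^2) \<Rightarrow> real \<Rightarrow> real^2 \<Rightarrow> real^2 \<Rightarrow> real"
  where "ray_integral u a d = avg 0 a (\<lambda>_. 1) (\<lambda>t. t *\<^sub>R d) (\<lambda>x. norm (pd u d x))"

text \<open>As \<open>u\<close> vanishes at the far end, the fundamental theorem bounds it at every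
  point of the ray by one and the same integral; a second integration along the ray gives the factor
  \<open>a\<close> for \<open>\<psi>\<close>.\<close>

lemma ray_bounds:
  assumes u: "smooth u" and \<psi>: "smooth \<psi>" "\<And>h x. \<bar>pd \<psi> h x\<bar> \<le> norm (u x) * norm h"
    and a: "a \<ge> 0" "norm d = 1" and z: "u (z + a *\<^sub>R d) = 0"
  shows "norm (u z) \<le> ray_integral u a d z" "\<bar>\<psi> z - \<psi> (z + a *\<^sub>R d)\<bar> \<le> a * ray_integral u a d z"
proof -
  let ?g = "\<lambda>t. pd u d (z + t *\<^sub>R d)"
  have cont: "continuous_on S ?g" for S
    by (intro continuous_on_compose2[OF smooth_continuous_on[OF smooth_pd[OF u], of UNIV]] continuous_intros) auto
  have ray: "norm (u (z + t *\<^sub>R d)) \<le> ray_integral u a d z" if t: "0 \<le> t" "t \<le> a" for t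
  proof -
    have "(?g has_integral (u (z + a *\<^sub>R d) - u (z + t *\<^sub>R d))) {t..a}"
      by (rule fundamental_theorem_of_calculus[OF t(2)]) (rule smooth_line_has_vector_derivative[OF u])
    then have "integral {t..a} ?g = - u (z + t *\<^sub>R d)" using z by (simp add: integral_unique)
    then have "norm (u (z + t *\<^sub>R d)) = norm (integral {t..a} ?g)" by simp
    also have "\<dots> \<le> integral {t..a} (\<lambda>t. norm (?g t))"
      by (rule integral_norm_bound_integral) (auto intro!: integrable_continuous_real continuous_intros cont)
    also have "\<dots> \<le> integral {0..a} (\<lambda>t. norm (?g t))"
      by (rule integral_subset_le) (use t in \<open>auto intro!: integrable_continuous_real continuous_intros cont\<close>)
    also have "\<dots> = ray_integral u a d z" by (simp add: ray_integral_def avg_def)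
    finally show ?thesis .
  qed
  from ray[of 0] a(1) show "norm (u z) \<le> ray_integral u a d z" by simp
  have "\<bar>\<psi> (z + a *\<^sub>R d) - \<psi> z\<bar> \<le> ray_integral u a d z * dist z (z + a *\<^sub>R d)"
  proof (rule segment_difference_le[OF \<psi>])
    fix q assume "q \<in> closed_segment z (z + a *\<^sub>R d)"
    then obtain t where t: "0 \<le> t" "t \<le> 1" "q = (1 - t) *\<^sub>R z + t *\<^sub>R (z + a *\<^sub>R d)" by (auto simp: in_segment)
    then have "q = z + (t * a) *\<^sub>R d" by (simp add: algebra_simps)
    moreover have "0 \<le> t * a" "t * a \<le> a" using t a mult_right_mono[of t 1 a] by auto
    ultimately show "norm (u q) \<le> ray_integral u a d z" using ray by blast
  qed
  also have "dist z (z + a *\<^sub>R d) = a" using a by (simp add: dist_norm)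
  finally show "\<bar>\<psi> z - \<psi> (z + a *\<^sub>R d)\<bar> \<le> a * ray_integral u a d z" by (simp add: abs_minus_commute mult.commute)
qed

text \<open>The factor \<open>a\<^sup>2\<close> is the Poincare constant for rays of length
  \<open>a\<close>; the 4 comes from the crude bound of a directional derivative by the full
  gradient.\<close>

lemma energy_ray_integral:
  fixes u :: "real^2 \<Rightarrow> real^2"
  assumes u: "smooth u" and a: "a \<ge> 0" "norm d = 1" and S: "S \<in> sets borel" "S' \<in> sets borel"
    and sub: "\<And>x t. x \<in> S \<Longrightarrow> 0 \<le> t \<Longrightarrow> t \<le> a \<Longrightarrow> x + t *\<^sub>R d \<in> S'"
  shows "energy S (ray_integral u a d) \<le> ennreal (4 * a\<^sup>2) * energy S' (grad u)"
proof -
  have c: "continuous_on UNIV (\<lambda>x. norm (pd u d x))"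
    by (intro continuous_intros smooth_continuous_on smooth_pd u)
  have "energy S (ray_integral u a d) \<le> ennreal ((measure lborel (cbox 0 a))\<^sup>2) * energy S' (\<lambda>x. norm (pd u d x))"
    unfolding ray_integral_def
    by (rule energy_avg_le[OF _ _ _ c S]) (use sub in \<open>auto intro!: continuous_intros\<close>)
  also have "\<dots> \<le> ennreal (a\<^sup>2) * (4 * energy S' (grad u))"
  proof (rule mult_mono)
    have "energy S' (\<lambda>x. norm (pd u d x)) = energy S' (pd u d)" by (rule energy_cong) simp
    also have "\<dots> \<le> 4 * energy S' (grad u)" by (rule energy_pd_le_grad[OF u S(2) a(2)])
    finally show "energy S' (\<lambda>x. norm (pd u d x)) \<le> 4 * energy S' (grad u)" .
  qed (use a(1) in auto)
  also have "\<dots> = ennreal (4 * a\<^sup>2) * energy S' (grad u)"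
    by (simp add: ennreal_mult mult_ac)
  finally show ?thesis .
qed

lemma ray_integral_measurable: "smooth u \<Longrightarrow> ray_integral u a d \<in> borel_measurable lebesgue"
proof (rule continuous_lebesgue)
  assume u: "smooth u"
  have "continuous_on (UNIV \<times> cbox 0 a) (\<lambda>(x, t). norm (pd u d (x + t *\<^sub>R d)))"
    unfolding split_beta
    by (intro continuous_intros continuous_on_compose2[OF smooth_continuous_on[OF smooth_pd[OF u], of UNIV]]) auto
  from integral_continuous_on_param[OF this]
  show "continuous_on UNIV (ray_integral u a d)" by (simp add: ray_integral_def avg_def[abs_def])
qed

text \<open>The data of one truncation: the geometry at a single scale \<open>\<delta>\<close>, an
  averaged field \<open>u\<close> with its stream function \<open>\<psi>\<close>, the outer cutoff
  \<open>\<zeta>1\<close> and the inner cutoff \<open>\<zeta>2\<close>. With all of them fixed, the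
  bounds proved below display the parameters on which they depend.\<close>

locale truncation =
  fixes \<Omega> :: "(real^2) set" and s r0 \<kappa> \<delta> \<rho> R B C :: real and E :: "(real^2) set"
    and u :: "real^2 \<Rightarrow> real^2" and \<psi> \<zeta>1 \<zeta>2 :: "real^2 \<Rightarrow> real"
  assumes \<Omega>: "compact (- \<Omega>)" "- \<Omega> \<noteq> {}"
    and geo: "s > 0" "r0 > 0" "\<kappa> \<ge> 2" "finite E" "\<And>e. e \<in> E \<Longrightarrow> norm e = 1"
      "\<And>z. infdist z (- \<Omega>) \<le> 4 * \<delta> \<Longrightarrow> \<exists>e\<in>E. ball (z - (s * \<delta>) *\<^sub>R e) (\<kappa> * \<delta>) \<subseteq> - \<Omega>"
      "\<And>x y. ball x (\<kappa> * \<delta>) \<subseteq> - \<Omega> \<Longrightarrow> ball y (\<kappa> * \<delta>) \<subseteq> - \<Omega> \<Longrightarrow> dist x y < r0 \<Longrightarrow>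
       \<exists>a b. \<forall>q\<in>closed_segment x a \<union> closed_segment a b \<union> closed_segment b y. ball q (2 * \<delta>) \<subseteq> - \<Omega>"
    and \<delta>: "\<delta> > 0" "4 * s * \<delta> < r0" "s * \<delta> \<le> R"
    and \<rho>: "\<And>x. infdist x (- \<Omega>) \<le> 4 * \<delta> \<Longrightarrow> norm x < \<rho>" "\<rho> > 0" "\<rho> \<le> R" and R: "R \<ge> 1"
    and u: "smooth u" "\<And>x. ball x (2 * \<delta>) \<subseteq> - \<Omega> \<Longrightarrow> u x = 0"
      "\<And>x. norm x \<le> 2 * R \<Longrightarrow> norm (u x) \<le> B / (norm x + 1)" and B: "B \<ge> 0"
    and \<psi>: "smooth \<psi>" "\<And>x. curl \<psi> x = u x" "\<And>h x. \<bar>pd \<psi> h x\<bar> \<le> norm (u x) * norm h"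
      "\<And>h k x. \<bar>pd (pd \<psi> h) k x\<bar> \<le> norm (pd u k x) * norm h"
    and C: "C \<ge> 1"
    and \<zeta>1: "controlled C (R / 4) \<zeta>1" "\<And>x. norm x < 5 / 4 * R \<Longrightarrow> \<zeta>1 x = 0" "\<And>x. norm x \<ge> 2 * R \<Longrightarrow> \<zeta>1 x = 1"
    and \<zeta>2: "controlled C \<delta> \<zeta>2" "\<And>x. infdist x (- \<Omega>) < \<delta> \<Longrightarrow> \<zeta>2 x = 1"
      "\<And>x. infdist x (- \<Omega>) \<ge> 4 * \<delta> \<Longrightarrow> \<zeta>2 x = 0"
begin

text \<open>\<open>N\<close> contains every point where \<open>\<zeta>2\<close> is nonzero, and
  \<open>N'\<close> every ray of length \<open>s * \<delta>\<close> that starts in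
  \<open>N\<close>.\<close>

definition "N = {x. infdist x (- \<Omega>) \<le> 4 * \<delta>}"
definition "N' = {x. infdist x (- \<Omega>) \<le> (4 + s) * \<delta>}"

text \<open>The direction is picked point by point without any measurability, which is why energies
  are estimated below by a sum over all of \<open>E\<close>.\<close>

definition "dir z = (SOME e. e \<in> E \<and> ball (z - (s * \<delta>) *\<^sub>R e) (\<kappa> * \<delta>) \<subseteq> - \<Omega>)"
definition "foot z = z - (s * \<delta>) *\<^sub>R dir z"
text \<open>At depth \<open>2 * \<delta>\<close> inside the complement \<open>u\<close> vanishes, so
  \<open>\<psi>\<close> is locally constant there; \<open>\<psi>0\<close> carries this value out to
  the points of \<open>N\<close>. It may differ from one component of the complement to
  another.\<close>

definition "\<psi>0 z = \<psi> (foot z)"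
definition "c = \<psi> (R *\<^sub>R e1)"
definition "p x = \<zeta>2 x * (\<psi> x - \<psi>0 x)"
definition "q x = \<zeta>1 x * (\<psi> x - c)"
text \<open>This is \<open>(1 - \<zeta>1 x) * (\<psi> x - c) - \<zeta>2 x * (\<psi> x - \<psi>0
  x)\<close>: it is 0 far out and locally the constant \<open>\<psi>0 x - c\<close> close to the
  complement.\<close>

definition "w x = \<psi> x - c - q x - p x"

lemma dir: "z \<in> N \<Longrightarrow> dir z \<in> E" "z \<in> N \<Longrightarrow> ball (foot z) (\<kappa> * \<delta>) \<subseteq> - \<Omega>"
proof -
  assume "z \<in> N"
  then have "\<exists>e. e \<in> E \<and> ball (z - (s * \<delta>) *\<^sub>R e) (\<kappa> * \<delta>) \<subseteq> - \<Omega>"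
    using geo(6)[of z] by (auto simp: N_def)
  from someI_ex[OF this] show "dir z \<in> E" "ball (foot z) (\<kappa> * \<delta>) \<subseteq> - \<Omega>"
    by (auto simp: dir_def foot_def)
qed

lemma closed_N: "closed N" "closed N'" "open {x. infdist x (- \<Omega>) > 4 * \<delta>}" "open {x. infdist x (- \<Omega>) < \<delta>}"
  unfolding N_def N'_def
  by (intro closed_Collect_le open_Collect_less continuous_intros)+

lemma borel_N: "N \<in> sets borel" "N' \<in> sets borel"
  using closed_N by auto

lemma dist_foot: "z \<in> N \<Longrightarrow> dist z (foot z) = s * \<delta>"
  using geo(1,5) \<delta>(1) dir(1) by (simp add: foot_def dist_norm)

lemma u_foot: "z \<in> N \<Longrightarrow> u (foot z) = 0"
proof (rule u(2))
  assume "z \<in> N"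
  moreover have "ball (foot z) (2 * \<delta>) \<subseteq> ball (foot z) (\<kappa> * \<delta>)"
    using geo(3) \<delta>(1) by (intro subset_ball) simp
  ultimately show "ball (foot z) (2 * \<delta>) \<subseteq> - \<Omega>" using dir(2) by blast
qed

lemma \<psi>_const_segment:
  assumes "\<And>q. q \<in> closed_segment a b \<Longrightarrow> ball q (2 * \<delta>) \<subseteq> - \<Omega>"
  shows "\<psi> a = \<psi> b"
  using segment_difference_le[OF \<psi>(1,3), of a b 0] u(2) assms by auto

text \<open>Each foot is \<open>s * \<delta>\<close> away from its point and
  \<open>4 * s * \<delta> < r0\<close>, so the feet are closer than \<open>r0\<close> and are joined
  by a path at depth \<open>2 * \<delta>\<close>, along which \<open>u\<close> vanishes.\<close>

lemma \<psi>0_locally_constant: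
  assumes "x \<in> N" "y \<in> N" "dist x y < r0 / 2"
  shows "\<psi>0 x = \<psi>0 y"
proof -
  have "dist (foot x) (foot y) < r0"
    using dist_triangle[of "foot x" "foot y" x] dist_triangle[of x "foot y" y]
      dist_foot[OF assms(1)] dist_foot[OF assms(2)] assms(3) \<delta>(2) by (simp add: dist_commute)
  from geo(7)[OF dir(2)[OF assms(1)] dir(2)[OF assms(2)] this]
  obtain a b where ab: "\<forall>q\<in>closed_segment (foot x) a \<union> closed_segment a b \<union> closed_segment b (foot y). ball q (2 * \<delta>) \<subseteq> - \<Omega>"
    by blast
  have "\<psi> (foot x) = \<psi> a" "\<psi> a = \<psi> b" "\<psi> b = \<psi> (foot y)"
    by (rule \<psi>_const_segment, use ab in blast)+
  then show ?thesis by (simp add: \<psi>0_def)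
qed

text \<open>Off \<open>N\<close> the value of \<open>\<psi>0\<close> is arbitrary, so
  \<open>p\<close> is not visibly smooth as a product. Around a point of \<open>N\<close> one
  constant serves the whole ball of radius \<open>r0 / 2\<close>, because \<open>\<zeta>2\<close>
  kills the points of the ball outside \<open>N\<close>; around any other point \<open>p\<close>
  vanishes.\<close>

lemma p_locally:
  obtains U k where "open U" "x \<in> U" "\<And>y. y \<in> U \<Longrightarrow> p y = \<zeta>2 y * (\<psi> y - k)" "x \<in> N \<Longrightarrow> k = \<psi>0 x"
    "x \<notin> N \<Longrightarrow> \<forall>y\<in>U. p y = 0"
proof (cases "x \<in> N")
  case True
  show thesis
  proof (rule that[of "ball x (r0 / 2)" "\<psi>0 x"])
    fix y assume y: "y \<in> ball x (r0 / 2)"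
    show "p y = \<zeta>2 y * (\<psi> y - \<psi>0 x)"
    proof (cases "y \<in> N")
      case True
      with \<psi>0_locally_constant[OF \<open>x \<in> N\<close> this] y show ?thesis by (simp add: p_def)
    next
      case False
      then have "\<zeta>2 y = 0" using \<zeta>2(3)[of y] by (simp add: N_def)
      then show ?thesis by (simp add: p_def)
    qed
  qed (use geo(2) True in auto)
next
  case False
  have 0: "p y = 0" if "infdist y (- \<Omega>) > 4 * \<delta>" for y
    using \<zeta>2(3)[of y] that by (simp add: p_def)
  show thesis
  proof (rule that[of "{x. infdist x (- \<Omega>) > 4 * \<delta>}" 0])
    show "p y = \<zeta>2 y * (\<psi> y - 0)" if "y \<in> {x. infdist x (- \<Omega>) > 4 * \<delta>}" for y
      using \<zeta>2(3)[of y] that by (simp add: p_def)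
  qed (use closed_N False 0 in \<open>auto simp: N_def\<close>)
qed

section \<open>Smoothness, curl and support of the truncated stream function\<close>

lemma C0: "C \<ge> 0" using C by simp
lemma R4: "R / 4 > 0" using R by simp

lemmas bounds2 = curl_cutoff_bounds[OF \<zeta>2(1) C0 \<delta>(1) \<psi>(1,3,4)]
lemmas bounds1 = curl_cutoff_bounds[OF \<zeta>1(1) C0 R4 \<psi>(1,3,4), where c = c, folded q_def[abs_def]]

lemma smooth_p: "smooth p"
proof (rule smooth_locally)
  fix x
  obtain U k where "open U" "x \<in> U" "\<And>y. y \<in> U \<Longrightarrow> p y = \<zeta>2 y * (\<psi> y - k)"
    using p_locally[of x] by metis
  then show "\<exists>U g. open U \<and> x \<in> U \<and> smooth g \<and> (\<forall>y\<in>U. p y = g y)"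
    using bounds2(1)[of k] by blast
qed

lemma smooth_w: "smooth w" and smooth_w0: "smooth (\<lambda>x. \<psi> x - c - q x)" "smooth (\<lambda>x. \<psi> x - c)"
  unfolding w_def[abs_def] by (intro smooth_diff \<psi>(1) smooth_const bounds1(1) smooth_p)+

lemma curl_w: "curl w x = u x - curl q x - curl p x"
proof -
  have "curl (\<lambda>x. \<psi> x - c) x = u x"
    using \<psi>(2)[of x] by (simp add: curl_def pd_diff[OF \<psi>(1) smooth_const])
  then show ?thesis
    unfolding w_def[abs_def] by (simp add: curl_diff[OF smooth_w0(1) smooth_p] curl_diff[OF smooth_w0(2) bounds1(1)])
qed

lemma pd_curl_w: "pd (curl w) k x - pd u k x = - pd (curl q) k x - pd (curl p) k x"
proof -
  have "curl w = (\<lambda>x. u x - curl q x - curl p x)" by (rule ext) (rule curl_w)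
  then show ?thesis
    by (simp add: pd_diff[OF smooth_diff[OF u(1) smooth_curl[OF bounds1(1)]] smooth_curl[OF smooth_p]]
        pd_diff[OF u(1) smooth_curl[OF bounds1(1)]])
qed

lemma curl_p_bounds:
  "x \<in> N \<Longrightarrow> norm (curl p x) \<le> 2 * C * (\<bar>\<psi> x - \<psi>0 x\<bar> / \<delta> + norm (u x))"
  "x \<in> N \<Longrightarrow> norm k = 1 \<Longrightarrow> norm (pd (curl p) k x) \<le>
     2 * C * (\<bar>\<psi> x - \<psi>0 x\<bar> / \<delta>\<^sup>2 + 2 * norm (u x) / \<delta> + norm (pd u k x))"
  "x \<notin> N \<Longrightarrow> curl p x = 0" "x \<notin> N \<Longrightarrow> pd (curl p) k x = 0"
proof -
  obtain U l where U: "open U" "x \<in> U" "\<And>y. y \<in> U \<Longrightarrow> p y = \<zeta>2 y * (\<psi> y - l)" "x \<in> N \<Longrightarrow> l = \<psi>0 x"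
    "x \<notin> N \<Longrightarrow> \<forall>y\<in>U. p y = 0"
    using p_locally[of x] by metis
  have 1: "curl p y = curl (\<lambda>y. \<zeta>2 y * (\<psi> y - l)) y" if "y \<in> U" for y
    by (rule curl_cong_open[OF U(1) that U(3) bounds2(1)])
  have 2: "pd (curl p) k x = pd (curl (\<lambda>y. \<zeta>2 y * (\<psi> y - l))) k x"
    by (rule pd_cong_open[OF U(1,2) 1 smooth_curl[OF bounds2(1)]])
  show "norm (curl p x) \<le> 2 * C * (\<bar>\<psi> x - \<psi>0 x\<bar> / \<delta> + norm (u x))" if "x \<in> N"
    using bounds2(2)[of l x] U(4)[OF that] 1[OF U(2)] by simp
  show "norm (pd (curl p) k x) \<le> 2 * C * (\<bar>\<psi> x - \<psi>0 x\<bar> / \<delta>\<^sup>2 + 2 * norm (u x) / \<delta> + norm (pd u k x))"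
    if "x \<in> N" "norm k = 1"
    using bounds2(3)[OF that(2), of l x] U(4)[OF that(1)] 2 by simp
  assume x: "x \<notin> N"
  have 0: "curl p y = 0" if "y \<in> U" for y
    by (rule curl_eq_0_open[OF U(1) that]) (use U(5) x in blast)
  then show "curl p x = 0" using U(2) by blast
  show "pd (curl p) k x = 0" by (rule pd_eq_0_open[OF U(1,2)]) (rule 0)
qed

lemma curl_q_inner:
  assumes "norm x \<le> R"
  shows "curl q x = 0" "pd (curl q) k x = 0"
proof -
  \<comment> \<open>The margin between \<open>R\<close> and \<open>5 / 4 * R\<close> provides an
    open set on which \<open>q\<close> vanishes, so derivatives vanish up to and including the
    circle of radius \<open>R\<close>.\<close>
  have U: "open {x::real^2. norm x < 5 / 4 * R}" by (intro open_Collect_less continuous_intros)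
  have x: "x \<in> {x. norm x < 5 / 4 * R}" using assms R by simp
  have 0: "curl q y = 0" if "y \<in> {x. norm x < 5 / 4 * R}" for y
    by (rule curl_eq_0_open[OF U that]) (simp add: q_def \<zeta>1(2))
  then show "curl q x = 0" using x by blast
  show "pd (curl q) k x = 0" by (rule pd_eq_0_open[OF U x]) (rule 0)
qed

lemma w_outer:
  assumes "norm x > 2 * R"
  shows "curl w x = 0" "pd (curl w) k x = 0"
proof -
  have U: "open {x::real^2. norm x > 2 * R}" by (intro open_Collect_less continuous_intros)
  have x: "x \<in> {x. norm x > 2 * R}" using assms by simp
  have w0: "w y = 0" if "y \<in> {x. norm x > 2 * R}" for y
  proof -
    have "infdist y (- \<Omega>) \<ge> 4 * \<delta>"
      using \<rho>(1)[of y] \<rho>(3) that R by (cases "infdist y (- \<Omega>) \<le> 4 * \<delta>") auto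
    then show ?thesis using \<zeta>2(3)[of y] \<zeta>1(3)[of y] that by (simp add: w_def p_def q_def)
  qed
  have 0: "curl w y = 0" if "y \<in> {x. norm x > 2 * R}" for y
    by (rule curl_eq_0_open[OF U that]) (rule w0)
  then show "curl w x = 0" using x by blast
  show "pd (curl w) k x = 0" by (rule pd_eq_0_open[OF U x]) (rule 0)
qed

text \<open>Here \<open>\<zeta>1 = 0\<close> and \<open>\<zeta>2 = 1\<close>, so \<open>w\<close> is
  locally a constant. This constant may be nonzero and may vary between components; only the curl
  has to vanish.\<close>

lemma w_near:
  assumes "infdist x (- \<Omega>) < \<delta>"
  shows "curl w x = 0"
proof -
  obtain U l where U: "open U" "x \<in> U" "\<And>y. y \<in> U \<Longrightarrow> p y = \<zeta>2 y * (\<psi> y - l)"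
    using p_locally[of x] by metis
  let ?V = "U \<inter> {x. infdist x (- \<Omega>) < \<delta>}"
  show ?thesis
  proof (rule curl_eq_0_open[of ?V])
    show "open ?V" using U(1) closed_N(4) by (rule open_Int)
    show "x \<in> ?V" using U(2) assms by simp
    fix y assume y: "y \<in> ?V"
    then have "norm y < R" using \<rho>(1)[of y] \<rho>(3) \<delta>(1) by simp
    then have "\<zeta>1 y = 0" using R by (intro \<zeta>1(2)) simp
    moreover have "\<zeta>2 y = 1" using y by (intro \<zeta>2(2)) simp
    ultimately show "w y = l - c" using U(3)[of y] y by (simp add: w_def q_def)
  qed
qed

lemma curl_w_test: "curl w \<in> solenoidal_test_fields \<Omega>"
proof (rule solenoidal_test_fieldI[OF smooth_curl[OF smooth_w]])
  let ?S = "cball 0 (2 * R) \<inter> {x. infdist x (- \<Omega>) \<ge> \<delta>}"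
  have "closed {x. infdist x (- \<Omega>) \<ge> \<delta>}" by (intro closed_Collect_le continuous_intros)
  then show "compact ?S" by (intro compact_Int_closed) auto
  show "?S \<subseteq> \<Omega>"
  proof
    fix x assume x: "x \<in> ?S"
    show "x \<in> \<Omega>"
    proof (rule ccontr)
      assume "x \<notin> \<Omega>"
      then have "infdist x (- \<Omega>) = 0" by (intro infdist_zero) simp
      then show False using x \<delta>(1) by simp
    qed
  qed
  show "curl w x = 0" if "x \<notin> ?S" for x
    using that w_near[of x] w_outer(1)[of x] by (auto simp: not_le)
  show "divergence (curl w) x = 0" for x by (rule divergence_curl[OF smooth_w])
qed

section \<open>The weighted bound\<close>

lemma N_bound: "x \<in> N \<Longrightarrow> norm x < \<rho>"
  using \<rho>(1) by (simp add: N_def)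

lemma u_weighted: "norm x \<le> 2 * R \<Longrightarrow> (norm x + 1) * norm (u x) \<le> B"
  using u(3)[of x] pos_le_divide_eq[of "norm x + 1" "norm (u x)" B]
  by (simp add: mult.commute add_nonneg_pos)

lemma u_le_B: "norm x \<le> 2 * R \<Longrightarrow> norm (u x) \<le> B"
  using u_weighted[of x] mult_right_mono[of 1 "norm x + 1" "norm (u x)"] by simp

abbreviation "f e \<equiv> ray_integral u (s * \<delta>) (- e)"

lemma s\<delta>: "s * \<delta> > 0" using geo(1) \<delta>(1) by simp

lemma rays:
  assumes "x \<in> N"
  shows "norm (u x) \<le> f (dir x) x" "\<bar>\<psi> x - \<psi>0 x\<bar> / \<delta> \<le> s * f (dir x) x"
proof -
  have n: "norm (- dir x) = 1" using geo(5) dir(1)[OF assms] by simp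
  have ft: "foot x = x + (s * \<delta>) *\<^sub>R (- dir x)" by (simp add: foot_def)
  note r = ray_bounds[OF u(1) \<psi>(1,3) less_imp_le[OF s\<delta>] n u_foot[OF assms, unfolded ft]]
  show "norm (u x) \<le> f (dir x) x" by (rule r(1))
  have "\<bar>\<psi> x - \<psi>0 x\<bar> \<le> s * \<delta> * f (dir x) x" using r(2) unfolding \<psi>0_def ft .
  then show "\<bar>\<psi> x - \<psi>0 x\<bar> / \<delta> \<le> s * f (dir x) x"
    using \<delta>(1) by (simp add: pos_divide_le_eq mult_ac)
qed

text \<open>The segment from the foot to \<open>x\<close> has length
  \<open>s * \<delta> \<le> R\<close>, and \<open>norm x < \<rho> \<le> R\<close>, so it stays
  within radius \<open>2 * R\<close>, where \<open>u\<close> is at most \<open>B\<close>.\<close>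

lemma \<psi>0_diff_le:
  assumes "x \<in> N"
  shows "\<bar>\<psi> x - \<psi>0 x\<bar> / \<delta> \<le> s * B"
proof -
  have "\<bar>\<psi> x - \<psi> (foot x)\<bar> \<le> B * dist (foot x) x"
  proof (rule segment_difference_le[OF \<psi>(1,3)])
    fix q assume q: "q \<in> closed_segment (foot x) x"
    have "dist q x \<le> s * \<delta>"
      using dist_in_closed_segment[OF q] dist_foot[OF assms] by (simp add: dist_commute)
    moreover have "norm q \<le> norm x + dist q x" unfolding dist_norm using norm_triangle_sub by blast
    ultimately have "norm q \<le> 2 * R" using N_bound[OF assms] \<rho>(3) \<delta>(3) by linarith
    then show "norm (u q) \<le> B" by (rule u_le_B)
  qed
  then show ?thesis
    using \<delta>(1) dist_foot[OF assms] by (simp add: \<psi>0_def dist_commute pos_divide_le_eq mult_ac)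
qed

text \<open>A nonnegative inner product keeps the segment away from the origin: its points have
  squared norm at least \<open>((1 - t)\<^sup>2 + t\<^sup>2) * R\<^sup>2\<close>, hence norm at
  least \<open>R / 2\<close>. There \<open>u\<close> is at most \<open>2 * B / R\<close>, and the
  segment is no longer than \<open>4 * R\<close>.\<close>

lemma half_plane:
  assumes ab: "a \<bullet> b \<ge> 0" "R \<le> norm a" "norm a \<le> 2 * R" "R \<le> norm b" "norm b \<le> 2 * R"
  shows "\<bar>\<psi> b - \<psi> a\<bar> \<le> 8 * B"
proof -
  have "\<bar>\<psi> b - \<psi> a\<bar> \<le> (2 * B / R) * dist a b"
  proof (rule segment_difference_le[OF \<psi>(1,3)])
    fix q assume q: "q \<in> closed_segment a b"
    then obtain t where t: "0 \<le> t" "t \<le> 1" "q = (1 - t) *\<^sub>R a + t *\<^sub>R b" by (auto simp: in_segment)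
    have "(R / 2)\<^sup>2 \<le> ((1 - t)\<^sup>2 + t\<^sup>2) * R\<^sup>2"
    proof -
      have "(1 - t)\<^sup>2 + t\<^sup>2 \<ge> 1 / 4"
        using zero_le_power2[of "2 * t - 1"] by (simp add: power2_eq_square algebra_simps)
      then show ?thesis using mult_right_mono[of "1/4" "(1 - t)\<^sup>2 + t\<^sup>2" "R\<^sup>2"] by (simp add: power_divide)
    qed
    also have "\<dots> = (1 - t)\<^sup>2 * R\<^sup>2 + t\<^sup>2 * R\<^sup>2" by (rule distrib_right)
    also have "\<dots> \<le> (1 - t)\<^sup>2 * (norm a)\<^sup>2 + t\<^sup>2 * (norm b)\<^sup>2"
      using ab R by (intro add_mono mult_left_mono power_mono) auto
    also have "\<dots> \<le> (norm q)\<^sup>2"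
    proof -
      have "0 \<le> 2 * (t * ((1 - t) * (a \<bullet> b)))" using t ab by simp
      then show ?thesis
        unfolding t(3) power2_norm_eq_inner
        by (simp add: inner_add_left inner_add_right inner_commute[of b a] power2_eq_square algebra_simps)
    qed
    finally have Rq: "R / 2 \<le> norm q" by (rule power2_le_imp_le) simp
    have "norm q \<le> 2 * R"
      using q closed_segment_subset[OF _ _ convex_cball, of a 0 "2 * R" b] ab by auto
    then have "norm (u q) \<le> B / (norm q + 1)" by (rule u(3))
    also have "\<dots> \<le> B / (R / 2)" using Rq R B by (intro divide_left_mono) auto
    finally show "norm (u q) \<le> 2 * B / R" by (simp add: mult.commute)
  qed
  also have "\<dots> \<le> (2 * B / R) * (4 * R)"
    using ab B R norm_triangle_ineq4[of a b] by (intro mult_left_mono) (auto simp: dist_norm)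
  also have "\<dots> = 8 * B" using R by simp
  finally show ?thesis .
qed

text \<open>A straight segment from \<open>R *\<^sub>R e1\<close> to \<open>x\<close> could pass
  close to the origin; the detour over \<open>R *\<^sub>R e2\<close> or its negative, on the side of
  \<open>x\<close>, replaces it by two segments with nonnegative inner products.\<close>

lemma annulus:
  assumes "R \<le> norm x" "norm x \<le> 2 * R"
  shows "\<bar>\<psi> x - c\<bar> \<le> 16 * B"
proof -
  define z where "z = (if x $ 2 \<ge> 0 then R else - R) *\<^sub>R e2"
  have z: "norm z = R" "(R *\<^sub>R e1) \<bullet> z = 0" "z \<bullet> x \<ge> 0"
    using R by (auto simp: z_def inner_vec_def sum_2 axis_def mult_nonneg_nonpos norm_vec_def L2_set_def)
  have "\<bar>\<psi> z - c\<bar> \<le> 8 * B" unfolding c_def by (rule half_plane) (use z R in auto)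
  moreover have "\<bar>\<psi> x - \<psi> z\<bar> \<le> 8 * B" by (rule half_plane) (use z R assms in auto)
  ultimately show ?thesis by linarith
qed

text \<open>Near the complement the weight is at most \<open>\<rho> + 1\<close> and the cutoff error
  of order \<open>B\<close>; on the annulus an error of order \<open>B / R\<close> meets a weight of
  at most \<open>3 * R\<close>. The constant 386 is \<open>2 * (64 * 3 + 1)\<close>.\<close>

lemma weighted_bound:
  "(norm x + 1) * norm (curl w x) \<le> B * ((\<rho> + 1) * (1 + 2 * C * (s + 1)) + (1 + 386 * C))"
proof -
  let ?A = "(\<rho> + 1) * (1 + 2 * C * (s + 1))" and ?D = "1 + 386 * C"
  have A: "?A \<ge> 0" "?D \<ge> 0" using \<rho>(2) geo(1) C by auto
  consider "x \<in> N" | "x \<notin> N" "norm x \<le> R" | "x \<notin> N" "norm x > R" "norm x \<le> 2 * R" | "norm x > 2 * R"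
    by linarith
  then show ?thesis
  proof cases
    case 1
    note x = N_bound[OF 1]
    have "norm (curl w x) \<le> norm (u x) + norm (curl p x)"
      unfolding curl_w using curl_q_inner(1)[of x] x \<rho>(3) norm_triangle_ineq4[of "u x" "curl p x"] by simp
    also have "\<dots> \<le> B + 2 * C * (s * B + B)"
    proof (rule add_mono)
      have uB: "norm (u x) \<le> B" using x \<rho>(3) R by (intro u_le_B) simp
      then show "norm (u x) \<le> B" .
      have "2 * C * (\<bar>\<psi> x - \<psi>0 x\<bar> / \<delta> + norm (u x)) \<le> 2 * C * (s * B + B)"
        using C by (intro mult_left_mono add_mono \<psi>0_diff_le[OF 1] uB) simp
      with curl_p_bounds(1)[OF 1] show "norm (curl p x) \<le> 2 * C * (s * B + B)" by linarith
    qed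
    also have "\<dots> = B * (1 + 2 * C * (s + 1))" by (simp add: algebra_simps)
    finally have le: "norm (curl w x) \<le> B * (1 + 2 * C * (s + 1))" .
    have "(norm x + 1) * norm (curl w x) \<le> (\<rho> + 1) * (B * (1 + 2 * C * (s + 1)))"
      using x by (intro mult_mono le) (use \<rho>(2) in auto)
    also have "\<dots> = B * ?A" by (simp add: mult_ac)
    also have "\<dots> \<le> B * (?A + ?D)" using A B by (intro mult_left_mono) auto
    finally show ?thesis .
  next
    case 2
    then have "curl w x = u x" by (simp add: curl_w curl_q_inner(1) curl_p_bounds(3))
    moreover have "(norm x + 1) * norm (u x) \<le> B"
      using 2 R by (intro u_weighted) simp
    moreover have "B * 1 \<le> B * (?A + ?D)" using A B C by (intro mult_left_mono) auto
    ultimately show ?thesis by simp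
  next
    case 3
    have uB: "(norm x + 1) * norm (u x) \<le> B"
      using 3 by (intro u_weighted) simp
    have "norm (curl w x) \<le> norm (u x) + norm (curl q x)"
      unfolding curl_w using norm_triangle_ineq4[of "u x" "curl q x"] curl_p_bounds(3)[OF 3(1)] by simp
    also have "\<dots> \<le> norm (u x) + 2 * C * (16 * B / (R / 4) + norm (u x))"
    proof (intro add_left_mono order_trans[OF bounds1(2)[of x]] mult_left_mono add_right_mono divide_right_mono)
      show "\<bar>\<psi> x - c\<bar> \<le> 16 * B" by (rule annulus) (use 3 in auto)
    qed (use C R in auto)
    finally have "(norm x + 1) * norm (curl w x) \<le> (norm x + 1) * (norm (u x) + 2 * C * (16 * B / (R / 4) + norm (u x)))"
      by (rule mult_left_mono) simp
    also have "\<dots> = (norm x + 1) * norm (u x) + 2 * C * (64 * B * ((norm x + 1) / R) + (norm x + 1) * norm (u x))"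
      by (simp add: algebra_simps)
    also have "\<dots> \<le> B + 2 * C * (64 * B * 3 + B)"
    proof (intro add_mono mult_left_mono uB)
      show "(norm x + 1) / R \<le> 3" using 3 R by (simp add: pos_divide_le_eq)
    qed (use C B in auto)
    also have "\<dots> = B * ?D" by (simp add: algebra_simps)
    also have "\<dots> \<le> B * (?A + ?D)" using A B by (intro mult_left_mono) auto
    finally show ?thesis .
  next
    case 4
    then show ?thesis using w_outer(1)[of x] A B by simp
  qed
qed

section \<open>Energy of the change of the field and of its gradient\<close>

lemma energy_f:
  assumes e: "e \<in> E"
  shows "energy N (f e) \<le> ennreal (4 * (s * \<delta>)\<^sup>2) * energy N' (grad u)"
proof (rule energy_ray_integral[OF u(1) less_imp_le[OF s\<delta>] _ borel_N])
  show "norm (- e) = 1" using geo(5)[OF e] by simp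
  fix x t assume x: "x \<in> N" and t: "0 \<le> t" "t \<le> s * \<delta>"
  have "infdist (x + t *\<^sub>R (- e)) (- \<Omega>) \<le> infdist x (- \<Omega>) + dist (x + t *\<^sub>R (- e)) x"
    by (rule infdist_triangle)
  also have "dist (x + t *\<^sub>R (- e)) x = t" using t geo(5)[OF e] by (simp add: dist_norm)
  finally show "x + t *\<^sub>R (- e) \<in> N'"
    using x t(2) by (simp add: N_def N'_def algebra_simps)
qed

text \<open>The sum over the finite set \<open>E\<close> dominates the term of the chosen direction
  and is measurable however \<open>dir\<close> was chosen.\<close>

lemma sum_dir_le:
  assumes "x \<in> N" "a \<ge> 0"
  shows "a * (f (dir x) x)\<^sup>2 \<le> (\<Sum>e\<in>E. a * (norm (f e x))\<^sup>2)"
  using member_le_sum[OF dir(1)[OF assms(1)], of "\<lambda>e. a * (norm (f e x))\<^sup>2"] geo(4) assms(2) by simp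

lemma N_sub_N': "N \<subseteq> N'"
  using geo(1) \<delta>(1) by (auto simp: N_def N'_def algebra_simps intro: order_trans)

text \<open>The square of the factor \<open>1 / \<delta>\<close> left by the cutoff cancels the
  Poincare factor \<open>(s * \<delta>)\<^sup>2\<close> of the rays, so the constant is free of
  \<open>\<delta>\<close> and smallness has to come from the energy of \<open>grad u\<close> on
  \<open>N'\<close>.\<close>

lemma energy_near:
  assumes k: "norm k = 1"
  shows "energy N (\<lambda>x. pd (curl w) k x - pd u k x) \<le>
    ennreal (32 * C\<^sup>2 * ((s + 2)\<^sup>2 * s\<^sup>2 * real (card E) + 1)) * energy N' (grad u)"
proof -
  \<comment> \<open>\<open>None\<close> stands for the term with \<open>pd u k\<close>, and
    \<open>Some e\<close> for the ray integral in direction \<open>e\<close>.\<close>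
  define G where "G i = (case i of None \<Rightarrow> (\<lambda>x. norm (pd u k x)) | Some e \<Rightarrow> f e)" for i
  define a where "a i = (case i of None \<Rightarrow> 8 * C\<^sup>2 | Some (e::real^2) \<Rightarrow> 8 * C\<^sup>2 * (s + 2)\<^sup>2 / \<delta>\<^sup>2)" for i
  let ?I = "insert None (Some ` E)"
  have "energy N (\<lambda>x. pd (curl w) k x - pd u k x) \<le> (\<Sum>i\<in>?I. ennreal (a i) * energy N (G i))"
  proof (rule energy_add_le_sq)
    have "(\<lambda>x. norm (pd u k x)) \<in> borel_measurable lebesgue"
      by (rule continuous_lebesgue[OF continuous_on_norm[OF smooth_continuous_on[OF smooth_pd[OF u(1)]]]])
    then show "G i \<in> borel_measurable lebesgue" if "i \<in> ?I" for i
      using ray_integral_measurable[OF u(1)] by (simp add: G_def split: option.split)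
    fix x assume x: "x \<in> N"
    let ?F = "f (dir x) x"
    have "norm x \<le> R" using N_bound[OF x] \<rho>(3) by simp
    then have "norm (pd (curl w) k x - pd u k x) = norm (pd (curl p) k x)"
      by (simp add: pd_curl_w curl_q_inner(2))
    also have "\<dots> \<le> 2 * C * (\<bar>\<psi> x - \<psi>0 x\<bar> / \<delta>\<^sup>2 + 2 * norm (u x) / \<delta> + norm (pd u k x))"
      by (rule curl_p_bounds(2)[OF x k])
    also have "\<dots> \<le> 2 * C * ((s + 2) * ?F / \<delta> + norm (pd u k x))"
    proof (intro mult_left_mono add_right_mono)
      have "\<bar>\<psi> x - \<psi>0 x\<bar> / \<delta>\<^sup>2 + 2 * norm (u x) / \<delta> = (\<bar>\<psi> x - \<psi>0 x\<bar> / \<delta> + 2 * norm (u x)) / \<delta>"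
        by (simp add: power2_eq_square add_divide_distrib)
      also have "\<dots> \<le> ((s + 2) * ?F) / \<delta>"
        using rays[OF x] \<delta>(1) by (intro divide_right_mono) (auto simp: algebra_simps)
      finally show "\<bar>\<psi> x - \<psi>0 x\<bar> / \<delta>\<^sup>2 + 2 * norm (u x) / \<delta> \<le> (s + 2) * ?F / \<delta>" .
    qed (use C in simp)
    finally have "(norm (pd (curl w) k x - pd u k x))\<^sup>2 \<le> (2 * C * ((s + 2) * ?F / \<delta> + norm (pd u k x)))\<^sup>2"
      by (rule power_mono) simp
    also have "\<dots> = 4 * C\<^sup>2 * ((s + 2) * ?F / \<delta> + norm (pd u k x))\<^sup>2" by (simp add: power_mult_distrib)
    also have "\<dots> \<le> 4 * C\<^sup>2 * (2 * ((s + 2) * ?F / \<delta>)\<^sup>2 + 2 * (norm (pd u k x))\<^sup>2)"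
    proof (rule mult_left_mono)
      show "((s + 2) * ?F / \<delta> + norm (pd u k x))\<^sup>2 \<le> 2 * ((s + 2) * ?F / \<delta>)\<^sup>2 + 2 * (norm (pd u k x))\<^sup>2"
        using zero_le_power2[of "(s + 2) * ?F / \<delta> - norm (pd u k x)"] unfolding power2_sum power2_diff by linarith
    qed simp
    also have "\<dots> = 8 * C\<^sup>2 * (s + 2)\<^sup>2 / \<delta>\<^sup>2 * ?F\<^sup>2 + 8 * C\<^sup>2 * (norm (pd u k x))\<^sup>2"
    proof -
      have "((s + 2) * ?F / \<delta>)\<^sup>2 = (s + 2)\<^sup>2 / \<delta>\<^sup>2 * ?F\<^sup>2"
        unfolding power_divide power_mult_distrib by simp
      then show ?thesis by (simp only:) (simp add: distrib_left)
    qed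
    also have "\<dots> \<le> (\<Sum>e\<in>E. 8 * C\<^sup>2 * (s + 2)\<^sup>2 / \<delta>\<^sup>2 * (norm (f e x))\<^sup>2) + 8 * C\<^sup>2 * (norm (pd u k x))\<^sup>2"
      by (intro add_right_mono sum_dir_le[OF x]) simp
    also have "\<dots> = (\<Sum>i\<in>?I. a i * (norm (G i x))\<^sup>2)"
      using geo(4) by (simp add: sum.insert[of "Some ` E"] sum.reindex G_def a_def)
    finally show "(norm (pd (curl w) k x - pd u k x))\<^sup>2 \<le> (\<Sum>i\<in>?I. a i * (norm (G i x))\<^sup>2)" .
  qed (use geo(4) borel_N in \<open>auto simp: a_def split: option.split\<close>)
  also have "\<dots> = ennreal (8 * C\<^sup>2) * energy N (\<lambda>x. norm (pd u k x)) +
      (\<Sum>e\<in>E. ennreal (8 * C\<^sup>2 * (s + 2)\<^sup>2 / \<delta>\<^sup>2) * energy N (f e))"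
    using geo(4) by (simp add: sum.insert[of "Some ` E"] sum.reindex G_def a_def)
  also have "\<dots> \<le> ennreal (8 * C\<^sup>2) * (ennreal 4 * energy N' (grad u)) +
      (\<Sum>e\<in>E. ennreal (8 * C\<^sup>2 * (s + 2)\<^sup>2 / \<delta>\<^sup>2) * (ennreal (4 * (s * \<delta>)\<^sup>2) * energy N' (grad u)))"
  proof (intro add_mono mult_left_mono sum_mono energy_f)
    have "energy N (\<lambda>x. norm (pd u k x)) = energy N (pd u k)" by (rule energy_cong) simp
    also have "\<dots> \<le> energy N' (pd u k)" by (rule energy_mono_set[OF N_sub_N'])
    also have "\<dots> \<le> 4 * energy N' (grad u)" by (rule energy_pd_le_grad[OF u(1) borel_N(2) k])
    finally show "energy N (\<lambda>x. norm (pd u k x)) \<le> ennreal 4 * energy N' (grad u)" by simp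
  qed auto
  also have "\<dots> = ennreal (32 * C\<^sup>2 * ((s + 2)\<^sup>2 * s\<^sup>2 * real (card E) + 1)) * energy N' (grad u)"
  proof -
    have 1: "ennreal (8 * C\<^sup>2) * (ennreal 4 * energy N' (grad u)) = ennreal (32 * C\<^sup>2) * energy N' (grad u)"
      by (subst ennreal_mult_assoc) simp_all
    have "8 * C\<^sup>2 * (s + 2)\<^sup>2 / \<delta>\<^sup>2 * (4 * (s * \<delta>)\<^sup>2) = 32 * C\<^sup>2 * ((s + 2)\<^sup>2 * s\<^sup>2)"
      using \<delta>(1) by (simp add: power_mult_distrib field_simps)
    then have 2: "ennreal (8 * C\<^sup>2 * (s + 2)\<^sup>2 / \<delta>\<^sup>2) * (ennreal (4 * (s * \<delta>)\<^sup>2) * energy N' (grad u)) =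
        ennreal (32 * C\<^sup>2 * ((s + 2)\<^sup>2 * s\<^sup>2)) * energy N' (grad u)"
      by (subst ennreal_mult_assoc) simp_all
    have 3: "(\<Sum>e\<in>E. ennreal (32 * C\<^sup>2 * ((s + 2)\<^sup>2 * s\<^sup>2)) * energy N' (grad u)) =
        ennreal (real (card E) * (32 * C\<^sup>2 * ((s + 2)\<^sup>2 * s\<^sup>2))) * energy N' (grad u)"
      by (rule sum_const_ennreal) simp
    show ?thesis
      unfolding 1 2 3
      by (subst ennreal_add_mult) (simp_all add: algebra_simps)
  qed
  finally show ?thesis .
qed

text \<open>One derivative fewer falls on the cutoff than in the gradient estimate, so the Poincare
  factor \<open>\<delta>\<^sup>2\<close> survives. Inside radius \<open>R\<close> the outer cutoff
  is not felt.\<close>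

lemma energy_diff_inner:
  "energy (ball 0 R) (\<lambda>x. curl w x - u x) \<le>
    ennreal (16 * C\<^sup>2 * (s + 1)\<^sup>2 * s\<^sup>2 * real (card E) * \<delta>\<^sup>2) * energy N' (grad u)"
proof -
  have eq: "curl w x - u x = - curl p x" if "x \<in> ball 0 R" for x
    using that by (simp add: curl_w curl_q_inner(1))
  have "energy (ball 0 R) (\<lambda>x. curl w x - u x) = energy (ball 0 R) (curl p)"
    by (rule energy_cong) (simp add: eq)
  also have "\<dots> \<le> energy (N \<inter> ball 0 R) (curl p)"
    by (rule energy_UNIV_le) (rule curl_p_bounds(3))
  also have "\<dots> \<le> energy N (curl p)" by (rule energy_mono_set) blast
  also have "\<dots> \<le> (\<Sum>e\<in>E. ennreal ((2 * C * (s + 1))\<^sup>2) * energy N (f e))"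
  proof (rule energy_add_le_sq)
    fix x assume x: "x \<in> N"
    have "2 * C * (\<bar>\<psi> x - \<psi>0 x\<bar> / \<delta> + norm (u x)) \<le> 2 * C * (s * f (dir x) x + f (dir x) x)"
      using C rays[OF x] by (intro mult_left_mono add_mono) auto
    then have "norm (curl p x) \<le> 2 * C * (s + 1) * f (dir x) x"
      using curl_p_bounds(1)[OF x] by (simp add: algebra_simps)
    then have "(norm (curl p x))\<^sup>2 \<le> (2 * C * (s + 1) * f (dir x) x)\<^sup>2" by (rule power_mono) simp
    also have "\<dots> = (2 * C * (s + 1))\<^sup>2 * (f (dir x) x)\<^sup>2" by (rule power_mult_distrib)
    also have "\<dots> \<le> (\<Sum>e\<in>E. (2 * C * (s + 1))\<^sup>2 * (norm (f e x))\<^sup>2)" by (rule sum_dir_le[OF x]) simp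
    finally show "(norm (curl p x))\<^sup>2 \<le> (\<Sum>e\<in>E. (2 * C * (s + 1))\<^sup>2 * (norm (f e x))\<^sup>2)" .
  qed (use geo(4) borel_N ray_integral_measurable[OF u(1)] in auto)
  also have "\<dots> \<le> (\<Sum>e\<in>E. ennreal ((2 * C * (s + 1))\<^sup>2) * (ennreal (4 * (s * \<delta>)\<^sup>2) * energy N' (grad u)))"
    by (intro sum_mono mult_left_mono energy_f) auto
  also have "\<dots> = ennreal (real (card E) * ((2 * C * (s + 1))\<^sup>2 * (4 * (s * \<delta>)\<^sup>2))) * energy N' (grad u)"
    by (simp only: ennreal_mult_assoc zero_le_power2 zero_le_mult_iff zero_le_numeral sum_const_ennreal simp_thms)
  also have "real (card E) * ((2 * C * (s + 1))\<^sup>2 * (4 * (s * \<delta>)\<^sup>2)) = 16 * C\<^sup>2 * (s + 1)\<^sup>2 * s\<^sup>2 * real (card E) * \<delta>\<^sup>2"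
    by algebra
  finally show ?thesis .
qed

lemma emeasure_cball_le: "emeasure lebesgue (cball (0::real^2) (2 * R)) \<le> ennreal (16 * R\<^sup>2)"
proof -
  have "cball 0 (2 * R) \<subseteq> cbox (- (2 * R) *\<^sub>R One) ((2 * R) *\<^sub>R One :: real^2)"
  proof
    fix x :: "real^2" assume "x \<in> cball 0 (2 * R)"
    then have "\<bar>x \<bullet> i\<bar> \<le> 2 * R" if "i \<in> Basis" for i using Basis_le_norm[OF that, of x] by simp
    then show "x \<in> cbox (- (2 * R) *\<^sub>R One) ((2 * R) *\<^sub>R One)"
      unfolding mem_box by (fastforce simp: abs_le_iff)
  qed
  then have "emeasure lebesgue (cball (0::real^2) (2 * R)) \<le> emeasure lebesgue (cbox (- (2 * R) *\<^sub>R One) ((2 * R) *\<^sub>R One :: real^2))"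
    by (rule emeasure_mono) simp
  also have "\<dots> = ennreal (measure lborel (cbox (- (2 * R) *\<^sub>R One) ((2 * R) *\<^sub>R One :: real^2)))"
    using emeasure_eq_measure2[OF lmeasurable_cbox] by (simp del: scaleR_minus_left)
  also have "\<dots> = ennreal (16 * R\<^sup>2)"
    using measure_cube[of "2 * R"] R by (simp add: power_mult_distrib del: scaleR_minus_left)
  finally show ?thesis .
qed

definition "outer = {x::real^2. R \<le> norm x}"

lemma borel_outer: "outer \<in> sets borel"
  unfolding outer_def by (intro borel_closed closed_Collect_le continuous_intros)

text \<open>Up to radius \<open>2 * R\<close> the terms without a derivative of \<open>u\<close> are
  at most \<open>264 * B / R\<^sup>2\<close>, where 264 = 16 * 16 + 2 * 4; on an area of at most
  \<open>16 * R\<^sup>2\<close> their energy is of order \<open>(B / R)\<^sup>2\<close>. Beyond that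
  radius the truncated field is 0 and the change is all of \<open>pd u k\<close>.\<close>

lemma energy_outer:
  assumes k: "norm k = 1"
  shows "energy outer (\<lambda>x. pd (curl w) k x - pd u k x) \<le>
    ennreal (32 * C\<^sup>2) * energy outer (grad u) + ennreal (128 * 264\<^sup>2 * C\<^sup>2 * (B / R)\<^sup>2)"
proof -
  define J where "J x = (264 * B / R\<^sup>2) * indicator (cball 0 (2 * R)) x" for x :: "real^2"
  have J0: "264 * B / R\<^sup>2 \<ge> 0" using B by simp
  have "energy outer (\<lambda>x. pd (curl w) k x - pd u k x) \<le>
      (\<Sum>b\<in>(UNIV::bool set). ennreal (8 * C\<^sup>2) * energy outer (if b then J else (\<lambda>x. norm (pd u k x))))"
  proof (rule energy_add_le_sq)
    have "(\<lambda>x. norm (pd u k x)) \<in> borel_measurable lebesgue"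
      by (rule continuous_lebesgue[OF continuous_on_norm[OF smooth_continuous_on[OF smooth_pd[OF u(1)]]]])
    moreover have "J \<in> borel_measurable lebesgue" unfolding J_def[abs_def]
      by (intro borel_measurable_times borel_measurable_const borel_measurable_indicator) simp
    ultimately show "(if b then J else (\<lambda>x. norm (pd u k x))) \<in> borel_measurable lebesgue" for b by simp
    fix x assume x: "x \<in> outer"
    have "norm (pd (curl w) k x - pd u k x) \<le> 2 * C * (J x + norm (pd u k x))"
    proof (cases "norm x \<le> 2 * R")
      case True
      have R0: "R > 0" using R by simp
      have xR: "R \<le> norm x" using x by (simp add: outer_def)
      have "x \<notin> N" using N_bound[of x] \<rho>(3) xR by auto
      then have "norm (pd (curl w) k x - pd u k x) = norm (pd (curl q) k x)"
        by (simp add: pd_curl_w curl_p_bounds(4))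
      also have "\<dots> \<le> 2 * C * (\<bar>\<psi> x - c\<bar> / (R / 4)\<^sup>2 + 2 * norm (u x) / (R / 4) + norm (pd u k x))"
        by (rule bounds1(3)[OF k])
      also have "\<dots> \<le> 2 * C * (J x + norm (pd u k x))"
      proof (intro mult_left_mono add_right_mono)
        have "norm (u x) \<le> B / (norm x + 1)" by (rule u(3)[OF True])
        also have "\<dots> \<le> B / R" using xR R0 B by (intro divide_left_mono) auto
        finally have "2 * norm (u x) / (R / 4) \<le> 2 * (B / R) / (R / 4)"
          using R0 by (intro divide_right_mono mult_left_mono) auto
        moreover have "\<bar>\<psi> x - c\<bar> / (R / 4)\<^sup>2 \<le> 16 * B / (R / 4)\<^sup>2"
          using annulus[OF xR True] by (intro divide_right_mono) auto
        moreover have "16 * B / (R / 4)\<^sup>2 + 2 * (B / R) / (R / 4) = 264 * B / R\<^sup>2"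
          using R0 by (simp add: field_simps power2_eq_square)
        ultimately show "\<bar>\<psi> x - c\<bar> / (R / 4)\<^sup>2 + 2 * norm (u x) / (R / 4) \<le> J x"
          using True by (simp add: J_def)
      qed (use C in simp)
      finally show ?thesis .
    next
      case False
      then have "norm (pd (curl w) k x - pd u k x) = norm (pd u k x)" by (simp add: w_outer(2))
      also have "\<dots> \<le> 2 * C * norm (pd u k x)"
        using C mult_right_mono[of 1 "2 * C" "norm (pd u k x)"] by simp
      also have "\<dots> = 2 * C * (J x + norm (pd u k x))" using False by (simp add: J_def)
      finally show ?thesis .
    qed
    then have "(norm (pd (curl w) k x - pd u k x))\<^sup>2 \<le> (2 * C * (J x + norm (pd u k x)))\<^sup>2"
      by (rule power_mono) simp
    also have "\<dots> = 4 * C\<^sup>2 * (J x + norm (pd u k x))\<^sup>2" by (simp add: power_mult_distrib)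
    also have "\<dots> \<le> 4 * C\<^sup>2 * (2 * (J x)\<^sup>2 + 2 * (norm (pd u k x))\<^sup>2)"
    proof (rule mult_left_mono)
      show "(J x + norm (pd u k x))\<^sup>2 \<le> 2 * (J x)\<^sup>2 + 2 * (norm (pd u k x))\<^sup>2"
        using zero_le_power2[of "J x - norm (pd u k x)"] unfolding power2_sum power2_diff by linarith
    qed simp
    also have "\<dots> = (\<Sum>b\<in>(UNIV::bool set). 8 * C\<^sup>2 * (norm ((if b then J else (\<lambda>x. norm (pd u k x))) x))\<^sup>2)"
      by (simp add: UNIV_bool distrib_left)
    finally show "(norm (pd (curl w) k x - pd u k x))\<^sup>2 \<le>
      (\<Sum>b\<in>(UNIV::bool set). 8 * C\<^sup>2 * (norm ((if b then J else (\<lambda>x. norm (pd u k x))) x))\<^sup>2)" .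
  qed (use borel_outer in auto)
  also have "\<dots> = ennreal (8 * C\<^sup>2) * energy outer (\<lambda>x. norm (pd u k x)) + ennreal (8 * C\<^sup>2) * energy outer J"
    by (simp add: UNIV_bool)
  also have "\<dots> \<le> ennreal (8 * C\<^sup>2) * (ennreal 4 * energy outer (grad u)) +
      ennreal (8 * C\<^sup>2) * (ennreal ((264 * B / R\<^sup>2)\<^sup>2) * ennreal (16 * R\<^sup>2))"
  proof (intro add_mono mult_left_mono)
    have "energy outer (\<lambda>x. norm (pd u k x)) = energy outer (pd u k)" by (rule energy_cong) simp
    also have "\<dots> \<le> 4 * energy outer (grad u)" by (rule energy_pd_le_grad[OF u(1) borel_outer k])
    finally show "energy outer (\<lambda>x. norm (pd u k x)) \<le> ennreal 4 * energy outer (grad u)" by simp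
    have "energy outer J \<le> ennreal ((264 * B / R\<^sup>2)\<^sup>2) * emeasure lebesgue (cball (0::real^2) (2 * R))"
      by (rule energy_bounded) (use J0 in \<open>auto simp: J_def indicator_def\<close>)
    also have "\<dots> \<le> ennreal ((264 * B / R\<^sup>2)\<^sup>2) * ennreal (16 * R\<^sup>2)"
      by (rule mult_left_mono[OF emeasure_cball_le]) simp
    finally show "energy outer J \<le> ennreal ((264 * B / R\<^sup>2)\<^sup>2) * ennreal (16 * R\<^sup>2)" .
  qed auto
  also have "ennreal (8 * C\<^sup>2) * (ennreal 4 * energy outer (grad u)) = ennreal (32 * C\<^sup>2) * energy outer (grad u)"
    by (subst ennreal_mult_assoc) simp_all
  also have "ennreal (8 * C\<^sup>2) * (ennreal ((264 * B / R\<^sup>2)\<^sup>2) * ennreal (16 * R\<^sup>2)) =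
      ennreal (8 * C\<^sup>2 * (264 * B / R\<^sup>2)\<^sup>2) * ennreal (16 * R\<^sup>2)"
    by (rule ennreal_mult_assoc) simp_all
  also have "\<dots> = ennreal (8 * C\<^sup>2 * ((264 * B / R\<^sup>2)\<^sup>2 * (16 * R\<^sup>2)))"
    by (subst ennreal_mult[symmetric]) (simp_all only: mult.assoc, simp_all)
  also have "8 * C\<^sup>2 * ((264 * B / R\<^sup>2)\<^sup>2 * (16 * R\<^sup>2)) = 128 * 264\<^sup>2 * C\<^sup>2 * (B / R)\<^sup>2"
    using R by (simp add: field_simps power2_eq_square)
  finally show ?thesis .
qed

lemma energy_pd_diff:
  assumes k: "norm k = 1"
  shows "energy UNIV (\<lambda>x. pd (curl w) k x - pd u k x) \<le>
    ennreal (32 * C\<^sup>2 * ((s + 2)\<^sup>2 * s\<^sup>2 * real (card E) + 1)) * (energy N' (grad u) + energy outer (grad u)) +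
    ennreal (128 * 264\<^sup>2 * C\<^sup>2 * (B / R)\<^sup>2)"
proof -
  let ?F = "\<lambda>x. pd (curl w) k x - pd u k x"
  let ?K = "32 * C\<^sup>2 * ((s + 2)\<^sup>2 * s\<^sup>2 * real (card E) + 1)"
  have m: "?F \<in> borel_measurable lebesgue"
    by (intro continuous_lebesgue continuous_on_diff smooth_continuous_on smooth_pd smooth_curl smooth_w u(1))
  have "?F x = 0" if "x \<notin> N \<union> outer" for x
    using that by (simp add: pd_curl_w curl_p_bounds(4) curl_q_inner(2) outer_def)
  then have "energy UNIV ?F \<le> energy ((N \<union> outer) \<inter> UNIV) ?F" by (rule energy_UNIV_le)
  also have "\<dots> \<le> energy N ?F + energy outer ?F"
    unfolding Int_UNIV_right by (rule energy_Un_le[OF m]) (use borel_N borel_outer in auto)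
  also have "\<dots> \<le> ennreal ?K * energy N' (grad u) + (ennreal (32 * C\<^sup>2) * energy outer (grad u) + ennreal (128 * 264\<^sup>2 * C\<^sup>2 * (B / R)\<^sup>2))"
    by (intro add_mono energy_near energy_outer k)
  also have "\<dots> \<le> ennreal ?K * energy N' (grad u) + (ennreal ?K * energy outer (grad u) + ennreal (128 * 264\<^sup>2 * C\<^sup>2 * (B / R)\<^sup>2))"
  proof (intro add_mono mult_right_mono ennreal_leI order_refl)
    show "32 * C\<^sup>2 \<le> ?K" by (simp add: algebra_simps)
  qed auto
  finally show ?thesis by (simp add: distrib_left add.assoc)
qed

end

section \<open>Approximation by truncated averages\<close>

text \<open>The bound on \<open>v\<close> contributes \<open>2 * C / (norm x + 1)\<close>, since the
  weight at most doubles within distance 1. The error \<open>t = norm (\<phi> z - v z)\<close> is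
  split by \<open>t \<le> \<eta> + t\<^sup>2 / \<eta>\<close>, so its average is at most
  \<open>\<eta>\<close> plus the energy \<open>J\<close> divided by \<open>\<eta>\<close> and by the
  area of the square.\<close>

lemma mean_pointwise:
  fixes \<phi> v :: "real^2 \<Rightarrow> real^2"
  assumes \<phi>: "continuous_on UNIV \<phi>" "\<And>x. x \<notin> \<Omega> \<Longrightarrow> \<phi> x = 0"
    and v: "v \<in> borel_measurable lebesgue" "AE z in lebesgue. z \<in> \<Omega> \<longrightarrow> (norm z + 1) * norm (v z) \<le> C"
    and \<Omega>: "open \<Omega>" and C: "C \<ge> 0" and \<delta>: "0 < \<delta>" "2 * \<delta> \<le> 1" and \<eta>: "\<eta> > 0" and J: "J \<ge> 0"
    and en: "energy (\<Omega> \<inter> ball 0 (norm x + 1)) (\<lambda>z. \<phi> z - v z) \<le> ennreal J"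
  shows "norm (mean \<delta> \<phi> x) \<le> 2 * C / (norm x + 1) + \<eta> + J / ((2 * \<delta>)\<^sup>2 * \<eta>)"
proof -
  let ?Q = "cbox (- \<delta> *\<^sub>R One) (\<delta> *\<^sub>R One) :: (real^2) set"
  let ?S = "\<Omega> \<inter> ball 0 (norm x + 1)"
  let ?c = "(2 * \<delta>)\<^sup>2"
  define K where "K = 2 * C / (norm x + 1) + \<eta>"
  have K: "K \<ge> 0" using C \<eta> by (simp add: K_def)
  have c: "?c > 0" using \<delta> by simp
  have cont: "continuous_on UNIV (\<lambda>y. norm (\<phi> (x + y)))"
    by (intro continuous_intros continuous_on_compose2[OF \<phi>(1)]) auto
  have Sm: "?S \<in> sets lebesgue" using \<Omega> by (auto intro!: sets_completionI_sets borel_open)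
  have pm: "\<phi> \<in> borel_measurable borel" by (rule borel_measurable_continuous_onI[OF \<phi>(1)])
  have em: "(\<lambda>z. ennreal ((norm (\<phi> z - v z))\<^sup>2) * indicator ?S z) \<in> borel_measurable lebesgue"
    by (intro energy_integrand_measurable Sm borel_measurable_diff continuous_lebesgue[OF \<phi>(1)] v(1))
  have im: "(\<lambda>z. indicator ?Q (z - x) :: ennreal) \<in> borel_measurable borel"
    by (intro measurable_compose[OF _ borel_measurable_indicator[of ?Q borel]]) auto
  have "ennreal (integral ?Q (\<lambda>y. norm (\<phi> (x + y)))) = (\<integral>\<^sup>+y. ennreal (norm (\<phi> (x + y))) * indicator ?Q y \<partial>lborel)"
    by (rule nn_integral_cbox[OF cont]) simp
  also have "\<dots> = (\<integral>\<^sup>+y. ennreal (norm (\<phi> (x + y))) * indicator ?Q ((x + y) - x) \<partial>lborel)" by simp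
  also have "\<dots> = (\<integral>\<^sup>+z. ennreal (norm (\<phi> z)) * indicator ?Q (z - x) \<partial>lborel)"
    by (rule nn_integral_translate) (intro borel_measurable_times_ennreal im measurable_compose[OF _ measurable_ennreal]
        measurable_compose[OF pm borel_measurable_norm])
  also have "\<dots> = (\<integral>\<^sup>+z. ennreal (norm (\<phi> z)) * indicator ?Q (z - x) \<partial>lebesgue)"
    by (rule nn_integral_completion[symmetric])
  also have "\<dots> \<le> (\<integral>\<^sup>+z. ennreal K * indicator ?Q (z - x) +
      ennreal (1 / \<eta>) * (ennreal ((norm (\<phi> z - v z))\<^sup>2) * indicator ?S z) \<partial>lebesgue)"
  proof (rule nn_integral_mono_AE)
    show "AE z in lebesgue. ennreal (norm (\<phi> z)) * indicator ?Q (z - x) \<le> ennreal K * indicator ?Q (z - x) +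
      ennreal (1 / \<eta>) * (ennreal ((norm (\<phi> z - v z))\<^sup>2) * indicator ?S z)"
      using v(2)
    proof eventually_elim
      case (elim z)
      show ?case
      proof (cases "z \<in> \<Omega> \<and> z - x \<in> ?Q")
        case False
        then show ?thesis using \<phi>(2)[of z] by (auto simp: indicator_def)
      next
        case True
        let ?D = "norm (\<phi> z - v z)"
        have zx: "norm (z - x) < 1" using norm_cube[OF \<delta>(1), of "z - x"] True \<delta>(2) by simp
        have zS: "z \<in> ?S" using True zx norm_triangle_sub[of z x] by simp
        have nz: "norm x + 1 \<le> 2 * (norm z + 1)"
        proof -
          have "norm (x - z) < 1" using zx by (simp add: norm_minus_commute)
          then have "norm x \<le> norm z + 1" using norm_triangle_sub[of x z] by (rule order_trans[rotated, OF add_left_mono[OF less_imp_le]])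
          then have "norm x + 1 \<le> (norm z + 1) + 1" by (rule add_right_mono)
          also have "\<dots> \<le> 2 * (norm z + 1)" by simp
          finally show ?thesis .
        qed
        have "norm (v z) \<le> C / (norm z + 1)"
          using elim True by (simp add: pos_le_divide_eq add_nonneg_pos mult.commute)
        also have "\<dots> \<le> 2 * C / (norm x + 1)"
          using nz C mult_left_mono[OF nz C] by (simp add: divide_simps add_nonneg_pos add_nonneg_eq_0_iff mult_ac)
        finally have 1: "norm (v z) \<le> 2 * C / (norm x + 1)" .
        have 2: "?D \<le> \<eta> + 1 / \<eta> * ?D\<^sup>2"
        proof (cases "?D \<le> \<eta>")
          case False
          then have "?D * \<eta> \<le> ?D * ?D" by (intro mult_left_mono) auto
          then show ?thesis using \<eta> by (simp add: field_simps power2_eq_square add_increasing)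
        qed (use \<eta> in \<open>simp add: add_increasing2\<close>)
        have "norm (\<phi> z) \<le> K + 1 / \<eta> * ?D\<^sup>2"
          using 1 2 norm_triangle_sub[of "\<phi> z" "v z"] unfolding K_def by linarith
        then have "ennreal (norm (\<phi> z)) \<le> ennreal (K + 1 / \<eta> * ?D\<^sup>2)" by (rule ennreal_leI)
        also have "\<dots> = ennreal K + ennreal (1 / \<eta>) * ennreal (?D\<^sup>2)"
          using K \<eta> by (simp add: ennreal_mult'[symmetric])
        finally show ?thesis using True zS by simp
      qed
    qed
  qed
  also have "\<dots> = (\<integral>\<^sup>+z. ennreal K * indicator ?Q (z - x) \<partial>lebesgue) +
      (\<integral>\<^sup>+z. ennreal (1 / \<eta>) * (ennreal ((norm (\<phi> z - v z))\<^sup>2) * indicator ?S z) \<partial>lebesgue)"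
    by (intro nn_integral_add borel_measurable_times_ennreal borel_measurable_const em borel_measurable_lebesgueI im)
  also have "(\<integral>\<^sup>+z. ennreal K * indicator ?Q (z - x) \<partial>lebesgue) = ennreal (K * ?c)"
  proof -
    have "(\<integral>\<^sup>+z. ennreal K * indicator ?Q (z - x) \<partial>lebesgue) = (\<integral>\<^sup>+z. ennreal K * indicator ?Q (z - x) \<partial>lborel)"
      by (rule nn_integral_completion)
    also have "\<dots> = (\<integral>\<^sup>+y. ennreal K * indicator ?Q ((x + y) - x) \<partial>lborel)"
      by (rule nn_integral_translate[symmetric]) (intro borel_measurable_times_ennreal im borel_measurable_const)
    also have "\<dots> = ennreal K * emeasure lborel ?Q"
      by (simp only: add_diff_cancel_left') (intro nn_integral_cmult_indicator, simp)
    also have "emeasure lborel ?Q = ennreal ?c"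
      using emeasure_eq_ennreal_measure[of lborel ?Q] emeasure_lborel_cbox_finite[of "- \<delta> *\<^sub>R One" "\<delta> *\<^sub>R One :: real^2"]
        measure_cube[OF \<delta>(1)] by (simp del: scaleR_minus_left)
    finally show ?thesis using K by (simp add: ennreal_mult)
  qed
  also have "(\<integral>\<^sup>+z. ennreal (1 / \<eta>) * (ennreal ((norm (\<phi> z - v z))\<^sup>2) * indicator ?S z) \<partial>lebesgue) =
      ennreal (1 / \<eta>) * energy ?S (\<lambda>z. \<phi> z - v z)"
    unfolding energy_def by (rule nn_integral_cmult[OF em])
  also have "ennreal (K * ?c) + \<dots> \<le> ennreal (K * ?c) + ennreal (1 / \<eta>) * ennreal J"
    by (intro add_left_mono mult_left_mono en) simp
  also have "\<dots> = ennreal (K * ?c + J / \<eta>)"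
    using K J \<eta> by (simp add: ennreal_mult'[symmetric])
  finally have le: "integral ?Q (\<lambda>y. norm (\<phi> (x + y))) \<le> K * ?c + J / \<eta>"
    using K J \<eta> by (subst (asm) ennreal_le_iff) auto
  have "norm (integral ?Q (\<lambda>y. \<phi> (x + y))) \<le> integral ?Q (\<lambda>y. norm (\<phi> (x + y)))"
    using avg_norm_le[OF cube_cont(1) cube_cont(2) \<phi>(1), of "- \<delta> *\<^sub>R One" "\<delta> *\<^sub>R One" x]
    by (simp add: avg_def del: scaleR_minus_left)
  then have "norm (mean \<delta> \<phi> x) \<le> (K * ?c + J / \<eta>) / ?c"
    using le c by (simp add: mean_def avg_def divide_right_mono del: scaleR_minus_left)
  also have "\<dots> = K + J / (?c * \<eta>)" using c by (simp add: add_divide_distrib)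
  finally show ?thesis by (simp add: K_def)
qed

section \<open>Energies of gradients of averages\<close>

lemma energy_grad:
  assumes "smooth f" "smooth g" "S \<in> sets borel"
  shows "energy S (\<lambda>x. grad f x - grad g x) =
    energy S (\<lambda>x. pd f e1 x - pd g e1 x) + energy S (\<lambda>x. pd f e2 x - pd g e2 x)"
proof -
  have m: "(\<lambda>x. ennreal ((norm (pd f h x - pd g h x))\<^sup>2) * indicator S x) \<in> borel_measurable lebesgue" for h
    using assms(3) by (intro energy_integrand_measurable continuous_lebesgue continuous_on_diff smooth_continuous_on
      smooth_pd assms) simp
  have "grad f x - grad g x = grad (\<lambda>x. f x - g x) x" for x
    by (simp add: vec_eq_iff grad_nth pd_diff[OF assms(1,2)])
  then have "(norm (grad f x - grad g x))\<^sup>2 = (norm (pd f e1 x - pd g e1 x))\<^sup>2 + (norm (pd f e2 x - pd g e2 x))\<^sup>2" for x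
    by (simp add: norm_grad pd_diff[OF assms(1,2)])
  then have "energy S (\<lambda>x. grad f x - grad g x) =
    (\<integral>\<^sup>+x. ennreal ((norm (pd f e1 x - pd g e1 x))\<^sup>2) * indicator S x + ennreal ((norm (pd f e2 x - pd g e2 x))\<^sup>2) * indicator S x \<partial>lebesgue)"
    unfolding energy_def by (intro nn_integral_cong) (simp add: distrib_right)
  also have "\<dots> = energy S (\<lambda>x. pd f e1 x - pd g e1 x) + energy S (\<lambda>x. pd f e2 x - pd g e2 x)"
    unfolding energy_def by (rule nn_integral_add[OF m m])
  finally show ?thesis .
qed

lemma energy_pd_diff_le_grad:
  assumes "smooth f" "smooth g"
  shows "energy S (\<lambda>x. pd f (axis j 1) x - pd g (axis j 1) x) \<le> energy S (\<lambda>x. grad f x - grad g x)"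
proof (rule energy_mono)
  fix x
  have "pd f (axis j 1) x - pd g (axis j 1) x = pd (\<lambda>x. f x - g x) (axis j 1) x"
    by (simp add: pd_diff[OF assms])
  moreover have "grad f x - grad g x = grad (\<lambda>x. f x - g x) x"
    by (simp add: vec_eq_iff grad_nth pd_diff[OF assms])
  ultimately show "norm (pd f (axis j 1) x - pd g (axis j 1) x) \<le> norm (grad f x - grad g x)"
    using norm_pd_axis_le[of "\<lambda>x. f x - g x" j x] by simp
qed

lemma energy_mean_diff:
  assumes "continuous_on UNIV f" "continuous_on UNIV g" "\<delta> > 0" "S \<in> sets borel" "S' \<in> sets borel"
    and "\<And>x y. x \<in> S \<Longrightarrow> norm y < 2 * \<delta> \<Longrightarrow> x + y \<in> S'"
  shows "energy S (\<lambda>x. mean \<delta> f x - mean \<delta> g x) \<le> energy S' (\<lambda>x. f x - g x)"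
proof -
  have "(\<lambda>x. mean \<delta> f x - mean \<delta> g x) = mean \<delta> (\<lambda>x. f x - g x)"
    by (rule ext) (rule mean_diff[OF assms(1,2), symmetric])
  then show ?thesis using energy_mean_le[OF continuous_on_diff[OF assms(1,2)] assms(3-6)] by simp
qed

text \<open>On \<open>S\<close> the averaged derivatives of \<open>g\<close> vanish, so those of
  \<open>f\<close> equal the averages of the difference, and averaging is a contraction. The 2
  counts the two coordinate directions.\<close>

lemma energy_grad_mean_le:
  fixes f g :: "real^2 \<Rightarrow> real^2"
  assumes f: "smooth f" and g: "smooth g" and \<delta>: "\<delta> > 0" and S: "S \<in> sets borel"
    and 0: "\<And>x h. x \<in> S \<Longrightarrow> mean \<delta> (pd g h) x = 0"
  shows "energy S (grad (mean \<delta> f)) \<le> 2 * energy UNIV (\<lambda>x. grad f x - grad g x)"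
proof -
  have c: "smooth (\<lambda>x. 0 :: real^2)" by simp
  have z: "grad (\<lambda>x. 0 :: real^2) x = 0" for x by (simp add: vec_eq_iff grad_nth)
  have "energy S (grad (mean \<delta> f)) = energy S (\<lambda>x. pd (mean \<delta> f) e1 x) + energy S (\<lambda>x. pd (mean \<delta> f) e2 x)"
    using energy_grad[OF smooth_mean[OF f] c S] by (simp add: z)
  also have "\<dots> \<le> energy UNIV (\<lambda>x. grad f x - grad g x) + energy UNIV (\<lambda>x. grad f x - grad g x)"
  proof (rule add_mono)
    have *: "energy S (\<lambda>x. pd (mean \<delta> f) (axis j 1) x) \<le> energy UNIV (\<lambda>x. grad f x - grad g x)" for j
    proof -
      have "energy S (\<lambda>x. pd (mean \<delta> f) (axis j 1) x) = energy S (\<lambda>x. mean \<delta> (pd f (axis j 1)) x - mean \<delta> (pd g (axis j 1)) x)"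
        by (rule energy_cong) (simp add: pd_mean[OF f] 0)
      also have "\<dots> \<le> energy UNIV (\<lambda>x. pd f (axis j 1) x - pd g (axis j 1) x)"
        by (rule energy_mean_diff) (use \<delta> S in \<open>auto intro!: smooth_continuous_on smooth_pd f g\<close>)
      also have "\<dots> \<le> energy UNIV (\<lambda>x. grad f x - grad g x)" by (rule energy_pd_diff_le_grad[OF f g])
      finally show ?thesis .
    qed
    show "energy S (\<lambda>x. pd (mean \<delta> f) e1 x) \<le> energy UNIV (\<lambda>x. grad f x - grad g x)"
      "energy S (\<lambda>x. pd (mean \<delta> f) e2 x) \<le> energy UNIV (\<lambda>x. grad f x - grad g x)" by (rule *)+
  qed
  finally show ?thesis by (simp add: mult_2)
qed

section \<open>Cutoffs near infinity\<close>

lemma controlled_mono: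
  assumes "controlled C \<delta> \<zeta>" "C \<le> C'" "\<delta> > 0"
  shows "controlled C' \<delta> \<zeta>"
proof -
  have le: "C / \<delta> \<le> C' / \<delta>" "C / \<delta>\<^sup>2 \<le> C' / \<delta>\<^sup>2" using assms by (auto intro: divide_right_mono)
  then have "C / \<delta> * norm h \<le> C' / \<delta> * norm h" "C / \<delta>\<^sup>2 * norm h * norm k \<le> C' / \<delta>\<^sup>2 * norm h * norm k" for h k :: 'a
    by (intro mult_right_mono norm_ge_zero le)+
  then show ?thesis using assms(1,2) unfolding controlled_def by (meson order_trans)
qed

lemma controlled_complement:
  assumes "controlled C \<delta> \<zeta>" "\<delta> > 0"
  shows "controlled (C + 1) \<delta> (\<lambda>x. 1 - \<zeta> x)"
proof -
  have s: "smooth \<zeta>" using assms(1) by (simp add: controlled_def)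
  have p: "pd (\<lambda>x. 1 - \<zeta> x) h = (\<lambda>x. 0 - pd \<zeta> h x)" for h
    by (rule ext) (simp add: pd_diff[OF smooth_const s])
  have pp: "pd (\<lambda>x. 0 - pd \<zeta> h x) k x = - pd (pd \<zeta> h) k x" for h k x
    by (subst pd_diff[OF smooth_const smooth_pd[OF s]]) simp
  have "controlled (C + 1) \<delta> \<zeta>" using controlled_mono[OF assms(1) _ assms(2)] by simp
  moreover have "\<bar>1 - \<zeta> x\<bar> \<le> C + 1" for x
  proof -
    have "\<bar>\<zeta> x\<bar> \<le> C" using assms(1) by (simp add: controlled_def)
    then show ?thesis by linarith
  qed
  ultimately show ?thesis
    unfolding controlled_def p pp by (simp add: smooth_diff)
qed

text \<open>One minus the cutoff for the ball of radius \<open>R\<close> at scale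
  \<open>R / 4\<close>: norm below \<open>5 / 4 * R\<close> means distance below
  \<open>R / 4\<close>, and norm at least \<open>2 * R\<close> means distance at least
  \<open>4 * (R / 4)\<close>. Subtraction from 1 raises the constant by 1.\<close>

lemma annulus_cutoff:
  fixes R :: real
  assumes C: "\<And>(A::'a::euclidean_space set) \<delta>. compact A \<Longrightarrow> A \<noteq> {} \<Longrightarrow> \<delta> > 0 \<Longrightarrow>
    \<exists>\<zeta>. controlled C \<delta> \<zeta> \<and>
      (\<forall>x. infdist x A < \<delta> \<longrightarrow> \<zeta> x = 1) \<and> (\<forall>x. infdist x A \<ge> 4 * \<delta> \<longrightarrow> \<zeta> x = 0)"
    and R: "R > 0"
  obtains \<zeta> :: "'a::euclidean_space \<Rightarrow> real" where "controlled (C + 1) (R / 4) \<zeta>"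
    "\<And>x. norm x < 5 / 4 * R \<Longrightarrow> \<zeta> x = 0" "\<And>x. norm x \<ge> 2 * R \<Longrightarrow> \<zeta> x = 1"
proof -
  have ne: "cball (0::'a) R \<noteq> {}" "R / 4 > 0" using R by auto
  obtain \<theta> where \<theta>: "controlled C (R / 4) \<theta>" "\<And>x::'a. infdist x (cball 0 R) < R / 4 \<Longrightarrow> \<theta> x = 1"
    "\<And>x. infdist x (cball 0 R) \<ge> 4 * (R / 4) \<Longrightarrow> \<theta> x = 0"
    using C[OF compact_cball ne] by blast
  show thesis
  proof
    show "controlled (C + 1) (R / 4) (\<lambda>x. 1 - \<theta> x)" by (rule controlled_complement[OF \<theta>(1) ne(2)])
    show "1 - \<theta> x = 0" if x: "norm x < 5 / 4 * R" for x
    proof -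
      have "infdist x (cball 0 R) < R / 4"
      proof (cases "norm x \<le> R")
        case True
        then have "infdist x (cball 0 R) = 0" by (intro infdist_zero) simp
        then show ?thesis using R by simp
      next
        case False
        let ?y = "(R / norm x) *\<^sub>R x"
        have x0: "norm x > 0" using False R by linarith
        have "x - ?y = (1 - R / norm x) *\<^sub>R x" by (simp add: algebra_simps)
        moreover have "1 - R / norm x \<ge> 0" using False x0 by (simp add: divide_le_eq)
        ultimately have "dist x ?y = (1 - R / norm x) * norm x" by (simp add: dist_norm)
        also have "\<dots> = norm x - R" using x0 by (simp add: algebra_simps)
        finally have "dist x ?y = norm x - R" .
        moreover have "?y \<in> cball 0 R" using x0 R by simp
        ultimately show ?thesis using infdist_le[of ?y "cball 0 R" x] x by simp
      qed
      then show ?thesis using \<theta>(2) by simp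
    qed
    show "1 - \<theta> x = 1" if x: "norm x \<ge> 2 * R" for x
    proof -
      obtain y where y: "y \<in> cball 0 R" "infdist x (cball 0 R) = dist x y"
        using infdist_attains_inf[OF closed_cball ne(1)] by blast
      have "infdist x (cball 0 R) \<ge> R"
        using y x norm_triangle_ineq2[of x y] by (simp add: dist_norm)
      then show ?thesis using \<theta>(3) by simp
    qed
  qed
qed

lemma energy_split4_le:
  fixes a b c d :: "'a::euclidean_space \<Rightarrow> 'b::euclidean_space"
  assumes m: "a \<in> borel_measurable lebesgue" "b \<in> borel_measurable lebesgue" "c \<in> borel_measurable lebesgue"
      "d \<in> borel_measurable lebesgue" "S \<in> sets lebesgue"
    and le: "energy S a \<le> ennreal A1" "energy S b \<le> ennreal A2" "energy S c \<le> ennreal A3" "energy S d \<le> ennreal A4"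
    and nn: "A1 \<ge> 0" "A2 \<ge> 0" "A3 \<ge> 0" "A4 \<ge> 0"
  shows "energy S (\<lambda>x. (a x + b x) + (c x + d x)) \<le> ennreal (4 * (A1 + A2 + A3 + A4))"
proof -
  have "energy S (\<lambda>x. (a x + b x) + (c x + d x)) \<le> 2 * (2 * (energy S a + energy S b) + 2 * (energy S c + energy S d))"
    by (intro order_trans[OF energy_add_le] mult_left_mono add_mono energy_add_le borel_measurable_add m) auto
  also have "\<dots> \<le> 2 * (2 * (ennreal A1 + ennreal A2) + 2 * (ennreal A3 + ennreal A4))"
    by (intro mult_left_mono add_mono le) auto
  also have "\<dots> = ennreal (4 * (A1 + A2 + A3 + A4))"
  proof -
    have "ennreal 2 * (ennreal 2 * (ennreal A1 + ennreal A2) + ennreal 2 * (ennreal A3 + ennreal A4)) =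
      ennreal (2 * (2 * (A1 + A2) + 2 * (A3 + A4)))"
      using nn by (simp only: ennreal_plus[symmetric] ennreal_mult[symmetric] add_nonneg_nonneg
          mult_nonneg_nonneg zero_le_numeral)
    then show ?thesis by (simp add: algebra_simps)
  qed
  finally show ?thesis .
qed

text \<open>\<open>C1\<close> is fixed before \<open>\<epsilon>\<close>, \<open>\<rho>'\<close> and
  \<open>M0\<close>; the weak* convergence rests on this uniformity. Gradients are compared with
  some late \<open>\<phi> m\<close>, as the limit of the \<open>grad (\<phi> m)\<close> has not been
  identified at this stage.\<close>

lemma approximation:
  fixes \<Omega> :: "(real^2) set" and v :: "real^2 \<Rightarrow> real^2" and \<phi> :: "nat \<Rightarrow> real^2 \<Rightarrow> real^2"
  assumes dom: "exterior_domain \<Omega>" and lip: "lipschitz_boundary \<Omega>"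
    and \<phi>: "\<And>n. \<phi> n \<in> solenoidal_test_fields \<Omega>"
    and cauchy: "\<And>\<epsilon>::real. \<epsilon> > 0 \<Longrightarrow> \<exists>N. \<forall>m\<ge>N. \<forall>n\<ge>N. energy UNIV (\<lambda>x. grad (\<phi> m) x - grad (\<phi> n) x) \<le> ennreal \<epsilon>"
    and loc: "\<And>r \<epsilon>::real. \<epsilon> > 0 \<Longrightarrow> \<exists>N. \<forall>n\<ge>N. energy (\<Omega> \<inter> ball 0 r) (\<lambda>x. \<phi> n x - v x) \<le> ennreal \<epsilon>"
    and v: "v \<in> borel_measurable lebesgue" "AE z in lebesgue. z \<in> \<Omega> \<longrightarrow> (norm z + 1) * norm (v z) \<le> Cv" and Cv: "Cv \<ge> 0"
  obtains C1 where "\<And>\<epsilon> \<rho>' M0. \<epsilon> > 0 \<Longrightarrow> \<exists>m\<ge>M0. \<exists>g. g \<in> solenoidal_test_fields \<Omega> \<and>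
    (\<forall>x. (norm x + 1) * norm (g x) \<le> C1) \<and>
    energy UNIV (\<lambda>x. grad g x - grad (\<phi> m) x) \<le> ennreal \<epsilon> \<and>
    energy (\<Omega> \<inter> ball 0 \<rho>') (\<lambda>x. g x - v x) \<le> ennreal \<epsilon>"
proof -
  let ?K = "- \<Omega>"
  have \<Omega>: "open \<Omega>" "compact ?K" "?K \<noteq> {}" using dom by (auto simp: exterior_domain_def)
  obtain s r0 d0 \<kappa> :: real and E :: "(real^2) set" where geo: "s > 0" "r0 > 0" "d0 > 0" "\<kappa> \<ge> 2" "finite E"
    "\<And>e. e \<in> E \<Longrightarrow> norm e = 1"
    "\<And>\<delta> z. 0 < \<delta> \<Longrightarrow> \<delta> < d0 \<Longrightarrow> infdist z ?K \<le> 4 * \<delta> \<Longrightarrow>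
       \<exists>e\<in>E. ball (z - (s * \<delta>) *\<^sub>R e) (\<kappa> * \<delta>) \<subseteq> ?K"
    "\<And>\<delta> x y. 0 < \<delta> \<Longrightarrow> \<delta> < d0 \<Longrightarrow> ball x (\<kappa> * \<delta>) \<subseteq> ?K \<Longrightarrow> ball y (\<kappa> * \<delta>) \<subseteq> ?K \<Longrightarrow>
       dist x y < r0 \<Longrightarrow>
       \<exists>a b. \<forall>q\<in>closed_segment x a \<union> closed_segment a b \<union> closed_segment b y. ball q (2 * \<delta>) \<subseteq> ?K"
    by (rule exterior_geometry[OF dom lip]) blast
  obtain C0 where C0: "C0 > 0" "\<And>(A::(real^2) set) \<delta>. compact A \<Longrightarrow> A \<noteq> {} \<Longrightarrow> \<delta> > 0 \<Longrightarrow>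
    \<exists>\<zeta>. controlled C0 \<delta> \<zeta> \<and>
      (\<forall>x. infdist x A < \<delta> \<longrightarrow> \<zeta> x = 1) \<and> (\<forall>x. infdist x A \<ge> 4 * \<delta> \<longrightarrow> \<zeta> x = 0)"
    by (rule uniform_cutoffs[where 'a = "real^2"]) blast
  define C where "C = C0 + 1"
  have C: "C \<ge> 1" using C0(1) by (simp add: C_def)
  obtain k0 where k0: "k0 > 0" "\<And>x. x \<in> ?K \<Longrightarrow> norm x \<le> k0"
    using compact_imp_bounded[OF \<Omega>(2)] by (auto simp: bounded_pos)
  define \<rho> where "\<rho> = k0 + 2"
  \<comment> \<open>The average of \<open>\<phi> n\<close> obeys the bound
    \<open>2 * Cv / (norm x + 1)\<close> up to two errors \<open>\<eta>\<close>, each at most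
    \<open>1 / (norm x + 1)\<close>.\<close>
  define B where "B = 2 * Cv + 2"
  have B: "B \<ge> 0" using Cv by (simp add: B_def)
  define C1 where "C1 = B * ((\<rho> + 1) * (1 + 2 * C * (s + 1)) + (1 + 386 * C))"
  define K1 where "K1 = 32 * C\<^sup>2 * ((s + 2)\<^sup>2 * s\<^sup>2 * real (card E) + 1)"
  define K2 where "K2 = 128 * 264\<^sup>2 * C\<^sup>2 * B\<^sup>2"
  define K3 where "K3 = 16 * C\<^sup>2 * (s + 1)\<^sup>2 * s\<^sup>2 * real (card E)"
  have K: "K1 \<ge> 0" "K2 \<ge> 0" "K3 \<ge> 0" by (simp_all add: K1_def K2_def K3_def)
  show thesis
  proof (rule that[of C1])
    fix \<epsilon> \<rho>' :: real and M0 :: nat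
    assume \<epsilon>: "\<epsilon> > 0"
    \<comment> \<open>The divisor majorises the totals of both final sums,
      \<open>32 * K1 + 24\<close> for the gradients and \<open>8 * K3 + 24\<close> for the
      fields.\<close>
    define \<epsilon>1 where "\<epsilon>1 = \<epsilon> / (32 * K1 + 8 * K3 + 48)"
    have \<epsilon>1: "\<epsilon>1 > 0" using \<epsilon> K by (auto simp: \<epsilon>1_def intro!: divide_pos_pos add_nonneg_pos)
    have \<epsilon>1': "(32 * K1 + 8 * K3 + 48) * \<epsilon>1 = \<epsilon>"
      using K by (simp add: \<epsilon>1_def add_nonneg_pos add_nonneg_eq_0_iff)
    obtain N1 where N1: "\<And>m n. m \<ge> N1 \<Longrightarrow> n \<ge> N1 \<Longrightarrow> energy UNIV (\<lambda>x. grad (\<phi> m) x - grad (\<phi> n) x) \<le> ennreal \<epsilon>1"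
      using cauchy[OF \<epsilon>1] by blast
    obtain N2 where N2: "\<And>n. n \<ge> N2 \<Longrightarrow> energy (\<Omega> \<inter> ball 0 (\<rho>' + 1)) (\<lambda>x. \<phi> n x - v x) \<le> ennreal \<epsilon>1"
      using loc[OF \<epsilon>1, of "\<rho>' + 1"] by blast
    define m where "m = max M0 (max N1 N2)"
    have m: "m \<ge> M0" "m \<ge> N1" "m \<ge> N2" by (auto simp: m_def)
    obtain S where sm: "smooth (\<phi> m)" and S: "compact S" "S \<subseteq> \<Omega>" "\<And>x. x \<notin> S \<Longrightarrow> \<phi> m x = 0"
      "\<And>x h. x \<notin> S \<Longrightarrow> pd (\<phi> m) h x = 0" and "\<And>x. divergence (\<phi> m) x = 0"
      using solenoidal_test_fieldD[OF \<phi>] by metis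
    have Sd: "\<exists>d1>0. \<forall>x\<in>S. \<forall>y\<in>?K. d1 \<le> dist x y"
      using separate_compact_closed[OF S(1) compact_imp_closed[OF \<Omega>(2)]] S(2) by blast
    then obtain d1 where d1: "d1 > 0" "\<And>x y. x \<in> S \<Longrightarrow> y \<in> ?K \<Longrightarrow> d1 \<le> dist x y" by blast
    obtain rm where rm: "rm > 0" "\<And>x. x \<in> S \<Longrightarrow> norm x \<le> rm"
      using compact_imp_bounded[OF S(1)] by (auto simp: bounded_pos)
    have rmS: "x \<notin> S" if "norm x > rm" for x using rm(2)[of x] that by auto
    note cm = smooth_continuous_on[OF sm] and cpm = smooth_continuous_on[OF smooth_pd[OF sm]]
    have "\<exists>d>0. \<forall>\<delta>. 0 < \<delta> \<and> \<delta> < d \<longrightarrow> energy UNIV (\<lambda>x. mean \<delta> g x - g x) \<le> ennreal \<epsilon>1"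
      if "continuous_on UNIV g" "\<And>x. x \<notin> S \<Longrightarrow> g x = 0" for g :: "real^2 \<Rightarrow> real^2"
      by (rule mean_approx[OF that(1) _ less_imp_le[OF rm(1)] \<epsilon>1]) (use that(2) rmS in blast)+
    note ma = this
    obtain d2 where d2: "d2 > 0" "\<And>\<delta>. 0 < \<delta> \<Longrightarrow> \<delta> < d2 \<Longrightarrow> energy UNIV (\<lambda>x. mean \<delta> (\<phi> m) x - \<phi> m x) \<le> ennreal \<epsilon>1"
      using ma[OF cm S(3)] by blast
    obtain d3 where d3: "d3 > 0" "\<And>\<delta>. 0 < \<delta> \<Longrightarrow> \<delta> < d3 \<Longrightarrow> energy UNIV (\<lambda>x. mean \<delta> (pd (\<phi> m) e1) x - pd (\<phi> m) e1 x) \<le> ennreal \<epsilon>1"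
      using ma[OF cpm S(4)] by blast
    obtain d4 where d4: "d4 > 0" "\<And>\<delta>. 0 < \<delta> \<Longrightarrow> \<delta> < d4 \<Longrightarrow> energy UNIV (\<lambda>x. mean \<delta> (pd (\<phi> m) e2) x - pd (\<phi> m) e2 x) \<le> ennreal \<epsilon>1"
      using ma[OF cpm S(4)] by blast
    \<comment> \<open>\<open>d1 / (7 + s)\<close> keeps squares centred in \<open>N'\<close> off the
      support of \<open>\<phi> m\<close>, \<open>r0 / (4 * s + 1)\<close> and
      \<open>1 / (s + 1)\<close> give the bounds on \<open>s * \<delta>\<close>, and
      \<open>d2\<close>, \<open>d3\<close>, \<open>d4\<close> make averaging close to the identity
      on \<open>\<phi> m\<close> and its derivatives.\<close>
    define D where "D = {d0, d1 / (7 + s), r0 / (4 * s + 1), 1 / (s + 1), 1 / 4, d2, d3, d4}"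
    define \<delta> where "\<delta> = Min D / 2"
    have D: "finite D" "D \<noteq> {}" by (simp_all add: D_def)
    have "d > 0" if "d \<in> D" for d
      using that geo(1-3) d1(1) d2(1) d3(1) d4(1) unfolding D_def by (auto simp: add_pos_pos)
    then have mpos: "Min D > 0" using D by simp
    then have \<delta>: "\<delta> > 0" unfolding \<delta>_def by simp
    have \<delta>lt: "\<delta> < d" if "d \<in> D" for d
      using Min_le[OF D(1) that] mpos unfolding \<delta>_def by linarith
    have \<delta>': "\<delta> < d0" "\<delta> < d1 / (7 + s)" "\<delta> < r0 / (4 * s + 1)" "\<delta> < 1 / (s + 1)" "\<delta> < 1/4" "\<delta> < d2" "\<delta> < d3" "\<delta> < d4"
      by (rule \<delta>lt, simp add: D_def)+
    have \<delta>a: "(7 + s) * \<delta> < d1" "4 * s * \<delta> < r0" "s * \<delta> < 1" "2 * \<delta> \<le> 1" "4 * \<delta> < 1"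
      using \<delta>'(2-5) geo(1) \<delta> by (auto simp: pos_less_divide_eq algebra_simps add_pos_pos)
    \<comment> \<open>Large enough for the outer zone to miss the averaged support of
      \<open>\<phi> m\<close>, and for \<open>K2 / R\<^sup>2\<close> to fall below
      \<open>\<epsilon>1\<close>: as \<open>R \<ge> 1\<close>, the bound
      \<open>K2 / \<epsilon>1 \<le> R\<close> suffices.\<close>
    define R where "R = 1 + \<rho> + \<bar>\<rho>'\<bar> + rm + 2 + K2 / \<epsilon>1"
    have K2\<epsilon>: "K2 / \<epsilon>1 \<ge> 0" using K \<epsilon>1 by simp
    have R: "R \<ge> 1" "\<rho> \<le> R" "\<rho>' \<le> R" "rm + 1 \<le> R" "K2 / \<epsilon>1 \<le> R"
      using k0(1) rm(1) K2\<epsilon> by (auto simp: R_def \<rho>_def)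
    have K2R: "K2 / R\<^sup>2 \<le> \<epsilon>1"
    proof -
      have "K2 \<le> \<epsilon>1 * R" using R(5) \<epsilon>1 by (simp add: pos_divide_le_eq mult.commute)
      also have "\<dots> \<le> \<epsilon>1 * R\<^sup>2" using R(1) \<epsilon>1 by (simp add: power2_eq_square mult_le_cancel_left1)
      finally show ?thesis using R(1) by (simp add: pos_divide_le_eq)
    qed
    \<comment> \<open>\<open>\<eta>\<close> is at most \<open>1 / (norm x + 1)\<close> for
      \<open>norm x \<le> 2 * R\<close>, and \<open>J\<close> is such that
      \<open>J / ((2 * \<delta>)\<^sup>2 * \<eta>) = \<eta>\<close>. Both precede the choice of
      \<open>n\<close>.\<close>
    define \<eta> where "\<eta> = 1 / (2 * R + 1)"
    define J where "J = (2 * \<delta>)\<^sup>2 * \<eta>\<^sup>2"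
    have \<eta>: "\<eta> > 0" using R(1) by (simp add: \<eta>_def)
    have J: "J > 0" using \<eta> \<delta> by (simp add: J_def)
    obtain N3 where N3: "\<And>n. n \<ge> N3 \<Longrightarrow> energy (\<Omega> \<inter> ball 0 (2 * R + 1)) (\<lambda>x. \<phi> n x - v x) \<le> ennreal J"
      using loc[OF J, of "2 * R + 1"] by blast
    define n where "n = max m N3"
    have n: "n \<ge> N1" "n \<ge> N2" "n \<ge> N3" using m by (auto simp: n_def)
    obtain Sn where sn: "smooth (\<phi> n)" and Sn: "Sn \<subseteq> \<Omega>" "\<And>x. x \<notin> Sn \<Longrightarrow> \<phi> n x = 0"
      and divn: "\<And>x. divergence (\<phi> n) x = 0"
      using solenoidal_test_fieldD[OF \<phi>] by metis
    have n0: "\<phi> n x = 0" if "x \<notin> \<Omega>" for x using Sn that by blast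
    have m0: "\<phi> m x = 0" if "x \<notin> \<Omega>" for x using S that by blast
    note cn = smooth_continuous_on[OF sn] and cpn = smooth_continuous_on[OF smooth_pd[OF sn]]
    define u where "u = mean \<delta> (\<phi> n)"
    have su: "smooth u" unfolding u_def by (rule smooth_mean[OF sn])
    have divu: "divergence u x = 0" for x unfolding u_def by (rule divergence_mean[OF sn divn])
    have u0: "u x = 0" if "ball x (2 * \<delta>) \<subseteq> ?K" for x
      unfolding u_def by (rule mean_eq_0[OF cn \<delta>]) (use that in \<open>intro n0, auto\<close>)
    have uB: "norm (u x) \<le> B / (norm x + 1)" if x: "norm x \<le> 2 * R" for x
    proof -
      have "energy (\<Omega> \<inter> ball 0 (norm x + 1)) (\<lambda>x. \<phi> n x - v x) \<le> energy (\<Omega> \<inter> ball 0 (2 * R + 1)) (\<lambda>x. \<phi> n x - v x)"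
        using x by (intro energy_mono_set) auto
      also have "\<dots> \<le> ennreal J" by (rule N3[OF n(3)])
      finally have "norm (u x) \<le> 2 * Cv / (norm x + 1) + \<eta> + J / ((2 * \<delta>)\<^sup>2 * \<eta>)"
        unfolding u_def using J
        by (intro mean_pointwise[OF cn n0 v \<Omega>(1) Cv \<delta> \<delta>a(4) \<eta>]) auto
      also have "J / ((2 * \<delta>)\<^sup>2 * \<eta>) = \<eta>" using \<delta> \<eta> by (simp add: J_def power2_eq_square)
      also have "2 * Cv / (norm x + 1) + \<eta> + \<eta> \<le> 2 * Cv / (norm x + 1) + 1 / (norm x + 1) + 1 / (norm x + 1)"
      proof -
        have "\<eta> \<le> 1 / (norm x + 1)"
          unfolding \<eta>_def using x R(1) by (intro divide_left_mono) (auto intro!: mult_pos_pos add_nonneg_pos)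
        then show ?thesis by linarith
      qed
      also have "\<dots> = B / (norm x + 1)" by (simp add: B_def add_divide_distrib)
      finally show ?thesis .
    qed
    obtain \<psi> where \<psi>: "smooth \<psi>" "\<And>x. curl \<psi> x = u x" "\<And>h x. \<bar>pd \<psi> h x\<bar> \<le> norm (u x) * norm h"
      "\<And>h k x. \<bar>pd (pd \<psi> h) k x\<bar> \<le> norm (pd u k x) * norm h"
      using stream_function[OF su divu] by metis
    have R0: "R > 0" using R(1) by simp
    obtain \<zeta>1 :: "real^2 \<Rightarrow> real" where \<zeta>1: "controlled C (R / 4) \<zeta>1"
      "\<And>x. norm x < 5 / 4 * R \<Longrightarrow> \<zeta>1 x = 0" "\<And>x. norm x \<ge> 2 * R \<Longrightarrow> \<zeta>1 x = 1"
      unfolding C_def by (rule annulus_cutoff[OF C0(2) R0]) blast+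
    obtain \<zeta>2 where z2: "controlled C0 \<delta> \<zeta>2" "\<And>x. infdist x ?K < \<delta> \<Longrightarrow> \<zeta>2 x = 1"
      "\<And>x. infdist x ?K \<ge> 4 * \<delta> \<Longrightarrow> \<zeta>2 x = 0"
      using C0(2)[OF \<Omega>(2,3) \<delta>] by blast
    have \<zeta>2: "controlled C \<delta> \<zeta>2" by (rule controlled_mono[OF z2(1) _ \<delta>]) (simp add: C_def)
    have nearK: "norm x < \<rho>" if "infdist x ?K \<le> 4 * \<delta>" for x
    proof -
      obtain y where y: "y \<in> ?K" "infdist x ?K = dist x y"
        using infdist_attains_inf[OF compact_imp_closed[OF \<Omega>(2)] \<Omega>(3)] by blast
      have "norm x \<le> norm y + dist x y" unfolding dist_norm by (rule norm_triangle_sub)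
      then show ?thesis using that y k0(2)[OF y(1)] \<delta>a(5) unfolding \<rho>_def by linarith
    qed
    interpret tr: truncation \<Omega> s r0 \<kappa> \<delta> \<rho> R B C E u \<psi> \<zeta>1 \<zeta>2
    proof unfold_locales
      show "s * \<delta> \<le> R" using \<delta>a(3) R(1) by linarith
      show "\<rho> > 0" using k0(1) by (simp add: \<rho>_def)
    qed (fact \<Omega> geo \<delta> \<delta>a R su u0 uB B \<psi> C \<zeta>1 \<zeta>2 z2 nearK geo(7)[OF \<delta> \<delta>'(1)] geo(8)[OF \<delta> \<delta>'(1)])+
    have grad_mn: "energy UNIV (\<lambda>x. grad (\<phi> n) x - grad (\<phi> m) x) \<le> ennreal \<epsilon>1"
      by (rule N1) (use m n in auto)
    have e: "energy T (grad u) \<le> ennreal (2 * \<epsilon>1)" if T: "T \<in> sets borel" "\<And>x h. x \<in> T \<Longrightarrow> mean \<delta> (pd (\<phi> m) h) x = 0" for T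
    proof -
      have "energy T (grad u) \<le> 2 * energy UNIV (\<lambda>x. grad (\<phi> n) x - grad (\<phi> m) x)"
        unfolding u_def by (rule energy_grad_mean_le[OF sn sm \<delta> T])
      also have "\<dots> \<le> 2 * ennreal \<epsilon>1" by (rule mult_left_mono[OF grad_mn]) simp
      finally show ?thesis using \<epsilon>1 by (simp add: ennreal_mult)
    qed
    \<comment> \<open>Here the fixed index \<open>m\<close> pays off: squares around points of
      \<open>N'\<close> miss the support of \<open>\<phi> m\<close>, so only the difference between
      \<open>\<phi> n\<close> and \<open>\<phi> m\<close> contributes to
      \<open>grad u\<close>.\<close>
    have eN': "energy tr.N' (grad u) \<le> ennreal (2 * \<epsilon>1)"
    proof (rule e[OF tr.borel_N(2)])
      fix x h assume x: "x \<in> tr.N'"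
      show "mean \<delta> (pd (\<phi> m) h) x = 0"
      proof (rule mean_eq_0[OF cpm \<delta>])
        fix y assume y: "dist x y < 2 * \<delta>"
        have "y \<notin> S"
        proof
          assume yS: "y \<in> S"
          obtain k where k: "k \<in> ?K" "infdist x ?K = dist x k"
            using infdist_attains_inf[OF compact_imp_closed[OF \<Omega>(2)] \<Omega>(3)] by blast
          have "d1 \<le> dist y k" by (rule d1(2)[OF yS k(1)])
          also have "\<dots> \<le> dist x y + dist x k" by (metis dist_commute dist_triangle)
          also have "\<dots> \<le> 2 * \<delta> + (4 + s) * \<delta>" using x y k(2) by (simp add: tr.N'_def)
          also have "\<dots> \<le> (7 + s) * \<delta>" using \<delta> by (simp add: algebra_simps)
          finally show False using \<delta>a(1) by linarith
        qed
        then show "pd (\<phi> m) h y = 0" by (rule S(4))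
      qed
    qed
    have eO: "energy tr.outer (grad u) \<le> ennreal (2 * \<epsilon>1)"
    proof (rule e[OF tr.borel_outer])
      fix x h assume x: "x \<in> tr.outer"
      show "mean \<delta> (pd (\<phi> m) h) x = 0"
      proof (rule mean_eq_0[OF cpm \<delta>])
        fix y assume y: "dist x y < 2 * \<delta>"
        have "norm x \<le> norm y + dist x y" unfolding dist_norm by (rule norm_triangle_sub)
        moreover have "R \<le> norm x" using x by (simp add: tr.outer_def)
        ultimately have "norm y > rm" using y R(4) \<delta>a(4) by linarith
        then show "pd (\<phi> m) h y = 0" by (intro S(4) rmS)
      qed
    qed
    let ?g = "curl tr.w"
    have sg: "smooth ?g" by (rule smooth_curl[OF tr.smooth_w])
    have j: "energy UNIV (\<lambda>x. pd ?g h x - pd (\<phi> m) h x) \<le> ennreal (4 * ((4 * K1 + 1) * \<epsilon>1 + \<epsilon>1 + \<epsilon>1 + 0))"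
      if h: "norm h = 1" and hj: "\<exists>j. h = axis j 1" and ma: "energy UNIV (\<lambda>x. mean \<delta> (pd (\<phi> m) h) x - pd (\<phi> m) h x) \<le> ennreal \<epsilon>1" for h
    proof -
      \<comment> \<open>Three differences: the truncation, the average of the derivative of
        \<open>\<phi> n - \<phi> m\<close>, and the effect of averaging on the fixed
        \<open>\<phi> m\<close>. The summand 0 fills the fourth slot of the splitting lemma.\<close>
      have eq: "(\<lambda>x. pd ?g h x - pd (\<phi> m) h x) = (\<lambda>x. ((pd ?g h x - pd u h x) + (mean \<delta> (pd (\<phi> n) h) x - mean \<delta> (pd (\<phi> m) h) x)) +
        ((mean \<delta> (pd (\<phi> m) h) x - pd (\<phi> m) h x) + 0))"
        by (rule ext) (simp add: u_def pd_mean[OF sn])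
      have cmean: "continuous_on UNIV (mean \<delta> (pd (\<phi> k) h))" for k
      proof -
        obtain S where "smooth (\<phi> k)" using solenoidal_test_fieldD[OF \<phi>] by metis
        then show ?thesis by (intro smooth_continuous_on smooth_mean smooth_pd)
      qed
      show ?thesis
        unfolding eq
      proof (rule energy_split4_le)
        have "energy UNIV (\<lambda>x. pd ?g h x - pd u h x) \<le> ennreal K1 * (energy tr.N' (grad u) + energy tr.outer (grad u)) + ennreal (128 * 264\<^sup>2 * C\<^sup>2 * (B / R)\<^sup>2)"
          unfolding K1_def by (rule tr.energy_pd_diff[OF h])
        also have "\<dots> \<le> ennreal K1 * (ennreal (2 * \<epsilon>1) + ennreal (2 * \<epsilon>1)) + ennreal \<epsilon>1"
        proof (intro add_mono mult_left_mono eN' eO ennreal_leI)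
          show "128 * 264\<^sup>2 * C\<^sup>2 * (B / R)\<^sup>2 \<le> \<epsilon>1" using K2R by (simp add: K2_def power_divide)
        qed auto
        also have "\<dots> = ennreal ((4 * K1 + 1) * \<epsilon>1)"
          using K \<epsilon>1 by (simp add: ennreal_plus[symmetric] ennreal_mult[symmetric] algebra_simps del: ennreal_plus)
        finally show "energy UNIV (\<lambda>x. pd ?g h x - pd u h x) \<le> ennreal ((4 * K1 + 1) * \<epsilon>1)" .
        have "energy UNIV (\<lambda>x. mean \<delta> (pd (\<phi> n) h) x - mean \<delta> (pd (\<phi> m) h) x) \<le> energy UNIV (\<lambda>x. pd (\<phi> n) h x - pd (\<phi> m) h x)"
          by (rule energy_mean_diff) (use \<delta> in \<open>auto intro: cpn cpm\<close>)
        also have "\<dots> \<le> energy UNIV (\<lambda>x. grad (\<phi> n) x - grad (\<phi> m) x)"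
          using hj energy_pd_diff_le_grad[OF sn sm] by auto
        also note grad_mn
        finally show "energy UNIV (\<lambda>x. mean \<delta> (pd (\<phi> n) h) x - mean \<delta> (pd (\<phi> m) h) x) \<le> ennreal \<epsilon>1" .
        show "energy UNIV (\<lambda>x. mean \<delta> (pd (\<phi> m) h) x - pd (\<phi> m) h x) \<le> ennreal \<epsilon>1" by (rule ma)
        show "energy UNIV (\<lambda>x. 0 :: real^2) \<le> ennreal 0" by (simp add: energy_eq_0)
      next
        show "(\<lambda>x. pd ?g h x - pd u h x) \<in> borel_measurable lebesgue"
          by (rule continuous_lebesgue[OF continuous_on_diff[OF smooth_continuous_on[OF smooth_pd[OF sg]]
                smooth_continuous_on[OF smooth_pd[OF su]]]])
        show "(\<lambda>x. mean \<delta> (pd (\<phi> n) h) x - mean \<delta> (pd (\<phi> m) h) x) \<in> borel_measurable lebesgue"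
          by (rule continuous_lebesgue[OF continuous_on_diff[OF cmean cmean]])
        show "(\<lambda>x. mean \<delta> (pd (\<phi> m) h) x - pd (\<phi> m) h x) \<in> borel_measurable lebesgue"
          by (rule continuous_lebesgue[OF continuous_on_diff[OF cmean cpm]])
      qed (use K \<epsilon>1 in auto)
    qed
    have G: "energy UNIV (\<lambda>x. grad ?g x - grad (\<phi> m) x) \<le> ennreal \<epsilon>"
    proof -
      have "energy UNIV (\<lambda>x. grad ?g x - grad (\<phi> m) x) =
          energy UNIV (\<lambda>x. pd ?g e1 x - pd (\<phi> m) e1 x) + energy UNIV (\<lambda>x. pd ?g e2 x - pd (\<phi> m) e2 x)"
        by (rule energy_grad[OF sg sm]) simp
      also have "\<dots> \<le> ennreal (4 * ((4 * K1 + 1) * \<epsilon>1 + \<epsilon>1 + \<epsilon>1 + 0)) + ennreal (4 * ((4 * K1 + 1) * \<epsilon>1 + \<epsilon>1 + \<epsilon>1 + 0))"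
        by (intro add_mono j d3 d4 \<delta> \<delta>') auto
      also have "\<dots> = ennreal ((32 * K1 + 24) * \<epsilon>1)"
        using K \<epsilon>1 by (subst ennreal_plus[symmetric]) (auto simp: algebra_simps)
      also have "\<dots> \<le> ennreal ((32 * K1 + 8 * K3 + 48) * \<epsilon>1)"
        using K \<epsilon>1 by (intro ennreal_leI mult_right_mono) auto
      finally show ?thesis unfolding \<epsilon>1' .
    qed
    have V: "energy (\<Omega> \<inter> ball 0 \<rho>') (\<lambda>x. ?g x - v x) \<le> ennreal \<epsilon>"
    proof -
      let ?T = "\<Omega> \<inter> ball 0 \<rho>'" and ?T' = "\<Omega> \<inter> ball 0 (\<rho>' + 1)"
      have Tm: "?T \<in> sets lebesgue" "?T' \<in> sets lebesgue" using \<Omega>(1) by (auto intro!: sets_completionI_sets borel_open)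
      have eq: "(\<lambda>x. ?g x - v x) = (\<lambda>x. ((?g x - u x) + (mean \<delta> (\<phi> n) x - mean \<delta> (\<phi> m) x)) + ((mean \<delta> (\<phi> m) x - \<phi> m x) + (\<phi> m x - v x)))"
        by (rule ext) (simp add: u_def)
      have "energy ?T (\<lambda>x. ?g x - v x) \<le> ennreal (4 * (2 * K3 * \<epsilon>1 + 4 * \<epsilon>1 + \<epsilon>1 + \<epsilon>1))"
        unfolding eq
      proof (rule energy_split4_le[OF _ _ _ _ Tm(1)])
        have "energy ?T (\<lambda>x. ?g x - u x) \<le> energy (ball 0 R) (\<lambda>x. ?g x - u x)"
          using R(3) by (intro energy_mono_set) auto
        also have "\<dots> \<le> ennreal (K3 * \<delta>\<^sup>2) * energy tr.N' (grad u)"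
          using tr.energy_diff_inner by (simp add: K3_def)
        also have "\<dots> \<le> ennreal K3 * ennreal (2 * \<epsilon>1)"
        proof (intro mult_mono ennreal_leI eN')
          have "\<delta>\<^sup>2 \<le> 1" using \<delta> \<delta>a(4) by (intro power_le_one) auto
          then show "K3 * \<delta>\<^sup>2 \<le> K3" using K by (simp add: mult_left_le)
        qed auto
        also have "\<dots> = ennreal (2 * K3 * \<epsilon>1)" using K \<epsilon>1 by (simp add: ennreal_mult[symmetric] mult_ac)
        finally show "energy ?T (\<lambda>x. ?g x - u x) \<le> ennreal (2 * K3 * \<epsilon>1)" .
        have "energy ?T (\<lambda>x. mean \<delta> (\<phi> n) x - mean \<delta> (\<phi> m) x) \<le> energy (ball 0 \<rho>') (\<lambda>x. mean \<delta> (\<phi> n) x - mean \<delta> (\<phi> m) x)"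
          by (intro energy_mono_set) auto
        also have "\<dots> \<le> energy (ball 0 (\<rho>' + 1)) (\<lambda>x. \<phi> n x - \<phi> m x)"
        proof (rule energy_mean_diff[OF cn cm \<delta>])
          fix x y :: "real^2" assume "x \<in> ball 0 \<rho>'" "norm y < 2 * \<delta>"
          then show "x + y \<in> ball 0 (\<rho>' + 1)" using \<delta>a(4) norm_triangle_ineq[of x y] by simp
        qed auto
        also have "\<dots> \<le> energy ?T' (\<lambda>x. \<phi> n x - \<phi> m x)"
          by (rule energy_UNIV_le) (simp add: n0 m0)
        \<comment> \<open>The distance of the two fields is measured through \<open>v\<close>, using
          local convergence rather than the Dirichlet norm.\<close>
        also have "(\<lambda>x. \<phi> n x - \<phi> m x) = (\<lambda>x. (\<phi> n x - v x) + - (\<phi> m x - v x))" by auto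
        also have "energy ?T' \<dots> \<le> 2 * (energy ?T' (\<lambda>x. \<phi> n x - v x) + energy ?T' (\<lambda>x. - (\<phi> m x - v x)))"
          by (rule energy_add_le[OF _ _ Tm(2)]) (intro borel_measurable_uminus borel_measurable_diff continuous_lebesgue cn cm v(1))+
        also have "energy ?T' (\<lambda>x. - (\<phi> m x - v x)) = energy ?T' (\<lambda>x. \<phi> m x - v x)"
          by (rule energy_cong) (simp only: norm_minus_cancel)
        also have "2 * (energy ?T' (\<lambda>x. \<phi> n x - v x) + energy ?T' (\<lambda>x. \<phi> m x - v x)) \<le> 2 * (ennreal \<epsilon>1 + ennreal \<epsilon>1)"
          by (intro mult_left_mono add_mono N2 m n) simp
        also have "\<dots> = ennreal (4 * \<epsilon>1)" using \<epsilon>1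
          by (simp add: ennreal_mult mult_2[symmetric])
        finally show "energy ?T (\<lambda>x. mean \<delta> (\<phi> n) x - mean \<delta> (\<phi> m) x) \<le> ennreal (4 * \<epsilon>1)" .
        have "energy ?T (\<lambda>x. mean \<delta> (\<phi> m) x - \<phi> m x) \<le> energy UNIV (\<lambda>x. mean \<delta> (\<phi> m) x - \<phi> m x)"
          by (rule energy_mono_set) simp
        also have "\<dots> \<le> ennreal \<epsilon>1" by (rule d2(2)[OF \<delta> \<delta>'(6)])
        finally show "energy ?T (\<lambda>x. mean \<delta> (\<phi> m) x - \<phi> m x) \<le> ennreal \<epsilon>1" .
        have "energy ?T (\<lambda>x. \<phi> m x - v x) \<le> energy ?T' (\<lambda>x. \<phi> m x - v x)"
          by (rule energy_mono_set) auto
        also have "\<dots> \<le> ennreal \<epsilon>1" by (rule N2[OF m(3)])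
        finally show "energy ?T (\<lambda>x. \<phi> m x - v x) \<le> ennreal \<epsilon>1" .
      next
        have mm: "mean \<delta> (\<phi> n) \<in> borel_measurable lebesgue" "mean \<delta> (\<phi> m) \<in> borel_measurable lebesgue"
          by (intro continuous_lebesgue smooth_continuous_on smooth_mean sn sm)+
        show "(\<lambda>x. ?g x - u x) \<in> borel_measurable lebesgue"
          by (intro borel_measurable_diff continuous_lebesgue smooth_continuous_on sg su)
        show "(\<lambda>x. mean \<delta> (\<phi> n) x - mean \<delta> (\<phi> m) x) \<in> borel_measurable lebesgue"
          by (intro borel_measurable_diff mm)
        show "(\<lambda>x. mean \<delta> (\<phi> m) x - \<phi> m x) \<in> borel_measurable lebesgue"
          by (intro borel_measurable_diff mm continuous_lebesgue cm)
        show "(\<lambda>x. \<phi> m x - v x) \<in> borel_measurable lebesgue"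
          by (intro borel_measurable_diff continuous_lebesgue cm v(1))
      qed (use K \<epsilon>1 in auto)
      also have "\<dots> \<le> ennreal ((32 * K1 + 8 * K3 + 48) * \<epsilon>1)"
        using K \<epsilon>1 by (intro ennreal_leI) (simp add: algebra_simps)
      finally show ?thesis unfolding \<epsilon>1' .
    qed
    show "\<exists>m\<ge>M0. \<exists>g. g \<in> solenoidal_test_fields \<Omega> \<and>
      (\<forall>x. (norm x + 1) * norm (g x) \<le> C1) \<and>
      energy UNIV (\<lambda>x. grad g x - grad (\<phi> m) x) \<le> ennreal \<epsilon> \<and>
      energy (\<Omega> \<inter> ball 0 \<rho>') (\<lambda>x. g x - v x) \<le> ennreal \<epsilon>"
      using m(1) tr.curl_w_test tr.weighted_bound G V unfolding C1_def by blast
  qed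
qed

section \<open>Convergence in \<open>L\<^sup>2\<close>\<close>

lemma nn_integral_lebesgue_on:
  assumes "\<Omega> \<in> sets lebesgue"
  shows "(\<integral>\<^sup>+x. ennreal ((norm (f x))\<^sup>2) \<partial>lebesgue_on \<Omega>) = energy \<Omega> f"
  unfolding energy_def using assms by (subst nn_integral_restrict_space) auto

lemma L2_space_iff:
  assumes "\<Omega> \<in> sets lebesgue" "f \<in> borel_measurable (lebesgue_on \<Omega>)"
  shows "f \<in> L2_space (lebesgue_on \<Omega>) \<longleftrightarrow> energy \<Omega> f < \<infinity>"
proof -
  have m: "(\<lambda>x. (norm (f x))\<^sup>2) \<in> borel_measurable (lebesgue_on \<Omega>)"
    using assms(2) by measurable
  show ?thesis
    using assms(2) m by (simp add: L2_space_def integrable_iff_bounded nn_integral_lebesgue_on[OF assms(1), symmetric])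
qed

lemma L2_norm_energy:
  assumes "\<Omega> \<in> sets lebesgue" "f \<in> borel_measurable (lebesgue_on \<Omega>)"
  shows "(L2_norm (lebesgue_on \<Omega>) f)\<^sup>2 = enn2real (energy \<Omega> f)"
proof -
  have m: "(\<lambda>x. (norm (f x))\<^sup>2) \<in> borel_measurable (lebesgue_on \<Omega>)"
    using assms(2) by measurable
  have "(LINT x|lebesgue_on \<Omega>. (norm (f x))\<^sup>2) = enn2real (energy \<Omega> f)"
    unfolding nn_integral_lebesgue_on[OF assms(1), symmetric] by (rule integral_eq_nn_integral[OF m]) simp
  then show ?thesis by (simp add: L2_norm_def)
qed

text \<open>Measurability is only given on \<open>S\<close>, so both functions are set to 0 outside
  before the general inequality is applied.\<close>

lemma energy_add_le_on:
  fixes f g :: "real^2 \<Rightarrow> 'b::euclidean_space"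
  assumes "f \<in> borel_measurable (lebesgue_on S)" "g \<in> borel_measurable (lebesgue_on S)" "S \<in> sets lebesgue"
  shows "energy S (\<lambda>x. f x - g x) \<le> 2 * (energy S f + energy S g)"
proof -
  let ?f = "\<lambda>x. if x \<in> S then f x else 0" and ?g = "\<lambda>x. if x \<in> S then - g x else 0"
  have m: "?f \<in> borel_measurable lebesgue" "?g \<in> borel_measurable lebesgue"
    using assms by (auto simp: borel_measurable_if)
  have "energy S (\<lambda>x. f x - g x) = energy S (\<lambda>x. ?f x + ?g x)" by (rule energy_cong) simp
  also have "\<dots> \<le> 2 * (energy S ?f + energy S ?g)" by (rule energy_add_le[OF m assms(3)])
  also have "energy S ?f = energy S f" by (rule energy_cong) simp
  also have "energy S ?g = energy S g" by (rule energy_cong) simp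
  finally show ?thesis .
qed

lemma energy_diff_finite:
  fixes f g :: "real^2 \<Rightarrow> 'b::euclidean_space"
  assumes "f \<in> L2_space (lebesgue_on S)" "g \<in> L2_space (lebesgue_on S)" "S \<in> sets lebesgue"
  shows "energy S (\<lambda>x. f x - g x) < \<infinity>"
proof -
  have m: "f \<in> borel_measurable (lebesgue_on S)" "g \<in> borel_measurable (lebesgue_on S)"
    using assms by (auto simp: L2_space_def)
  have "energy S f < \<infinity>" "energy S g < \<infinity>" using assms m L2_space_iff by blast+
  then have "2 * (energy S f + energy S g) < \<infinity>" by (simp add: ennreal_mult_less_top)
  then show ?thesis using energy_add_le_on[OF m assms(3)] by (rule le_less_trans[rotated])
qed

lemma energy_le_of_L2_norm:
  assumes "S \<in> sets lebesgue" "f \<in> borel_measurable (lebesgue_on S)" "energy S f < \<infinity>"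
    "L2_norm (lebesgue_on S) f \<le> e"
  shows "energy S f \<le> ennreal (e\<^sup>2)"
proof -
  have "energy S f = ennreal (enn2real (energy S f))" using assms(3) by simp
  also have "\<dots> = ennreal ((L2_norm (lebesgue_on S) f)\<^sup>2)" by (simp add: L2_norm_energy[OF assms(1,2)])
  also have "\<dots> \<le> ennreal (e\<^sup>2)"
    by (intro ennreal_leI power_mono assms(4)) (simp add: L2_norm_def)
  finally show ?thesis .
qed

lemma L2_space_measurable: "f \<in> L2_space M \<Longrightarrow> f \<in> borel_measurable M"
  by (simp add: L2_space_def)

lemma L2_tendsto_energy:
  fixes f :: "nat \<Rightarrow> real^2 \<Rightarrow> 'b::euclidean_space"
  assumes "L2_tendsto (lebesgue_on S) f g" "S \<in> sets lebesgue" "\<epsilon> > 0"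
  shows "\<exists>N. \<forall>n\<ge>N. energy S (\<lambda>x. f n x - g x) \<le> ennreal \<epsilon>"
proof -
  have l: "\<And>n. f n \<in> L2_space (lebesgue_on S)" "g \<in> L2_space (lebesgue_on S)"
    and t: "(\<lambda>n. L2_norm (lebesgue_on S) (\<lambda>x. f n x - g x)) \<longlonglongrightarrow> 0"
    using assms(1) by (auto simp: L2_tendsto_def)
  have m: "(\<lambda>x. f n x - g x) \<in> borel_measurable (lebesgue_on S)" for n
    by (intro borel_measurable_diff L2_space_measurable l)
  obtain N where N: "\<And>n. n \<ge> N \<Longrightarrow> norm (L2_norm (lebesgue_on S) (\<lambda>x. f n x - g x) - 0) < sqrt \<epsilon>"
    using LIMSEQ_D[OF t, of "sqrt \<epsilon>"] assms(3) by auto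
  have "energy S (\<lambda>x. f n x - g x) \<le> ennreal ((sqrt \<epsilon>)\<^sup>2)" if "n \<ge> N" for n
    by (rule energy_le_of_L2_norm[OF assms(2) m energy_diff_finite[OF l(1) l(2) assms(2)]])
      (use N[OF that] in simp)
  then show ?thesis using assms(3) by auto
qed

lemma L2_tendstoI_energy:
  fixes f :: "nat \<Rightarrow> real^2 \<Rightarrow> 'b::euclidean_space"
  assumes S: "S \<in> sets lebesgue" and f: "\<And>n. f n \<in> L2_space (lebesgue_on S)" and g: "g \<in> L2_space (lebesgue_on S)"
    and t: "\<And>\<epsilon>. \<epsilon> > 0 \<Longrightarrow> \<exists>N. \<forall>n\<ge>N. energy S (\<lambda>x. f n x - g x) \<le> ennreal \<epsilon>"
  shows "L2_tendsto (lebesgue_on S) f g"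
  unfolding L2_tendsto_def
proof (intro conjI allI f g LIMSEQ_I)
  fix r :: real assume r: "r > 0"
  have m: "(\<lambda>x. f n x - g x) \<in> borel_measurable (lebesgue_on S)" for n
    by (intro borel_measurable_diff L2_space_measurable f g)
  obtain N where N: "\<And>n. n \<ge> N \<Longrightarrow> energy S (\<lambda>x. f n x - g x) \<le> ennreal ((r / 2)\<^sup>2)"
    using t[of "(r / 2)\<^sup>2"] r by auto
  have "norm (L2_norm (lebesgue_on S) (\<lambda>x. f n x - g x) - 0) < r" if "n \<ge> N" for n
  proof -
    have "(L2_norm (lebesgue_on S) (\<lambda>x. f n x - g x))\<^sup>2 \<le> (r / 2)\<^sup>2"
      unfolding L2_norm_energy[OF S m] using N[OF that] by (intro enn2real_leI) auto
    then have "\<bar>L2_norm (lebesgue_on S) (\<lambda>x. f n x - g x)\<bar> \<le> r / 2"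
      using r by (simp add: abs_le_square_iff[symmetric])
    then show ?thesis using r by simp
  qed
  then show "\<exists>no. \<forall>n\<ge>no. norm (L2_norm (lebesgue_on S) (\<lambda>x. f n x - g x) - 0) < r" by blast
qed

text \<open>Energies of size \<open>(1/4) ^ k\<close> remain summable after weighting by
  \<open>2 ^ k\<close>, so the series of \<open>2 ^ k * (norm (d k x))\<^sup>2\<close> is finite
  almost everywhere on \<open>S\<close>, and its sum bounds each term. The result is a geometric
  rate, hence summability as well as convergence to 0.\<close>

lemma AE_tendsto_of_energy:
  fixes d :: "nat \<Rightarrow> 'a::euclidean_space \<Rightarrow> 'b::euclidean_space"
  assumes m: "\<And>k. d k \<in> borel_measurable lebesgue" and S: "S \<in> sets lebesgue"
    and le: "\<And>k. k \<ge> k0 \<Longrightarrow> energy S (d k) \<le> ennreal ((1/4) ^ k)"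
  shows "AE x in lebesgue. x \<in> S \<longrightarrow> (\<exists>C. \<forall>k. norm (d k x) \<le> C * (sqrt (1/2)) ^ k)"
proof -
  let ?g = "\<lambda>k x. ennreal ((norm (d (k + k0) x))\<^sup>2) * indicator S x"
  let ?h = "\<lambda>k x. ennreal (2 ^ (k + k0)) * ?g k x"
  have gm: "?g k \<in> borel_measurable lebesgue" for k by (rule energy_integrand_measurable[OF m S])
  have "(\<integral>\<^sup>+x. (\<Sum>k. ?h k x) \<partial>lebesgue) = (\<Sum>k. \<integral>\<^sup>+x. ?h k x \<partial>lebesgue)"
    by (rule nn_integral_suminf) (intro borel_measurable_times_ennreal borel_measurable_const gm)
  also have "\<dots> = (\<Sum>k. ennreal (2 ^ (k + k0)) * energy S (d (k + k0)))"
    unfolding energy_def by (intro suminf_cong nn_integral_cmult gm)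
  also have "\<dots> \<le> (\<Sum>k. ennreal ((1/2) ^ k))"
  proof (rule suminf_le)
    fix k
    have "ennreal (2 ^ (k + k0)) * energy S (d (k + k0)) \<le> ennreal (2 ^ (k + k0)) * ennreal ((1/4) ^ (k + k0))"
      by (intro mult_left_mono le) auto
    also have "\<dots> = ennreal ((1/2) ^ (k + k0))"
      by (simp add: ennreal_mult[symmetric] power_mult_distrib[symmetric] del: power_add)
    also have "\<dots> \<le> ennreal ((1/2) ^ k)" by (intro ennreal_leI power_decreasing) auto
    finally show "ennreal (2 ^ (k + k0)) * energy S (d (k + k0)) \<le> ennreal ((1/2) ^ k)" .
  qed auto
  also have "\<dots> = ennreal (\<Sum>k. (1/2) ^ k)"
    by (rule suminf_ennreal2) (auto intro: summable_geometric)
  also have "\<dots> < \<infinity>" by simp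
  finally have "AE x in lebesgue. (\<Sum>k. ?h k x) \<noteq> \<infinity>"
    by (intro nn_integral_noteq_infinite)
      (auto intro!: borel_measurable_suminf_order borel_measurable_times_ennreal gm)
  then show ?thesis
  proof eventually_elim
    case (elim x)
    show ?case
    proof
      assume x: "x \<in> S"
      define T where "T = enn2real (\<Sum>k. ?h k x)"
      have T: "(\<Sum>k. ?h k x) = ennreal T" using elim by (simp add: T_def less_top)
      have T0: "T \<ge> 0" by (simp add: T_def)
      have b: "norm (d (k + k0) x) \<le> sqrt T * (sqrt (1/2)) ^ (k + k0)" for k
      proof -
        have "?h k x \<le> (\<Sum>k. ?h k x)"
          using sum_le_suminf[of "\<lambda>k. ?h k x" "{k}"] by simp
        then have "ennreal (2 ^ (k + k0) * (norm (d (k + k0) x))\<^sup>2) \<le> ennreal T"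
          unfolding T using x by (simp add: ennreal_mult)
        then have "2 ^ (k + k0) * (norm (d (k + k0) x))\<^sup>2 \<le> T" using T0 by (simp add: ennreal_le_iff)
        then have "(norm (d (k + k0) x))\<^sup>2 \<le> T * (1/2) ^ (k + k0)"
          by (simp add: field_simps power_one_over)
        then have "sqrt ((norm (d (k + k0) x))\<^sup>2) \<le> sqrt (T * (1/2) ^ (k + k0))" by (rule real_sqrt_le_mono)
        then show ?thesis by (simp add: real_sqrt_mult real_sqrt_power)
      qed
      \<comment> \<open>The finitely many indices below \<open>k0\<close>, for which no energy bound
        is assumed, are absorbed into the constant.\<close>
      define C where "C = sqrt T + (\<Sum>j<k0. norm (d j x) / (sqrt (1/2)) ^ j)"
      have "norm (d k x) \<le> C * (sqrt (1/2)) ^ k" for k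
      proof (cases "k < k0")
        case True
        have "norm (d k x) / (sqrt (1/2)) ^ k \<le> (\<Sum>j<k0. norm (d j x) / (sqrt (1/2)) ^ j)"
          by (rule member_le_sum) (use True in auto)
        also have "\<dots> \<le> C" using T0 by (simp add: C_def)
        finally show ?thesis by (simp add: pos_divide_le_eq)
      next
        case False
        have "sqrt T \<le> C" by (simp add: C_def sum_nonneg)
        then have "sqrt T * (sqrt (1/2)) ^ k \<le> C * (sqrt (1/2)) ^ k" by (intro mult_right_mono) auto
        moreover have "norm (d k x) \<le> sqrt T * (sqrt (1/2)) ^ k" using b[of "k - k0"] False by simp
        ultimately show ?thesis by (rule order_trans[rotated])
      qed
      then show "\<exists>C. \<forall>k. norm (d k x) \<le> C * (sqrt (1/2)) ^ k" by blast
    qed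
  qed
qed

lemma geometric_sqrt_half: "summable (\<lambda>k. C * (sqrt (1/2)) ^ k)" "(\<lambda>k. C * (sqrt (1/2)) ^ k) \<longlonglongrightarrow> 0"
proof -
  have "norm (sqrt (1/2)) < 1" by simp
  then show "summable (\<lambda>k. C * (sqrt (1/2)) ^ k)" "(\<lambda>k. C * (sqrt (1/2)) ^ k) \<longlonglongrightarrow> 0"
    by (auto intro!: summable_mult summable_geometric tendsto_mult_right_zero LIMSEQ_power_zero)
qed

text \<open>Riesz-Fischer: along indices with geometrically small energies the increments are
  summable almost everywhere, which gives \<open>G\<close>; Fatou's lemma then transfers the Cauchy
  estimate to the limit.\<close>

lemma energy_complete:
  fixes f :: "nat \<Rightarrow> 'a::euclidean_space \<Rightarrow> 'b::euclidean_space"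
  assumes m: "\<And>k. f k \<in> borel_measurable lebesgue" and S: "S \<in> sets lebesgue"
    and cauchy: "\<And>\<epsilon>::real. \<epsilon> > 0 \<Longrightarrow> \<exists>N. \<forall>m\<ge>N. \<forall>n\<ge>N. energy S (\<lambda>x. f m x - f n x) \<le> ennreal \<epsilon>"
  obtains G where "G \<in> borel_measurable lebesgue"
    "\<And>\<epsilon>::real. \<epsilon> > 0 \<Longrightarrow> \<exists>N. \<forall>n\<ge>N. energy S (\<lambda>x. f n x - G x) \<le> ennreal \<epsilon>"
proof -
  have "\<exists>N. \<forall>m\<ge>N. \<forall>n\<ge>N. energy S (\<lambda>x. f m x - f n x) \<le> ennreal ((1/4) ^ k)" for k
    using cauchy[of "(1/4) ^ k"] by simp
  then obtain M where M: "\<And>k m n. m \<ge> M k \<Longrightarrow> n \<ge> M k \<Longrightarrow> energy S (\<lambda>x. f m x - f n x) \<le> ennreal ((1/4) ^ k)"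
    by metis
  \<comment> \<open>The sum dominates each \<open>M j\<close> with \<open>j \<le> k\<close>, so
    \<open>r k\<close> and \<open>r (Suc k)\<close> are both past \<open>M k\<close>; the summand
    \<open>k\<close> sends the indices to infinity.\<close>
  define r where "r k = (\<Sum>j\<le>k. M j) + k" for k
  have rM: "r k \<ge> M k" "r (Suc k) \<ge> M k" "r k \<ge> k" for k
    using member_le_sum[of k "{..k}" M] by (auto simp: r_def)
  define d where "d k x = f (r (Suc k)) x - f (r k) x" for k x
  have dm: "d k \<in> borel_measurable lebesgue" for k unfolding d_def[abs_def] by (intro borel_measurable_diff m)
  have ae: "AE x in lebesgue. x \<in> S \<longrightarrow> (\<exists>C. \<forall>k. norm (d k x) \<le> C * (sqrt (1/2)) ^ k)"
    by (rule AE_tendsto_of_energy[OF dm S, of 0]) (unfold d_def, rule M[OF rM(2,1)])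
  \<comment> \<open>Where the sequence diverges, \<open>lim\<close> is an unspecified value; such
    points of \<open>S\<close> form a null set.\<close>
  define G where "G x = lim (\<lambda>k. f (r k) x)" for x
  have conv: "AE x in lebesgue. x \<in> S \<longrightarrow> (\<lambda>k. f (r k) x) \<longlonglongrightarrow> G x"
    using ae
  proof eventually_elim
    case (elim x)
    show ?case
    proof
      assume "x \<in> S"
      then obtain C where C: "\<And>k. norm (d k x) \<le> C * (sqrt (1/2)) ^ k" using elim by blast
      have "summable (\<lambda>k. d k x)" by (rule summable_comparison_test'[OF geometric_sqrt_half(1) C])
      then have "(\<lambda>n. \<Sum>k<n. d k x) \<longlonglongrightarrow> (\<Sum>k. d k x)" by (rule summable_LIMSEQ)
      moreover have "(\<Sum>k<n. d k x) = f (r n) x - f (r 0) x" for n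
        unfolding d_def by (rule sum_lessThan_telescope)
      ultimately have "(\<lambda>n. f (r n) x - f (r 0) x + f (r 0) x) \<longlonglongrightarrow> (\<Sum>k. d k x) + f (r 0) x"
        by (intro tendsto_add tendsto_const) simp
      then have "convergent (\<lambda>n. f (r n) x)" by (auto simp: convergent_def)
      then show "(\<lambda>k. f (r k) x) \<longlonglongrightarrow> G x" unfolding G_def by (simp add: convergent_LIMSEQ_iff)
    qed
  qed
  show thesis
  proof
    show Gm: "G \<in> borel_measurable lebesgue"
      unfolding G_def[abs_def] by (rule borel_measurable_lim_metric[OF m])
    fix \<epsilon> :: real assume \<epsilon>: "\<epsilon> > 0"
    obtain N where N: "\<And>m n. m \<ge> N \<Longrightarrow> n \<ge> N \<Longrightarrow> energy S (\<lambda>x. f m x - f n x) \<le> ennreal \<epsilon>"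
      using cauchy[OF \<epsilon>] by blast
    have "energy S (\<lambda>x. f n x - G x) \<le> ennreal \<epsilon>" if n: "n \<ge> N" for n
    proof -
      let ?h = "\<lambda>k x. ennreal ((norm (f n x - f (r k) x))\<^sup>2) * indicator S x"
      have hm: "?h k \<in> borel_measurable lebesgue" for k
        by (rule energy_integrand_measurable[OF borel_measurable_diff[OF m m] S])
      have "energy S (\<lambda>x. f n x - G x) \<le> (\<integral>\<^sup>+x. liminf (\<lambda>k. ?h k x) \<partial>lebesgue)"
        unfolding energy_def
      proof (rule nn_integral_mono_AE)
        show "AE x in lebesgue. ennreal ((norm (f n x - G x))\<^sup>2) * indicator S x \<le> liminf (\<lambda>k. ?h k x)"
          using conv
        proof eventually_elim
          case (elim x)
          show ?case
          proof (cases "x \<in> S")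
            case True
            with elim have t: "(\<lambda>k. f (r k) x) \<longlonglongrightarrow> G x" by blast
            have "(\<lambda>k. ennreal ((norm (f n x - f (r k) x))\<^sup>2)) \<longlonglongrightarrow> ennreal ((norm (f n x - G x))\<^sup>2)"
              by (intro tendsto_ennrealI tendsto_power tendsto_norm tendsto_diff tendsto_const t)
            then have "(\<lambda>k. ?h k x) \<longlonglongrightarrow> ennreal ((norm (f n x - G x))\<^sup>2) * indicator S x" using True by simp
            then show ?thesis by (simp add: lim_imp_Liminf)
          qed simp
        qed
      qed
      also have "\<dots> \<le> liminf (\<lambda>k. \<integral>\<^sup>+x. ?h k x \<partial>lebesgue)" by (rule nn_integral_liminf[OF hm])
      also have "\<dots> \<le> ennreal \<epsilon>"
      proof (rule Liminf_le)
        show "\<forall>\<^sub>F k in sequentially. (\<integral>\<^sup>+x. ?h k x \<partial>lebesgue) \<le> ennreal \<epsilon>"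
        proof (rule eventually_sequentiallyI[of N])
          fix k assume "k \<ge> N"
          then have "r k \<ge> N" using rM(3)[of k] by linarith
          from N[OF n this] show "(\<integral>\<^sup>+x. ?h k x \<partial>lebesgue) \<le> ennreal \<epsilon>" by (simp add: energy_def)
        qed
      qed simp
      finally show ?thesis .
    qed
    then show "\<exists>N. \<forall>n\<ge>N. energy S (\<lambda>x. f n x - G x) \<le> ennreal \<epsilon>" by blast
  qed
qed

section \<open>The weak gradient as an \<open>L\<^sup>2\<close> limit\<close>

text \<open>The inequality \<open>t \<le> \<eta> + t\<^sup>2 / \<eta>\<close> replaces
  Cauchy-Schwarz: no square roots of \<open>ennreal\<close> values arise, and \<open>\<eta>\<close>
  can be balanced later.\<close>

lemma energy_L1:
  assumes f: "f \<in> borel_measurable lebesgue" and B: "B \<in> sets lebesgue" and \<eta>: "\<eta> > 0"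
  shows "(\<integral>\<^sup>+x. ennreal (norm (f x)) * indicator B x \<partial>lebesgue) \<le>
    ennreal \<eta> * emeasure lebesgue B + ennreal (1 / \<eta>) * energy B f"
proof -
  note em = energy_integrand_measurable[OF f B]
  have "(\<integral>\<^sup>+x. ennreal (norm (f x)) * indicator B x \<partial>lebesgue) \<le>
    (\<integral>\<^sup>+x. ennreal \<eta> * indicator B x + ennreal (1 / \<eta>) * (ennreal ((norm (f x))\<^sup>2) * indicator B x) \<partial>lebesgue)"
  proof (rule nn_integral_mono)
    fix x
    have 2: "norm (f x) \<le> \<eta> + 1 / \<eta> * (norm (f x))\<^sup>2"
    proof (cases "norm (f x) \<le> \<eta>")
      case False
      then have "norm (f x) * \<eta> \<le> norm (f x) * norm (f x)" by (intro mult_left_mono) auto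
      then show ?thesis using \<eta> by (simp add: field_simps power2_eq_square add_increasing)
    qed (use \<eta> in \<open>simp add: add_increasing2\<close>)
    then have "ennreal (norm (f x)) \<le> ennreal (\<eta> + 1 / \<eta> * (norm (f x))\<^sup>2)" by (rule ennreal_leI)
    also have "\<dots> = ennreal \<eta> + ennreal (1 / \<eta>) * ennreal ((norm (f x))\<^sup>2)"
      using \<eta> by (simp add: ennreal_mult'[symmetric])
    finally show "ennreal (norm (f x)) * indicator B x \<le>
      ennreal \<eta> * indicator B x + ennreal (1 / \<eta>) * (ennreal ((norm (f x))\<^sup>2) * indicator B x)"
      by (simp add: indicator_def)
  qed
  also have "\<dots> = (\<integral>\<^sup>+x. ennreal \<eta> * indicator B x \<partial>lebesgue) +
      (\<integral>\<^sup>+x. ennreal (1 / \<eta>) * (ennreal ((norm (f x))\<^sup>2) * indicator B x) \<partial>lebesgue)"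
    by (intro nn_integral_add borel_measurable_times_ennreal borel_measurable_const em borel_measurable_indicator B)
  also have "\<dots> = ennreal \<eta> * emeasure lebesgue B + ennreal (1 / \<eta>) * energy B f"
    unfolding energy_def using B by (subst nn_integral_cmult[OF em]) (simp add: nn_integral_cmult_indicator)
  finally show ?thesis .
qed

lemma compact_emeasure_finite: "compact (B :: 'a::euclidean_space set) \<Longrightarrow> emeasure lebesgue B < \<infinity>"
  using lmeasurable_compact[of B] unfolding fmeasurable_def by blast

lemma energy_integrable:
  fixes f :: "'a::euclidean_space \<Rightarrow> real"
  assumes f: "f \<in> borel_measurable lebesgue" and B: "compact B" and fin: "energy B f < \<infinity>"
    and \<chi>: "continuous_on UNIV \<xi>" "\<And>x. x \<notin> B \<Longrightarrow> \<xi> x = 0" "\<And>x. \<bar>\<xi> x\<bar> \<le> M"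
  shows "integrable lebesgue (\<lambda>x. f x * \<xi> x)"
proof (rule integrableI_bounded)
  have Bm: "B \<in> sets lebesgue" using B by (intro sets_completionI_sets) (simp add: compact_imp_closed)
  show "(\<lambda>x. f x * \<xi> x) \<in> borel_measurable lebesgue"
    by (intro borel_measurable_times f continuous_lebesgue \<chi>(1))
  have "(\<integral>\<^sup>+x. ennreal (norm (f x * \<xi> x)) \<partial>lebesgue) \<le> (\<integral>\<^sup>+x. ennreal M * (ennreal (norm (f x)) * indicator B x) \<partial>lebesgue)"
  proof (rule nn_integral_mono)
    fix x
    have "\<bar>\<xi> x\<bar> * \<bar>f x\<bar> \<le> M * \<bar>f x\<bar>" by (intro mult_right_mono \<chi>(3)) simp
    moreover have "M \<ge> 0" using \<chi>(3)[of x] by linarith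
    ultimately show "ennreal (norm (f x * \<xi> x)) \<le> ennreal M * (ennreal (norm (f x)) * indicator B x)"
      using \<chi>(2)[of x] by (cases "x \<in> B") (auto simp: abs_mult ennreal_mult'[symmetric] mult.commute intro: ennreal_leI)
  qed
  also have "\<dots> = ennreal M * (\<integral>\<^sup>+x. ennreal (norm (f x)) * indicator B x \<partial>lebesgue)"
    by (intro nn_integral_cmult borel_measurable_times_ennreal borel_measurable_indicator Bm
        measurable_compose[OF _ measurable_ennreal] measurable_compose[OF f borel_measurable_norm])
  also have "\<dots> \<le> ennreal M * (ennreal 1 * emeasure lebesgue B + ennreal (1 / 1) * energy B f)"
    by (intro mult_left_mono energy_L1 f Bm) auto
  also have "\<dots> < \<infinity>" using fin compact_emeasure_finite[OF B] by (simp add: ennreal_mult_less_top)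
  finally show "(\<integral>\<^sup>+x. ennreal (norm (f x * \<xi> x)) \<partial>lebesgue) < \<infinity>" .
qed

text \<open>The difference of the integrals is at most \<open>sup \<bar>\<xi>\<bar>\<close> times an
  \<open>L\<^sup>1\<close> norm on \<open>B\<close>, which the energy controls because
  \<open>B\<close> has finite measure.\<close>

lemma energy_weak_limit:
  fixes f :: "nat \<Rightarrow> 'a::euclidean_space \<Rightarrow> real"
  assumes m: "\<And>n. f n \<in> borel_measurable lebesgue" "g \<in> borel_measurable lebesgue" and B: "compact B"
    and fin: "\<And>n. energy B (f n) < \<infinity>" "energy B g < \<infinity>"
    and lim: "\<And>\<epsilon>::real. \<epsilon> > 0 \<Longrightarrow> \<exists>N. \<forall>n\<ge>N. energy B (\<lambda>x. f n x - g x) \<le> ennreal \<epsilon>"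
    and \<chi>: "continuous_on UNIV \<xi>" "\<And>x. x \<notin> B \<Longrightarrow> \<xi> x = 0"
  shows "(\<lambda>n. LINT x|lebesgue. f n x * \<xi> x) \<longlonglongrightarrow> (LINT x|lebesgue. g x * \<xi> x)"
proof -
  have Bm: "B \<in> sets lebesgue" using B by (intro sets_completionI_sets) (simp add: compact_imp_closed)
  have "bounded (\<xi> ` B)"
    by (intro compact_imp_bounded compact_continuous_image continuous_on_subset[OF \<chi>(1)] B) simp
  then obtain M where M: "M > 0" "\<And>x. x \<in> B \<Longrightarrow> \<bar>\<xi> x\<bar> \<le> M" by (auto simp: bounded_pos)
  have \<chi>M: "\<bar>\<xi> x\<bar> \<le> M" for x using M \<chi>(2)[of x] by (cases "x \<in> B") auto
  have vol: "emeasure lebesgue B = ennreal (measure lebesgue B)"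
    using compact_emeasure_finite[OF B] by (intro emeasure_eq_ennreal_measure) auto
  define V where "V = measure lebesgue B + 1"
  have V: "V > 0" by (simp add: V_def add_nonneg_pos)
  show ?thesis
  proof (rule LIMSEQ_I)
    fix r :: real assume r: "r > 0"
    \<comment> \<open>With this choice the measure term and the energy term each contribute
      \<open>r / 4\<close>.\<close>
    define \<eta> where "\<eta> = r / (4 * M * V)"
    have \<eta>: "\<eta> > 0" using r M V by (simp add: \<eta>_def)
    obtain N where N: "\<And>n. n \<ge> N \<Longrightarrow> energy B (\<lambda>x. f n x - g x) \<le> ennreal (\<eta> * r / (4 * M))"
      using lim[of "\<eta> * r / (4 * M)"] \<eta> r M by auto
    have "norm ((LINT x|lebesgue. f n x * \<xi> x) - (LINT x|lebesgue. g x * \<xi> x)) < r" if n: "n \<ge> N" for n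
    proof -
      let ?d = "\<lambda>x. f n x - g x"
      have dm: "?d \<in> borel_measurable lebesgue" by (intro borel_measurable_diff m)
      have i1: "integrable lebesgue (\<lambda>x. f n x * \<xi> x)"
        by (rule energy_integrable[OF m(1) B fin(1) \<chi> \<chi>M])
      have i2: "integrable lebesgue (\<lambda>x. g x * \<xi> x)"
        by (rule energy_integrable[OF m(2) B fin(2) \<chi> \<chi>M])
      note i = i1 i2
      have id: "integrable lebesgue (\<lambda>x. ?d x * \<xi> x)"
        using Bochner_Integration.integrable_diff[OF i] by (simp add: left_diff_distrib)
      have "norm ((LINT x|lebesgue. f n x * \<xi> x) - (LINT x|lebesgue. g x * \<xi> x)) = norm (LINT x|lebesgue. ?d x * \<xi> x)"
        using Bochner_Integration.integral_diff[OF i] by (simp add: left_diff_distrib)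
      also have "ennreal \<dots> \<le> (\<integral>\<^sup>+x. ennreal (norm (?d x * \<xi> x)) \<partial>lebesgue)"
        by (rule integral_norm_bound_ennreal[OF id])
      also have "\<dots> \<le> (\<integral>\<^sup>+x. ennreal M * (ennreal (norm (?d x)) * indicator B x) \<partial>lebesgue)"
      proof (rule nn_integral_mono)
        fix x
        have "\<bar>\<xi> x\<bar> * \<bar>?d x\<bar> \<le> M * \<bar>?d x\<bar>" by (intro mult_right_mono \<chi>M) simp
        then show "ennreal (norm (?d x * \<xi> x)) \<le> ennreal M * (ennreal (norm (?d x)) * indicator B x)"
          using \<chi>(2)[of x] M(1)
          by (cases "x \<in> B") (auto simp: abs_mult ennreal_mult'[symmetric] mult.commute intro: ennreal_leI)
      qed
      also have "\<dots> = ennreal M * (\<integral>\<^sup>+x. ennreal (norm (?d x)) * indicator B x \<partial>lebesgue)"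
        by (intro nn_integral_cmult borel_measurable_times_ennreal borel_measurable_indicator Bm
            measurable_compose[OF _ measurable_ennreal] measurable_compose[OF dm borel_measurable_norm])
      also have "\<dots> \<le> ennreal M * (ennreal \<eta> * ennreal V + ennreal (1 / \<eta>) * ennreal (\<eta> * r / (4 * M)))"
      proof (rule mult_left_mono)
        have "(\<integral>\<^sup>+x. ennreal (norm (?d x)) * indicator B x \<partial>lebesgue) \<le> ennreal \<eta> * emeasure lebesgue B + ennreal (1 / \<eta>) * energy B ?d"
          by (rule energy_L1[OF dm Bm \<eta>])
        also have "\<dots> \<le> ennreal \<eta> * ennreal V + ennreal (1 / \<eta>) * ennreal (\<eta> * r / (4 * M))"
          unfolding vol by (intro add_mono mult_left_mono N n ennreal_leI) (auto simp: V_def)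
        finally show "(\<integral>\<^sup>+x. ennreal (norm (?d x)) * indicator B x \<partial>lebesgue) \<le>
          ennreal \<eta> * ennreal V + ennreal (1 / \<eta>) * ennreal (\<eta> * r / (4 * M))" .
      qed simp
      also have "\<dots> = ennreal (M * (\<eta> * V + 1 / \<eta> * (\<eta> * r / (4 * M))))"
        using M V \<eta> r by (subst ennreal_mult, simp, simp, subst ennreal_plus, simp, simp, subst ennreal_mult, simp, simp, subst ennreal_mult) simp_all
      also have "M * (\<eta> * V + 1 / \<eta> * (\<eta> * r / (4 * M))) = r / 2"
        using M V \<eta> r by (simp add: \<eta>_def field_simps)
      finally have "norm ((LINT x|lebesgue. f n x * \<xi> x) - (LINT x|lebesgue. g x * \<xi> x)) \<le> r / 2"
        using r by (subst (asm) ennreal_le_iff) auto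
      then show ?thesis using r by linarith
    qed
    then show "\<exists>no. \<forall>n\<ge>no. norm ((LINT x|lebesgue. f n x * \<xi> x) - (LINT x|lebesgue. g x * \<xi> x)) < r" by blast
  qed
qed

section \<open>Integration by parts\<close>

lemma compact_support_integral:
  fixes f :: "'a::euclidean_space \<Rightarrow> 'b::euclidean_space"
  assumes f: "continuous_on UNIV f" "\<And>y. y \<notin> cbox l r \<Longrightarrow> f y = 0"
  shows "integrable lborel f" "(LINT y|lborel. f y) = integral (cbox l r) f"
proof -
  have "(\<lambda>y. indicator (cbox l r) y *\<^sub>R f y) = f" using f(2) by (auto simp: indicator_def)
  with borel_integrable_compact[OF compact_cbox continuous_on_subset[OF f(1)], of l r]
  show i: "integrable lborel f" by simp
  have "(\<lambda>y. if y \<in> cbox l r then f y else 0) = f" using f(2) by auto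
  with has_integral_integral_lborel[OF i]
  have "((\<lambda>y. if y \<in> cbox l r then f y else 0) has_integral (LINT y|lborel. f y)) UNIV" by simp
  then show "(LINT y|lborel. f y) = integral (cbox l r) f"
    unfolding has_integral_restrict_UNIV by (rule integral_unique[symmetric])
qed

text \<open>The integral of a translate of \<open>g\<close> over a large box does not change under
  small translations, so differentiating under the integral sign gives 0.\<close>

lemma integral_pd_eq_0:
  fixes g :: "'a::euclidean_space \<Rightarrow> 'b::euclidean_space"
  assumes g: "smooth g" "\<And>x. norm x > r \<Longrightarrow> g x = 0"
  shows "integrable lborel (pd g h)" "(LINT x|lborel. pd g h x) = 0"
proof -
  \<comment> \<open>The box contains the ball of radius \<open>r + 1\<close>, so translates by less
    than 1 keep their support inside it.\<close>
  obtain a :: 'a where a: "cball 0 (r + 1) \<subseteq> cbox (- a) a"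
    using bounded_subset_cbox_symmetric[OF bounded_cball] by metis
  have out: "norm y > r + 1" if "y \<notin> cbox (- a) a" for y using a that by (auto simp: not_le)
  note cg = smooth_continuous_on[OF g(1)] and cp = smooth_continuous_on[OF smooth_pd[OF g(1)]]
  have p0: "pd g h y = 0" if "y \<notin> cbox (- a) a" for y
    by (rule pd_eq_0_of_support[OF g(2)]) (use out[OF that] in simp_all)
  show "integrable lborel (pd g h)" by (rule compact_support_integral(1)[OF cp p0])
  have c: "avg (- a) a (\<lambda>_. 1) (\<lambda>y. y) g x = (LINT y|lborel. g y)" if x: "x \<in> ball 0 1" for x
  proof -
    have cx: "continuous_on UNIV (\<lambda>y. g (x + y))" by (intro continuous_on_compose2[OF cg] continuous_intros) auto
    have 0: "g (x + y) = 0" if "y \<notin> cbox (- a) a" for y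
      using out[OF that] x norm_triangle_ineq4[of "x + y" x] by (intro g(2)) simp
    have "(LINT y|lborel. g y) = (LINT y|distr lborel borel ((+) x). g y)" by (simp only: lborel_distr_plus)
    also have "\<dots> = (LINT y|lborel. g (x + y))"
      by (rule integral_distr) (auto intro: borel_measurable_continuous_onI cg)
    also have "\<dots> = integral (cbox (- a) a) (\<lambda>y. g (x + y))" by (rule compact_support_integral(2)[OF cx 0])
    finally show ?thesis by (simp add: avg_def)
  qed
  have "pd (avg (- a) a (\<lambda>_. 1) (\<lambda>y. y) g) h 0 = 0"
    by (rule pd_eq_0_open[OF open_ball[of 0 1] _ c]) simp_all
  then have "avg (- a) a (\<lambda>_. 1) (\<lambda>y. y) (pd g h) 0 = 0"
    by (subst (asm) pd_avg[OF _ _ g(1)]) (intro continuous_intros)+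
  then show "(LINT x|lborel. pd g h x) = 0"
    by (subst compact_support_integral(2)[OF cp p0]) (simp_all add: avg_def)
qed

lemma integral_by_parts:
  fixes f \<xi> :: "real^2 \<Rightarrow> real"
  assumes f: "smooth f" and \<xi>: "smooth \<xi>" "\<And>x. norm x > r \<Longrightarrow> \<xi> x = 0"
  shows "(LINT x|lebesgue. f x * pd \<xi> h x) = - (LINT x|lebesgue. pd f h x * \<xi> x)"
proof -
  obtain a :: "real^2" where a: "cball 0 r \<subseteq> cbox (- a) a"
    using bounded_subset_cbox_symmetric[OF bounded_cball] by metis
  have out: "norm y > r" if "y \<notin> cbox (- a) a" for y using a that by (auto simp: not_le)
  have c: "continuous_on UNIV (\<lambda>x. f x * pd \<xi> h x)" "continuous_on UNIV (\<lambda>x. pd f h x * \<xi> x)"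
    by (intro continuous_on_mult smooth_continuous_on smooth_pd f \<xi>(1))+
  have z: "\<xi> y = 0" "pd \<xi> h y = 0" if "y \<notin> cbox (- a) a" for y
    using out[OF that] \<xi>(2) pd_eq_0_of_support[of r \<xi> y h] by simp_all
  have i1: "integrable lborel (\<lambda>x. f x * pd \<xi> h x)"
    by (rule compact_support_integral(1)[OF c(1), of "- a" a]) (simp add: z)
  have i2: "integrable lborel (\<lambda>x. pd f h x * \<xi> x)"
    by (rule compact_support_integral(1)[OF c(2), of "- a" a]) (simp add: z)
  note i = i1 i2
  have "(LINT x|lborel. pd (\<lambda>x. f x * \<xi> x) h x) = 0"
    by (rule integral_pd_eq_0(2)[of _ r]) (auto intro: smooth_mult f \<xi>)
  then have "(LINT x|lborel. f x * pd \<xi> h x + pd f h x * \<xi> x) = 0"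
    by (simp only: pd_mult[OF f \<xi>(1)])
  then have "(LINT x|lborel. f x * pd \<xi> h x) + (LINT x|lborel. pd f h x * \<xi> x) = 0"
    by (simp only: Bochner_Integration.integral_add[OF i])
  moreover have "(LINT x|lebesgue. f x * pd \<xi> h x) = (LINT x|lborel. f x * pd \<xi> h x)"
    "(LINT x|lebesgue. pd f h x * \<xi> x) = (LINT x|lborel. pd f h x * \<xi> x)"
    by (rule integral_completion, simp add: borel_measurable_continuous_onI[OF c(1)])
      (rule integral_completion, simp add: borel_measurable_continuous_onI[OF c(2)])
  ultimately show ?thesis by linarith
qed

section \<open>The fundamental lemma of the calculus of variations\<close>

lemma open_lebesgue: "open S \<Longrightarrow> S \<in> sets lebesgue" and compact_lebesgue: "compact S \<Longrightarrow> S \<in> sets lebesgue"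
  by (auto intro!: sets_completionI_sets simp: compact_imp_closed)

text \<open>The indicator of \<open>A\<close> is a bounded pointwise limit of test functions, namely
  of cutoffs around \<open>A\<close> at scales tending to 0; the uniform constant \<open>C\<close>
  provides the dominating function.\<close>

lemma integral_compact_eq_0:
  fixes H :: "real^2 \<Rightarrow> real"
  assumes \<Omega>: "open \<Omega>" and H: "\<And>K. compact K \<Longrightarrow> K \<subseteq> \<Omega> \<Longrightarrow> integrable (lebesgue_on K) H"
    and 0: "\<And>\<xi>. \<xi> \<in> test_functions \<Omega> \<Longrightarrow> (LINT x|lebesgue_on \<Omega>. H x * \<xi> x) = 0"
    and A: "compact A" "A \<subseteq> \<Omega>"
  shows "(LINT x|lebesgue_on A. H x) = 0"
proof (cases "A = {}")
  case True
  then show ?thesis by (simp add: integral_restrict_space)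
next
  case ne: False
  obtain C where C: "C > 0" "\<And>(A::(real^2) set) \<delta>. compact A \<Longrightarrow> A \<noteq> {} \<Longrightarrow> \<delta> > 0 \<Longrightarrow>
    \<exists>\<zeta>. controlled C \<delta> \<zeta> \<and>
      (\<forall>x. infdist x A < \<delta> \<longrightarrow> \<zeta> x = 1) \<and> (\<forall>x. infdist x A \<ge> 4 * \<delta> \<longrightarrow> \<zeta> x = 0)"
    by (rule uniform_cutoffs[where 'a = "real^2"]) blast
  obtain d where d: "d > 0" "(\<Union>x\<in>A. ball x d) \<subseteq> \<Omega>"
    using compact_subset_open_imp_ball_epsilon_subset[OF A(1) \<Omega> A(2)] by blast
  define A' where "A' = {x. infdist x A \<le> d / 2}"
  have A'c: "compact A'" unfolding A'_def using d(1) by (intro compact_infdist_le ne A(1)) simp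
  have A'\<Omega>: "A' \<subseteq> \<Omega>"
  proof
    fix x assume "x \<in> A'"
    moreover obtain y where "y \<in> A" "infdist x A = dist x y"
      using infdist_attains_inf[OF compact_imp_closed[OF A(1)] ne] by blast
    ultimately have "x \<in> ball y d" using d(1) by (simp add: A'_def dist_commute)
    then show "x \<in> \<Omega>" using d(2) \<open>y \<in> A\<close> by blast
  qed
  \<comment> \<open>The factor 8 confines all cutoffs to distance \<open>d / 2\<close> from
    \<open>A\<close>, hence to the compact \<open>A'\<close> inside \<open>\<Omega>\<close>.\<close>
  define \<delta> where "\<delta> k = d / (8 * real (Suc k))" for k :: nat
  have \<delta>: "\<delta> k > 0" "4 * \<delta> k \<le> d / 2" for k
    using d(1) by (auto simp: \<delta>_def field_simps)
  have "\<forall>k. \<exists>\<zeta>. controlled C (\<delta> k) \<zeta> \<and>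
      (\<forall>x. infdist x A < \<delta> k \<longrightarrow> \<zeta> x = 1) \<and> (\<forall>x. infdist x A \<ge> 4 * \<delta> k \<longrightarrow> \<zeta> x = 0)"
    using C(2)[OF A(1) ne \<delta>(1)] by blast
  then obtain \<zeta> where \<zeta>: "\<And>k. controlled C (\<delta> k) (\<zeta> k)" "\<And>k x. infdist x A < \<delta> k \<Longrightarrow> \<zeta> k x = 1"
    "\<And>k x. infdist x A \<ge> 4 * \<delta> k \<Longrightarrow> \<zeta> k x = 0" by metis
  have \<zeta>s: "smooth (\<zeta> k)" and \<zeta>C: "\<bar>\<zeta> k x\<bar> \<le> C" for k x using \<zeta>(1)[of k] by (auto simp: controlled_def)
  have \<zeta>0: "\<zeta> k x = 0" if "x \<notin> A'" for k x
    using that \<delta>(2)[of k] by (intro \<zeta>(3)) (simp add: A'_def)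
  have test: "\<zeta> k \<in> test_functions \<Omega>" for k
  proof -
    have sub: "closure {x. \<zeta> k x \<noteq> 0} \<subseteq> A'"
      by (rule closure_minimal) (use \<zeta>0 A'c compact_imp_closed in auto)
    moreover have "compact (closure {x. \<zeta> k x \<noteq> 0})"
      using compact_Int_closed[OF A'c closed_closure] sub by (metis inf.absorb_iff2)
    ultimately show ?thesis using \<zeta>s A'\<Omega> by (auto simp: test_functions_def)
  qed
  define HA where "HA x = indicator A' x *\<^sub>R H x" for x
  have HAi: "integrable lebesgue HA"
    using H[OF A'c A'\<Omega>] compact_lebesgue[OF A'c] by (simp add: integrable_restrict_space HA_def[abs_def])
  have "(\<lambda>k. LINT x|lebesgue. HA x * \<zeta> k x) \<longlonglongrightarrow> (LINT x|lebesgue. HA x * indicator A x)"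
  proof (rule integral_dominated_convergence[where w = "\<lambda>x. C * norm (HA x)"])
    show "integrable lebesgue (\<lambda>x. C * norm (HA x))" using HAi by simp
    show "(\<lambda>x. HA x * indicator A x) \<in> borel_measurable lebesgue"
      by (intro borel_measurable_times borel_measurable_integrable[OF HAi] borel_measurable_indicator compact_lebesgue A)
    show "(\<lambda>x. HA x * \<zeta> k x) \<in> borel_measurable lebesgue" for k
      by (intro borel_measurable_times borel_measurable_integrable[OF HAi] continuous_lebesgue smooth_continuous_on \<zeta>s)
    show "AE x in lebesgue. norm (HA x * \<zeta> k x) \<le> C * norm (HA x)" for k
    proof (rule AE_I2)
      fix x
      have "\<bar>HA x\<bar> * \<bar>\<zeta> k x\<bar> \<le> \<bar>HA x\<bar> * C" by (rule mult_left_mono[OF \<zeta>C]) simp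
      then show "norm (HA x * \<zeta> k x) \<le> C * norm (HA x)" by (simp add: abs_mult mult.commute)
    qed
    show "AE x in lebesgue. (\<lambda>k. HA x * \<zeta> k x) \<longlonglongrightarrow> HA x * indicator A x"
    proof (intro AE_I2 tendsto_mult tendsto_const)
      fix x
      show "(\<lambda>k. \<zeta> k x) \<longlonglongrightarrow> indicator A x"
      proof (cases "x \<in> A")
        case True
        then have "\<zeta> k x = 1" for k using \<delta>(1)[of k] by (intro \<zeta>(2)) simp
        then show ?thesis using True by simp
      next
        case False
        have i: "infdist x A > 0"
          using False infdist_pos_not_in_closed[OF compact_imp_closed[OF A(1)] ne] by blast
        obtain N where N: "d / infdist x A < real N" using reals_Archimedean2 by blast
        have "\<zeta> k x = 0" if "k \<ge> N" for k
        proof (rule \<zeta>(3))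
          have "d / infdist x A \<le> real (Suc k)" using N that by linarith
          then have "d \<le> infdist x A * real (Suc k)" using i by (simp add: pos_divide_le_eq mult.commute)
          then show "4 * \<delta> k \<le> infdist x A" using d(1) by (simp add: \<delta>_def field_simps)
        qed
        then have "\<forall>\<^sub>F k in sequentially. \<zeta> k x = indicator A x"
          using False by (intro eventually_sequentiallyI[of N]) simp
        then show ?thesis by (rule tendsto_eventually)
      qed
    qed
  qed
  moreover have "(LINT x|lebesgue. HA x * \<zeta> k x) = 0" for k
  proof -
    have "(LINT x|lebesgue. HA x * \<zeta> k x) = (LINT x|lebesgue. indicator \<Omega> x *\<^sub>R (H x * \<zeta> k x))"
      by (rule Bochner_Integration.integral_cong[OF refl]) (use A'\<Omega> \<zeta>0 in \<open>auto simp: HA_def indicator_def\<close>)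
    also have "\<dots> = (LINT x|lebesgue_on \<Omega>. H x * \<zeta> k x)"
      using open_lebesgue[OF \<Omega>] by (simp add: integral_restrict_space)
    finally show ?thesis using 0[OF test] by simp
  qed
  ultimately have "(LINT x|lebesgue. HA x * indicator A x) = 0" by (simp add: LIMSEQ_const_iff)
  moreover have "(LINT x|lebesgue. HA x * indicator A x) = (LINT x|lebesgue. indicator A x *\<^sub>R H x)"
  proof (rule Bochner_Integration.integral_cong[OF refl])
    fix x
    show "HA x * indicator A x = indicator A x *\<^sub>R H x"
      using d(1) by (auto simp: HA_def A'_def indicator_def)
  qed
  ultimately show ?thesis using compact_lebesgue[OF A(1)] by (simp add: integral_restrict_space)
qed

text \<open>Inner regularity: on a closed subset of the set where \<open>H\<close> is positive the
  integral of \<open>H\<close> is 0, so the subset is null, and such subsets exhaust the set up to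
  any measure \<open>e > 0\<close>.\<close>

lemma positive_part_null:
  fixes H :: "real^2 \<Rightarrow> real"
  assumes K: "compact K" and H: "integrable (lebesgue_on K) H"
    and 0: "\<And>A. compact A \<Longrightarrow> A \<subseteq> K \<Longrightarrow> (LINT x|lebesgue_on A. H x) = 0"
  shows "AE x in lebesgue. x \<in> K \<longrightarrow> H x \<le> 0"
proof -
  define P where "P = {x \<in> K. H x > 0}"
  note Kl = compact_lebesgue[OF K]
  have HK: "(\<lambda>x. if x \<in> K then H x else 0) \<in> borel_measurable lebesgue"
    using borel_measurable_integrable[OF H] Kl by (simp add: borel_measurable_if)
  have "P = {x \<in> space lebesgue. (if x \<in> K then H x else 0) > 0}" by (auto simp: P_def)
  then have P: "P \<in> sets lebesgue" using borel_measurable_less[OF borel_measurable_const HK] by simp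
  have le: "emeasure lebesgue P \<le> ennreal e" if e: "e > 0" for e
  proof -
    obtain T where T: "closed T" "T \<subseteq> P" "emeasure lebesgue (P - T) < ennreal e"
      using sets_lebesgue_inner_closed[OF P e] by metis
    have TK: "T \<subseteq> K" using T(2) by (auto simp: P_def)
    have Tc: "compact T" using compact_Int_closed[OF K T(1)] TK by (metis inf.absorb_iff2)
    note Tl = compact_lebesgue[OF Tc]
    let ?g = "\<lambda>x. indicator T x *\<^sub>R H x"
    have gi: "integrable lebesgue ?g"
    proof -
      have "integrable lebesgue (\<lambda>x. indicator K x *\<^sub>R H x)"
        using H Kl by (simp add: integrable_restrict_space)
      then have "integrable lebesgue (\<lambda>x. indicator T x *\<^sub>R (indicator K x *\<^sub>R H x))"
        by (rule integrable_mult_indicator[OF Tl])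
      moreover have "(\<lambda>x. indicator T x *\<^sub>R (indicator K x *\<^sub>R H x)) = ?g"
        by (rule ext) (use TK in \<open>auto simp: indicator_def\<close>)
      ultimately show ?thesis by simp
    qed
    have "(LINT x|lebesgue. ?g x) = 0" using 0[OF Tc TK] Tl by (simp add: integral_restrict_space)
    moreover have "AE x in lebesgue. 0 \<le> ?g x" using T(2) by (intro AE_I2) (auto simp: indicator_def P_def)
    ultimately have "AE x in lebesgue. ?g x = 0" using integral_nonneg_eq_0_iff_AE[OF gi] by simp
    then have "AE x in lebesgue. x \<notin> T"
      by eventually_elim (use T(2) in \<open>auto simp: P_def\<close>)
    then have "emeasure lebesgue T = 0" using AE_iff_measurable[OF Tl, of "\<lambda>x. x \<notin> T"] by simp
    have "P = T \<union> (P - T)" using T(2) by blast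
    then have "emeasure lebesgue P \<le> emeasure lebesgue T + emeasure lebesgue (P - T)"
      using emeasure_subadditive[OF Tl, of "P - T"] P Tl by (metis sets.Diff)
    then show ?thesis using T(3) \<open>emeasure lebesgue T = 0\<close> by simp
  qed
  have "emeasure lebesgue P \<le> 0" by (rule ennreal_le_epsilon) (simp add: le)
  then have "emeasure lebesgue P = 0" by simp
  then have "AE x in lebesgue. x \<notin> P" using AE_iff_measurable[OF P, of "\<lambda>x. x \<notin> P"] by simp
  then show ?thesis by eventually_elim (auto simp: P_def)
qed

text \<open>The one-sided result for \<open>H\<close> and for \<open>- H\<close>, on each member of
  a compact exhaustion.\<close>

lemma fundamental_lemma:
  fixes H :: "real^2 \<Rightarrow> real"
  assumes \<Omega>: "open \<Omega>" and H: "\<And>K. compact K \<Longrightarrow> K \<subseteq> \<Omega> \<Longrightarrow> integrable (lebesgue_on K) H"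
    and 0: "\<And>\<xi>. \<xi> \<in> test_functions \<Omega> \<Longrightarrow> (LINT x|lebesgue_on \<Omega>. H x * \<xi> x) = 0"
  shows "AE x in lebesgue. x \<in> \<Omega> \<longrightarrow> H x = 0"
proof -
  obtain C :: "nat \<Rightarrow> (real^2) set" where C: "\<And>n. compact (C n)" "\<And>n. C n \<subseteq> \<Omega>" "(\<Union>n. C n) = \<Omega>"
    using open_Union_compact_subsets[OF \<Omega>] by metis
  have "AE x in lebesgue. x \<in> C n \<longrightarrow> H x = 0" for n
  proof -
    have z: "(LINT x|lebesgue_on A. H x) = 0" if "compact A" "A \<subseteq> C n" for A
      by (rule integral_compact_eq_0[OF \<Omega> H 0 that(1)]) (use that C in auto)
    have "AE x in lebesgue. x \<in> C n \<longrightarrow> H x \<le> 0"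
      by (rule positive_part_null[OF C(1) H[OF C(1,2)] z])
    moreover have "AE x in lebesgue. x \<in> C n \<longrightarrow> - H x \<le> 0"
      by (rule positive_part_null[OF C(1)]) (use H[OF C(1,2)] z in auto)
    ultimately show ?thesis by eventually_elim auto
  qed
  then have "AE x in lebesgue. \<forall>n. x \<in> C n \<longrightarrow> H x = 0" unfolding AE_all_countable by blast
  then show ?thesis by eventually_elim (use C(3) in blast)
qed

text \<open>The hypotheses on \<open>v\<close> and \<open>Dv\<close> give measurability on bounded
  or compact pieces; the zero extension is the pointwise limit of the extensions from these
  pieces.\<close>

lemma measurable_exhaustion:
  fixes f :: "'a::euclidean_space \<Rightarrow> 'b::euclidean_space"
  assumes C: "\<And>n. C n \<in> sets lebesgue" "\<And>n. C n \<subseteq> \<Omega>" "\<And>x. x \<in> \<Omega> \<Longrightarrow> \<exists>N. \<forall>n\<ge>N. x \<in> C n"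
    and f: "\<And>n::nat. f \<in> borel_measurable (lebesgue_on (C n))"
  shows "(\<lambda>x. if x \<in> \<Omega> then f x else 0) \<in> borel_measurable lebesgue"
proof (rule borel_measurable_LIMSEQ_metric)
  show "(\<lambda>x. if x \<in> C n then f x else 0) \<in> borel_measurable lebesgue" for n
    using f[of n] C(1)[of n] by (simp add: borel_measurable_if)
  fix x
  show "(\<lambda>n. if x \<in> C n then f x else 0) \<longlonglongrightarrow> (if x \<in> \<Omega> then f x else 0)"
  proof (cases "x \<in> \<Omega>")
    case True
    then obtain N where "\<forall>n\<ge>N. x \<in> C n" using C(3) by blast
    then have "\<forall>\<^sub>F n in sequentially. (if x \<in> C n then f x else 0) = f x"
      by (intro eventually_sequentiallyI[of N]) simp
    then show ?thesis using True by (simp add: tendsto_eventually)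
  next
    case False
    then have "x \<notin> C n" for n using C(2) by blast
    then show ?thesis using False by simp
  qed
qed

section \<open>Test fields and the identification of the weak gradient\<close>

lemma grad_test_support:
  assumes "\<phi> \<in> solenoidal_test_fields \<Omega>"
  obtains r where "smooth \<phi>" "r > 0" "\<And>x. norm x > r \<Longrightarrow> \<phi> x = 0" "\<And>x. x \<notin> \<Omega> \<Longrightarrow> \<phi> x = 0"
    "\<And>x. norm x > r \<Longrightarrow> grad \<phi> x = 0" "\<And>x. x \<notin> \<Omega> \<Longrightarrow> grad \<phi> x = 0"
proof -
  obtain S where S: "smooth \<phi>" "compact S" "S \<subseteq> \<Omega>" "\<And>x. x \<notin> S \<Longrightarrow> \<phi> x = 0" "\<And>x h. x \<notin> S \<Longrightarrow> pd \<phi> h x = 0"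
    using solenoidal_test_fieldD[OF assms] by metis
  obtain r where r: "r > 0" "\<And>x. x \<in> S \<Longrightarrow> norm x \<le> r"
    using compact_imp_bounded[OF S(2)] by (auto simp: bounded_pos)
  have g: "grad \<phi> x = 0" if "x \<notin> S" for x using S(5)[OF that] by (simp add: vec_eq_iff grad_nth)
  have "x \<notin> S" if "norm x > r" for x using r(2)[of x] that by auto
  then show thesis using that[OF S(1) r(1)] S g by blast
qed

lemma energy_compact_support_finite:
  fixes f :: "real^2 \<Rightarrow> 'b::euclidean_space"
  assumes "continuous_on UNIV f" "\<And>x. norm x > r \<Longrightarrow> f x = 0"
  shows "energy S f < \<infinity>"
proof -
  obtain M where M: "M \<ge> 0" "\<And>x. norm (f x) \<le> M" by (rule bounded_of_compact_support[OF assms]) auto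
  have "energy S f \<le> ennreal (M\<^sup>2) * emeasure lebesgue (cball (0::real^2) r)"
    by (rule energy_bounded[OF M(2)]) (use assms(2) in auto)
  also have "\<dots> < \<infinity>" using compact_emeasure_finite[of "cball (0::real^2) r"] by (simp add: ennreal_mult_less_top)
  finally show ?thesis .
qed

lemma energy_grad_finite:
  assumes "\<phi> \<in> solenoidal_test_fields \<Omega>"
  shows "energy S (grad \<phi>) < \<infinity>"
proof -
  obtain r where "smooth \<phi>" "\<And>x. norm x > r \<Longrightarrow> grad \<phi> x = 0"
    by (rule grad_test_support[OF assms]) blast
  then show ?thesis by (rule energy_compact_support_finite[OF continuous_on_grad])
qed

lemma test_functionD:
  assumes "\<xi> \<in> test_functions \<Omega>"
  obtains S r where "smooth \<xi>" "compact S" "S \<subseteq> \<Omega>" "\<And>x. x \<notin> S \<Longrightarrow> \<xi> x = 0" "\<And>x h. x \<notin> S \<Longrightarrow> pd \<xi> h x = 0"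
    "\<And>x. norm x > r \<Longrightarrow> \<xi> x = 0"
proof -
  define S where "S = closure {x. \<xi> x \<noteq> 0}"
  have S: "compact S" "S \<subseteq> \<Omega>" and s: "smooth \<xi>"
    using assms by (auto simp: test_functions_def S_def)
  have 0: "\<xi> x = 0" if "x \<notin> S" for x
    using that closure_subset[of "{x. \<xi> x \<noteq> 0}"] by (auto simp: S_def)
  have pd0: "pd \<xi> h x = 0" if "x \<notin> S" for x h
  proof (rule pd_eq_0_open)
    show "open (- S)" by (simp add: S_def open_Compl)
  qed (use that 0 in auto)
  obtain r where r: "\<And>x. x \<in> S \<Longrightarrow> norm x \<le> r" using compact_imp_bounded[OF S(1)] by (auto simp: bounded_pos)
  have "\<xi> x = 0" if "norm x > r" for x using r[of x] that by (intro 0) auto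
  then show thesis using that[OF s S 0 pd0] by blast
qed

lemma energy_component_le:
  assumes "\<And>x. \<bar>f x\<bar> \<le> norm (g x)"
  shows "energy S f \<le> energy S g"
  by (rule energy_mono) (use assms in simp)

text \<open>Passing to the limit in the integration by parts for \<open>\<phi> n\<close> shows that
  \<open>G\<close> acts as a weak gradient of \<open>v\<close>; the fundamental lemma, applied to
  each entry of \<open>G - Dv\<close>, then gives uniqueness.\<close>

lemma weak_gradient_limit:
  fixes \<Omega> :: "(real^2) set" and v :: "real^2 \<Rightarrow> real^2" and \<phi> :: "nat \<Rightarrow> real^2 \<Rightarrow> real^2"
  assumes \<Omega>: "open \<Omega>" and \<phi>: "\<And>n. \<phi> n \<in> solenoidal_test_fields \<Omega>"
    and wg: "weak_gradient \<Omega> v Dv" and vm: "v \<in> borel_measurable lebesgue"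
    and vfin: "\<And>r. energy (\<Omega> \<inter> ball 0 r) v < \<infinity>"
    and loc: "\<And>r \<epsilon>::real. \<epsilon> > 0 \<Longrightarrow> \<exists>N. \<forall>n\<ge>N. energy (\<Omega> \<inter> ball 0 r) (\<lambda>x. \<phi> n x - v x) \<le> ennreal \<epsilon>"
    and Gm: "G \<in> borel_measurable lebesgue" and Gfin: "energy \<Omega> G < \<infinity>"
    and G: "\<And>\<epsilon>::real. \<epsilon> > 0 \<Longrightarrow> \<exists>N. \<forall>n\<ge>N. energy \<Omega> (\<lambda>x. grad (\<phi> n) x - G x) \<le> ennreal \<epsilon>"
  shows "AE x in lebesgue. x \<in> \<Omega> \<longrightarrow> G x = Dv x"
proof -
  note \<Omega>l = open_lebesgue[OF \<Omega>]
  have comp: "(\<lambda>x. f x $ i) \<in> borel_measurable lebesgue" if "f \<in> borel_measurable lebesgue" for i and f :: "real^2 \<Rightarrow> 'c::euclidean_space^2"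
    using measurable_compose[OF that borel_measurable_continuous_onI[OF continuous_on_component[OF continuous_on_id]]] by simp
  have Gij: "(\<lambda>x. G x $ i $ j) \<in> borel_measurable lebesgue" for i j by (intro comp Gm)
  have nij: "\<bar>(M::real^2^2) $ i $ j\<bar> \<le> norm M" for M i j
    by (rule order_trans[OF component_le_norm_cart Finite_Cartesian_Product.norm_nth_le])
  have "AE x in lebesgue. x \<in> \<Omega> \<longrightarrow> G x $ i $ j - Dv x $ i $ j = 0" for i j
  proof -
    have DvK: "integrable (lebesgue_on K) (\<lambda>x. Dv x $ i $ j)" if "compact K" "K \<subseteq> \<Omega>" for K
    proof -
      have "integrable (lebesgue_on K) Dv" using wg that by (simp add: weak_gradient_def locally_integrable_def)
      from integrable_bounded_linear[OF bounded_linear_compose[OF bounded_linear_vec_nth bounded_linear_vec_nth] this]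
      show ?thesis .
    qed
    have GK: "integrable lebesgue (\<lambda>x. G x $ i $ j * \<xi> x)"
      if "compact K" "K \<subseteq> \<Omega>" "continuous_on UNIV \<xi>" "\<And>x. x \<notin> K \<Longrightarrow> \<xi> x = 0" "\<And>x. \<bar>\<xi> x\<bar> \<le> M" for K \<xi> M
    proof (rule energy_integrable[OF Gij that(1) _ that(3-5)])
      have "energy K (\<lambda>x. G x $ i $ j) \<le> energy K G" by (rule energy_component_le) (rule nij)
      also have "\<dots> \<le> energy \<Omega> G" by (rule energy_mono_set[OF that(2)])
      finally show "energy K (\<lambda>x. G x $ i $ j) < \<infinity>" using Gfin by (rule le_less_trans)
    qed
    show ?thesis
    proof (rule fundamental_lemma[OF \<Omega>])
      fix K assume K: "compact K" "K \<subseteq> \<Omega>"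
      have "integrable (lebesgue_on K) (\<lambda>x. G x $ i $ j)"
      proof -
        have "(\<lambda>x. indicator K x *\<^sub>R G x $ i $ j) \<in> borel_measurable lebesgue"
          by (intro borel_measurable_scaleR borel_measurable_indicator compact_lebesgue K Gij)
        moreover have "(\<integral>\<^sup>+x. ennreal (norm (indicator K x *\<^sub>R G x $ i $ j)) \<partial>lebesgue) < \<infinity>"
        proof -
          have "(\<integral>\<^sup>+x. ennreal (norm (indicator K x *\<^sub>R G x $ i $ j)) \<partial>lebesgue) =
            (\<integral>\<^sup>+x. ennreal (norm (G x $ i $ j)) * indicator K x \<partial>lebesgue)"
            by (intro nn_integral_cong) (auto simp: indicator_def)
          also have "\<dots> \<le> ennreal 1 * emeasure lebesgue K + ennreal (1 / 1) * energy K (\<lambda>x. G x $ i $ j)"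
            by (rule energy_L1[OF Gij compact_lebesgue[OF K(1)]]) simp
          also have "energy K (\<lambda>x. G x $ i $ j) \<le> energy K G" by (rule energy_component_le) (rule nij)
          also have "\<dots> \<le> energy \<Omega> G" by (rule energy_mono_set[OF K(2)])
          also have "ennreal 1 * emeasure lebesgue K + ennreal (1 / 1) * \<dots> < \<infinity>"
            using Gfin compact_emeasure_finite[OF K(1)] by (simp add: ennreal_mult_less_top)
          finally show ?thesis by (simp add: add_left_mono mult_left_mono)
        qed
        ultimately show ?thesis
          using compact_lebesgue[OF K(1)] by (subst integrable_restrict_space) (auto intro: integrableI_bounded)
      qed
      then show "integrable (lebesgue_on K) (\<lambda>x. G x $ i $ j - Dv x $ i $ j)"
        by (intro Bochner_Integration.integrable_diff DvK K)
    next
      fix \<xi> :: "real^2 \<Rightarrow> real" assume \<xi>: "\<xi> \<in> test_functions \<Omega>"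
      obtain S r where S: "smooth \<xi>" "compact S" "S \<subseteq> \<Omega>" "\<And>x. x \<notin> S \<Longrightarrow> \<xi> x = 0" "\<And>x h. x \<notin> S \<Longrightarrow> pd \<xi> h x = 0"
        "\<And>x. norm x > r \<Longrightarrow> \<xi> x = 0"
        by (rule test_functionD[OF \<xi>]) blast
      let ?e = "axis j (1::real) :: real^2"
      obtain rS where rS: "S \<subseteq> \<Omega> \<inter> ball 0 rS"
      proof -
        obtain b where "b > 0" "\<And>x. x \<in> S \<Longrightarrow> norm x \<le> b" using compact_imp_bounded[OF S(2)] by (auto simp: bounded_pos)
        then have "S \<subseteq> \<Omega> \<inter> ball 0 (b + 1)" using S(3) by fastforce
        then show thesis by (rule that)
      qed
      have \<phi>s: "smooth (\<phi> n)" for n by (rule grad_test_support[OF \<phi>]) auto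
      have si: "smooth (\<lambda>x. \<phi> n x $ i)" for n by (rule smooth_linear_compose[OF bounded_linear_vec_nth \<phi>s])
      have pi: "pd (\<lambda>x. \<phi> n x $ i) ?e x = grad (\<phi> n) x $ i $ j" for n x
        by (simp add: pd_linear_compose[OF bounded_linear_vec_nth \<phi>s] grad_nth)
      have parts: "(LINT x|lebesgue. \<phi> n x $ i * pd \<xi> ?e x) = - (LINT x|lebesgue. grad (\<phi> n) x $ i $ j * \<xi> x)" for n
        using integral_by_parts[OF si[of n] S(1,6), where h = ?e] by (simp add: pi)
      have l1: "(\<lambda>n. LINT x|lebesgue. \<phi> n x $ i * pd \<xi> ?e x) \<longlonglongrightarrow> (LINT x|lebesgue. v x $ i * pd \<xi> ?e x)"
      proof (rule energy_weak_limit[OF _ _ S(2) _ _ _ smooth_continuous_on[OF smooth_pd[OF S(1)]] S(5)])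
        show "(\<lambda>x. \<phi> n x $ i) \<in> borel_measurable lebesgue" for n by (intro continuous_lebesgue smooth_continuous_on si)
        show "(\<lambda>x. v x $ i) \<in> borel_measurable lebesgue" by (intro comp vm)
        show "energy S (\<lambda>x. \<phi> n x $ i) < \<infinity>" for n
        proof -
          obtain r where "\<And>x. norm x > r \<Longrightarrow> \<phi> n x = 0" by (rule grad_test_support[OF \<phi>[of n]]) blast
          then show ?thesis by (intro energy_compact_support_finite[OF smooth_continuous_on[OF si], of r]) simp
        qed
        have "energy S (\<lambda>x. v x $ i) \<le> energy S v" by (rule energy_component_le) (rule component_le_norm_cart)
        also have "\<dots> \<le> energy (\<Omega> \<inter> ball 0 rS) v" by (rule energy_mono_set[OF rS])
        finally show "energy S (\<lambda>x. v x $ i) < \<infinity>" using vfin by (rule le_less_trans)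
        fix \<epsilon> :: real assume "\<epsilon> > 0"
        then obtain N where N: "\<And>n. n \<ge> N \<Longrightarrow> energy (\<Omega> \<inter> ball 0 rS) (\<lambda>x. \<phi> n x - v x) \<le> ennreal \<epsilon>"
          using loc by blast
        have "energy S (\<lambda>x. \<phi> n x $ i - v x $ i) \<le> ennreal \<epsilon>" if "n \<ge> N" for n
        proof -
          have "energy S (\<lambda>x. \<phi> n x $ i - v x $ i) \<le> energy S (\<lambda>x. \<phi> n x - v x)"
            by (rule energy_component_le) (use component_le_norm_cart[of "\<phi> n _ - v _" i] in simp)
          also have "\<dots> \<le> energy (\<Omega> \<inter> ball 0 rS) (\<lambda>x. \<phi> n x - v x)" by (rule energy_mono_set[OF rS])
          also note N[OF that]
          finally show ?thesis .
        qed
        then show "\<exists>N. \<forall>n\<ge>N. energy S (\<lambda>x. \<phi> n x $ i - v x $ i) \<le> ennreal \<epsilon>" by blast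
      qed
      have l2: "(\<lambda>n. LINT x|lebesgue. grad (\<phi> n) x $ i $ j * \<xi> x) \<longlonglongrightarrow> (LINT x|lebesgue. G x $ i $ j * \<xi> x)"
      proof (rule energy_weak_limit[OF _ Gij S(2) _ _ _ smooth_continuous_on[OF S(1)] S(4)])
        show "(\<lambda>x. grad (\<phi> n) x $ i $ j) \<in> borel_measurable lebesgue" for n
          by (intro comp continuous_lebesgue continuous_on_grad \<phi>s)
        show "energy S (\<lambda>x. grad (\<phi> n) x $ i $ j) < \<infinity>" for n
        proof -
          have "energy S (\<lambda>x. grad (\<phi> n) x $ i $ j) \<le> energy S (grad (\<phi> n))" by (rule energy_component_le) (rule nij)
          also have "\<dots> < \<infinity>" by (rule energy_grad_finite[OF \<phi>])
          finally show ?thesis .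
        qed
        have "energy S (\<lambda>x. G x $ i $ j) \<le> energy S G" by (rule energy_component_le) (rule nij)
        also have "\<dots> \<le> energy \<Omega> G" by (rule energy_mono_set[OF S(3)])
        finally show "energy S (\<lambda>x. G x $ i $ j) < \<infinity>" using Gfin by (rule le_less_trans)
        fix \<epsilon> :: real assume "\<epsilon> > 0"
        then obtain N where N: "\<And>n. n \<ge> N \<Longrightarrow> energy \<Omega> (\<lambda>x. grad (\<phi> n) x - G x) \<le> ennreal \<epsilon>"
          using G by blast
        have "energy S (\<lambda>x. grad (\<phi> n) x $ i $ j - G x $ i $ j) \<le> ennreal \<epsilon>" if "n \<ge> N" for n
        proof -
          have "energy S (\<lambda>x. grad (\<phi> n) x $ i $ j - G x $ i $ j) \<le> energy S (\<lambda>x. grad (\<phi> n) x - G x)"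
            by (rule energy_component_le) (use nij[of "grad (\<phi> n) _ - G _" i j] in simp)
          also have "\<dots> \<le> energy \<Omega> (\<lambda>x. grad (\<phi> n) x - G x)" by (rule energy_mono_set[OF S(3)])
          also note N[OF that]
          finally show ?thesis .
        qed
        then show "\<exists>N. \<forall>n\<ge>N. energy S (\<lambda>x. grad (\<phi> n) x $ i $ j - G x $ i $ j) \<le> ennreal \<epsilon>" by blast
      qed
      have "(\<lambda>n. LINT x|lebesgue. \<phi> n x $ i * pd \<xi> ?e x) \<longlonglongrightarrow> - (LINT x|lebesgue. G x $ i $ j * \<xi> x)"
        unfolding parts by (rule tendsto_minus[OF l2])
      from LIMSEQ_unique[OF l1 this]
      have vG: "(LINT x|lebesgue. v x $ i * pd \<xi> ?e x) = - (LINT x|lebesgue. G x $ i $ j * \<xi> x)" .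
      have on: "(LINT x|lebesgue_on \<Omega>. f x * \<xi>' x) = (LINT x|lebesgue. f x * \<xi>' x)"
        if "\<And>x. x \<notin> S \<Longrightarrow> \<xi>' x = 0" for f \<xi>' :: "real^2 \<Rightarrow> real"
      proof -
        have "(LINT x|lebesgue_on \<Omega>. f x * \<xi>' x) = (LINT x|lebesgue. indicator \<Omega> x *\<^sub>R (f x * \<xi>' x))"
          using \<Omega>l by (simp add: integral_restrict_space)
        also have "\<dots> = (LINT x|lebesgue. f x * \<xi>' x)"
          by (rule Bochner_Integration.integral_cong[OF refl]) (use that S(3) in \<open>auto simp: indicator_def\<close>)
        finally show ?thesis .
      qed
      have "(LINT x|lebesgue_on \<Omega>. v x $ i * frechet_derivative \<xi> (at x) ?e) = - (LINT x|lebesgue_on \<Omega>. Dv x $ i $ j * \<xi> x)"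
        using wg \<xi> unfolding weak_gradient_def by blast
      then have "(LINT x|lebesgue_on \<Omega>. v x $ i * pd \<xi> ?e x) = - (LINT x|lebesgue_on \<Omega>. Dv x $ i $ j * \<xi> x)"
        unfolding pd_def[symmetric] .
      moreover have "(LINT x|lebesgue_on \<Omega>. v x $ i * pd \<xi> ?e x) = (LINT x|lebesgue. v x $ i * pd \<xi> ?e x)"
        by (rule on) (rule S(5))
      moreover have "(LINT x|lebesgue_on \<Omega>. Dv x $ i $ j * \<xi> x) = (LINT x|lebesgue. Dv x $ i $ j * \<xi> x)"
        by (rule on) (rule S(4))
      ultimately have vD: "(LINT x|lebesgue. v x $ i * pd \<xi> ?e x) = - (LINT x|lebesgue. Dv x $ i $ j * \<xi> x)"
        by simp
      obtain M where M: "\<And>x. \<bar>\<xi> x\<bar> \<le> M"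
        using bounded_of_compact_support[OF smooth_continuous_on[OF S(1)] S(6)] by (metis real_norm_def)
      have iG: "integrable lebesgue (\<lambda>x. G x $ i $ j * \<xi> x)"
        by (rule GK[OF S(2,3) smooth_continuous_on[OF S(1)] S(4) M])
      have iD: "integrable lebesgue (\<lambda>x. Dv x $ i $ j * \<xi> x)"
      proof -
        have i: "integrable lebesgue (\<lambda>x. indicator S x *\<^sub>R Dv x $ i $ j)"
          using DvK[OF S(2,3)] compact_lebesgue[OF S(2)] by (simp add: integrable_restrict_space)
        have "integrable lebesgue (\<lambda>x. (indicator S x *\<^sub>R Dv x $ i $ j) * \<xi> x)"
        proof (rule Bochner_Integration.integrable_bound)
          show "integrable lebesgue (\<lambda>x. M * (indicator S x *\<^sub>R Dv x $ i $ j))" using i by (rule integrable_mult_right)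
          show "(\<lambda>x. (indicator S x *\<^sub>R Dv x $ i $ j) * \<xi> x) \<in> borel_measurable lebesgue"
            by (intro borel_measurable_times borel_measurable_integrable[OF i] continuous_lebesgue smooth_continuous_on S(1))
          show "AE x in lebesgue. norm ((indicator S x *\<^sub>R Dv x $ i $ j) * \<xi> x) \<le> norm (M * (indicator S x *\<^sub>R Dv x $ i $ j))"
          proof (rule AE_I2)
            fix x
            have "\<bar>\<xi> x\<bar> \<le> \<bar>M\<bar>" using M[of x] by linarith
            then show "norm ((indicator S x *\<^sub>R Dv x $ i $ j) * \<xi> x) \<le> norm (M * (indicator S x *\<^sub>R Dv x $ i $ j))"
              unfolding norm_mult by (subst mult.commute) (intro mult_right_mono, simp_all)
          qed
        qed
        moreover have "(\<lambda>x. (indicator S x *\<^sub>R Dv x $ i $ j) * \<xi> x) = (\<lambda>x. Dv x $ i $ j * \<xi> x)"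
        proof
          fix x
          show "(indicator S x *\<^sub>R Dv x $ i $ j) * \<xi> x = Dv x $ i $ j * \<xi> x"
            by (cases "x \<in> S") (simp_all add: S(4))
        qed
        ultimately show ?thesis by simp
      qed
      have "(LINT x|lebesgue_on \<Omega>. (G x $ i $ j - Dv x $ i $ j) * \<xi> x) = (LINT x|lebesgue. (G x $ i $ j - Dv x $ i $ j) * \<xi> x)"
        by (rule on[OF S(4)])
      also have "\<dots> = (LINT x|lebesgue. G x $ i $ j * \<xi> x) - (LINT x|lebesgue. Dv x $ i $ j * \<xi> x)"
        unfolding left_diff_distrib by (rule Bochner_Integration.integral_diff[OF iG iD])
      also have "\<dots> = 0" using vG vD by simp
      finally show "(LINT x|lebesgue_on \<Omega>. (G x $ i $ j - Dv x $ i $ j) * \<xi> x) = 0" .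
    qed
  qed
  then have "AE x in lebesgue. \<forall>i j. x \<in> \<Omega> \<longrightarrow> G x $ i $ j - Dv x $ i $ j = 0"
    unfolding AE_all_countable by blast
  then show ?thesis by eventually_elim (simp add: vec_eq_iff)
qed

section \<open>The approximation theorem\<close>

text \<open>The gradients of test fields vanish off \<open>\<Omega>\<close>, so their energy over
  the plane is the one over \<open>\<Omega>\<close>.\<close>

lemma dirichlet_norm_energy:
  assumes \<Omega>: "open \<Omega>" and \<phi>: "\<phi> \<in> solenoidal_test_fields \<Omega>" "\<phi>' \<in> solenoidal_test_fields \<Omega>"
    and e: "dirichlet_norm \<Omega> (\<lambda>x. \<phi> x - \<phi>' x) \<le> e"
  shows "energy UNIV (\<lambda>x. grad \<phi> x - grad \<phi>' x) \<le> ennreal (e\<^sup>2)"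
proof -
  obtain r where r: "smooth \<phi>" "\<And>x. norm x > r \<Longrightarrow> grad \<phi> x = 0" "\<And>x. x \<notin> \<Omega> \<Longrightarrow> grad \<phi> x = 0"
    by (rule grad_test_support[OF \<phi>(1)]) blast
  obtain r' where r': "smooth \<phi>'" "\<And>x. norm x > r' \<Longrightarrow> grad \<phi>' x = 0" "\<And>x. x \<notin> \<Omega> \<Longrightarrow> grad \<phi>' x = 0"
    by (rule grad_test_support[OF \<phi>(2)]) blast
  let ?d = "\<lambda>x. grad \<phi> x - grad \<phi>' x"
  have d: "?d = grad (\<lambda>x. \<phi> x - \<phi>' x)"
    by (rule ext) (simp add: vec_eq_iff grad_nth pd_diff[OF r(1) r'(1)])
  have c: "continuous_on UNIV ?d" by (intro continuous_on_diff continuous_on_grad r r')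
  have "energy UNIV ?d \<le> energy (\<Omega> \<inter> UNIV) ?d" by (rule energy_UNIV_le) (simp add: r r')
  also have "\<dots> = energy \<Omega> ?d" by simp
  also have "\<dots> \<le> ennreal (e\<^sup>2)"
  proof (rule energy_le_of_L2_norm[OF open_lebesgue[OF \<Omega>]])
    show "?d \<in> borel_measurable (lebesgue_on \<Omega>)"
      by (intro measurable_restrict_space1 continuous_lebesgue c)
    show "energy \<Omega> ?d < \<infinity>"
      by (rule energy_compact_support_finite[OF c, of "max r r'"]) (simp add: r r')
    show "L2_norm (lebesgue_on \<Omega>) ?d \<le> e" using e unfolding dirichlet_norm_def d .
  qed
  finally show ?thesis .
qed

theorem proposition3p1:
  fixes \<Omega> :: "(real^2) set"
    and v :: "real^2 \<Rightarrow> real^2"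
    and Dv :: "real^2 \<Rightarrow> real^2^2"
  assumes "exterior_domain \<Omega>"
    and "lipschitz_boundary \<Omega>"
    and "v \<in> H1dot_0_sigma \<Omega>"
    and "weak_gradient \<Omega> v Dv"
    and "esssup (lebesgue_on \<Omega>) (\<lambda>x. ereal ((norm x + 1) * norm (v x))) < \<infinity>"
  shows "\<exists>vn :: nat \<Rightarrow> real^2 \<Rightarrow> real^2.
           (\<forall>n. vn n \<in> solenoidal_test_fields \<Omega>) \<and>
           L2_tendsto (lebesgue_on \<Omega>) (\<lambda>n. grad (vn n)) Dv \<and>
           Linf_weak_star_tendsto (lebesgue_on \<Omega>)
             (\<lambda>n x. (norm x + 1) *\<^sub>R vn n x) (\<lambda>x. (norm x + 1) *\<^sub>R v x)"
proof -
  have \<Omega>: "open \<Omega>" using assms(1) by (simp add: exterior_domain_def)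
  note \<Omega>l = open_lebesgue[OF \<Omega>]
  have ballm: "\<Omega> \<inter> ball 0 r \<in> sets lebesgue" for r using \<Omega> by (intro open_lebesgue open_Int) auto
  from assms(3) have "\<exists>\<phi>. (\<forall>n. \<phi> n \<in> solenoidal_test_fields \<Omega>) \<and>
      (\<forall>e>0. \<exists>N. \<forall>m\<ge>N. \<forall>n\<ge>N. dirichlet_norm \<Omega> (\<lambda>x. \<phi> m x - \<phi> n x) < e) \<and>
      (\<forall>R>0. L2_tendsto (lebesgue_on (\<Omega> \<inter> ball 0 R)) \<phi> v)"
    unfolding H1dot_0_sigma_def by (rule CollectD)
  then obtain \<phi> where \<phi>: "\<And>n. \<phi> n \<in> solenoidal_test_fields \<Omega>"
    and dir: "\<forall>e>0. \<exists>N. \<forall>m\<ge>N. \<forall>n\<ge>N. dirichlet_norm \<Omega> (\<lambda>x. \<phi> m x - \<phi> n x) < e"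
    and L2: "\<And>R. R > 0 \<Longrightarrow> L2_tendsto (lebesgue_on (\<Omega> \<inter> ball 0 R)) \<phi> v"
    by blast
  have cauchy: "\<exists>N. \<forall>m\<ge>N. \<forall>n\<ge>N. energy UNIV (\<lambda>x. grad (\<phi> m) x - grad (\<phi> n) x) \<le> ennreal \<epsilon>" if "\<epsilon> > 0" for \<epsilon> :: real
  proof -
    have "sqrt \<epsilon> > 0" using that by simp
    from mp[OF spec[OF dir] this] have "\<exists>N. \<forall>m\<ge>N. \<forall>n\<ge>N. dirichlet_norm \<Omega> (\<lambda>x. \<phi> m x - \<phi> n x) < sqrt \<epsilon>" .
    then obtain N where N: "\<And>m n. m \<ge> N \<Longrightarrow> n \<ge> N \<Longrightarrow> dirichlet_norm \<Omega> (\<lambda>x. \<phi> m x - \<phi> n x) < sqrt \<epsilon>"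
      by blast
    have "energy UNIV (\<lambda>x. grad (\<phi> m) x - grad (\<phi> n) x) \<le> ennreal ((sqrt \<epsilon>)\<^sup>2)" if "m \<ge> N" "n \<ge> N" for m n
      by (rule dirichlet_norm_energy[OF \<Omega> \<phi> \<phi> less_imp_le[OF N[OF that]]])
    then show ?thesis using that by auto
  qed
  \<comment> \<open>The hypotheses constrain \<open>v\<close> only on \<open>\<Omega>\<close>; the
    zero extension is measurable on the plane and has the same weak gradient and the same energies
    on subsets of \<open>\<Omega>\<close>.\<close>
  define v' where "v' x = (if x \<in> \<Omega> then v x else 0)" for x
  have v'm: "v' \<in> borel_measurable lebesgue"
    unfolding v'_def[abs_def]
  proof (rule measurable_exhaustion[of "\<lambda>n. \<Omega> \<inter> ball 0 (real (Suc n))"])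
    show "\<exists>N. \<forall>n\<ge>N. x \<in> \<Omega> \<inter> ball 0 (real (Suc n))" if "x \<in> \<Omega>" for x
    proof -
      obtain N where "norm x < real N" using reals_Archimedean2 by blast
      then show ?thesis using that by (intro exI[of _ N]) auto
    qed
    show "v \<in> borel_measurable (lebesgue_on (\<Omega> \<inter> ball 0 (real (Suc n))))" for n
      using L2[of "real (Suc n)"] by (simp add: L2_tendsto_def L2_space_def)
  qed (use ballm in auto)
  have v_on: "v \<in> borel_measurable (lebesgue_on \<Omega>)"
    using v'm \<Omega>l by (simp add: v'_def[abs_def] borel_measurable_if)
  have loc: "\<exists>N. \<forall>n\<ge>N. energy (\<Omega> \<inter> ball 0 r) (\<lambda>x. \<phi> n x - v' x) \<le> ennreal \<epsilon>" if pos: "\<epsilon> > 0" for r \<epsilon> :: real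
  proof -
    have sub: "\<Omega> \<inter> ball 0 r \<subseteq> \<Omega> \<inter> ball 0 (\<bar>r\<bar> + 1)" by auto
    have "\<bar>r\<bar> + 1 > 0" by simp
    from L2_tendsto_energy[OF L2[OF this] ballm pos]
    obtain N where N: "\<And>n. n \<ge> N \<Longrightarrow> energy (\<Omega> \<inter> ball 0 (\<bar>r\<bar> + 1)) (\<lambda>x. \<phi> n x - v x) \<le> ennreal \<epsilon>"
      by blast
    have "energy (\<Omega> \<inter> ball 0 r) (\<lambda>x. \<phi> n x - v' x) \<le> ennreal \<epsilon>" if "n \<ge> N" for n
    proof -
      have "energy (\<Omega> \<inter> ball 0 r) (\<lambda>x. \<phi> n x - v' x) = energy (\<Omega> \<inter> ball 0 r) (\<lambda>x. \<phi> n x - v x)"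
        by (rule energy_cong) (simp add: v'_def)
      also have "\<dots> \<le> energy (\<Omega> \<inter> ball 0 (\<bar>r\<bar> + 1)) (\<lambda>x. \<phi> n x - v x)" by (rule energy_mono_set[OF sub])
      also note N[OF that]
      finally show ?thesis .
    qed
    then show ?thesis by blast
  qed
  have vfin: "energy (\<Omega> \<inter> ball 0 r) v' < \<infinity>" for r
  proof -
    have "energy (\<Omega> \<inter> ball 0 r) v' = energy (\<Omega> \<inter> ball 0 r) v" by (rule energy_cong) (simp add: v'_def)
    also have "\<dots> \<le> energy (\<Omega> \<inter> ball 0 (\<bar>r\<bar> + 1)) v" by (rule energy_mono_set) auto
    also have "\<dots> < \<infinity>"
    proof -
      have "v \<in> L2_space (lebesgue_on (\<Omega> \<inter> ball 0 (\<bar>r\<bar> + 1)))"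
        using L2[of "\<bar>r\<bar> + 1"] by (simp add: L2_tendsto_def)
      then show ?thesis using L2_space_iff[OF ballm L2_space_measurable] by blast
    qed
    finally show ?thesis .
  qed
  define Cv where "Cv = max 0 (real_of_ereal (esssup (lebesgue_on \<Omega>) (\<lambda>x. ereal ((norm x + 1) * norm (v x)))))"
  have AEv: "AE x in lebesgue_on \<Omega>. (norm x + 1) * norm (v x) \<le> Cv"
    using esssup_AE[of "\<lambda>x. ereal ((norm x + 1) * norm (v x))" "lebesgue_on \<Omega>"]
  proof eventually_elim
    case (elim x)
    then show ?case using assms(5) unfolding Cv_def
      by (cases "esssup (lebesgue_on \<Omega>) (\<lambda>x. ereal ((norm x + 1) * norm (v x)))") auto
  qed
  have AEv': "AE x in lebesgue. x \<in> \<Omega> \<longrightarrow> (norm x + 1) * norm (v' x) \<le> Cv"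
    using AEv \<Omega>l by (simp add: AE_restrict_space_iff v'_def)
  have Cv: "Cv \<ge> 0" by (simp add: Cv_def)
  obtain C1 where C1: "\<And>\<epsilon> \<rho>' M0. \<epsilon> > 0 \<Longrightarrow> \<exists>m\<ge>M0. \<exists>g. g \<in> solenoidal_test_fields \<Omega> \<and>
    (\<forall>x. (norm x + 1) * norm (g x) \<le> C1) \<and>
    energy UNIV (\<lambda>x. grad g x - grad (\<phi> m) x) \<le> ennreal \<epsilon> \<and>
    energy (\<Omega> \<inter> ball 0 \<rho>') (\<lambda>x. g x - v' x) \<le> ennreal \<epsilon>"
  proof (rule approximation[OF assms(1,2) \<phi> cauchy loc v'm AEv' Cv])
    fix C1
    assume "\<And>\<epsilon> \<rho>' M0. \<epsilon> > 0 \<Longrightarrow> \<exists>m\<ge>M0. \<exists>g. g \<in> solenoidal_test_fields \<Omega> \<and>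
      (\<forall>x. (norm x + 1) * norm (g x) \<le> C1) \<and>
      energy UNIV (\<lambda>x. grad g x - grad (\<phi> m) x) \<le> ennreal \<epsilon> \<and>
      energy (\<Omega> \<inter> ball 0 \<rho>') (\<lambda>x. g x - v' x) \<le> ennreal \<epsilon>"
    then show thesis by (rule that)
  qed
  \<comment> \<open>Errors \<open>(1/4) ^ k\<close> on balls of radius \<open>k\<close> are what the
    almost everywhere lemma asks for, so the whole sequence will converge pointwise without passing
    to a subsequence.\<close>
  have "\<forall>k. \<exists>g. g \<in> solenoidal_test_fields \<Omega> \<and> (\<forall>x. (norm x + 1) * norm (g x) \<le> C1) \<and>
    (\<exists>m\<ge>k. energy UNIV (\<lambda>x. grad g x - grad (\<phi> m) x) \<le> ennreal ((1/4) ^ k)) \<and>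
    energy (\<Omega> \<inter> ball 0 (real k)) (\<lambda>x. g x - v' x) \<le> ennreal ((1/4) ^ k)"
  proof
    fix k :: nat
    have "(1/4::real) ^ k > 0" by simp
    from C1[OF this, of k "real k"] show "\<exists>g. g \<in> solenoidal_test_fields \<Omega> \<and> (\<forall>x. (norm x + 1) * norm (g x) \<le> C1) \<and>
    (\<exists>m\<ge>k. energy UNIV (\<lambda>x. grad g x - grad (\<phi> m) x) \<le> ennreal ((1/4) ^ k)) \<and>
    energy (\<Omega> \<inter> ball 0 (real k)) (\<lambda>x. g x - v' x) \<le> ennreal ((1/4) ^ k)" by blast
  qed
  from choice[OF this] obtain vn where vn: "\<And>k. vn k \<in> solenoidal_test_fields \<Omega>"
    and bd: "\<And>k x. (norm x + 1) * norm (vn k x) \<le> C1"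
    and gr: "\<And>k. \<exists>m\<ge>k. energy UNIV (\<lambda>x. grad (vn k) x - grad (\<phi> m) x) \<le> ennreal ((1/4) ^ k)"
    and cl: "\<And>k. energy (\<Omega> \<inter> ball 0 (real k)) (\<lambda>x. vn k x - v' x) \<le> ennreal ((1/4) ^ k)"
    by blast
  have vs: "smooth (vn k)" and \<phi>s: "smooth (\<phi> k)" for k
    by (rule grad_test_support[OF vn[of k]], simp) (rule grad_test_support[OF \<phi>[of k]], simp)
  have gfin: "energy S (grad (\<phi> k)) < \<infinity>" "energy S (grad (vn k)) < \<infinity>" for k S
    by (rule energy_grad_finite[OF \<phi>]) (rule energy_grad_finite[OF vn])
  have gm: "grad (\<phi> k) \<in> borel_measurable lebesgue" "grad (vn k) \<in> borel_measurable lebesgue" for k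
    by (intro continuous_lebesgue continuous_on_grad \<phi>s vs)+
  have cauchy\<Omega>: "\<exists>N. \<forall>m\<ge>N. \<forall>n\<ge>N. energy \<Omega> (\<lambda>x. grad (\<phi> m) x - grad (\<phi> n) x) \<le> ennreal \<epsilon>" if "\<epsilon> > 0" for \<epsilon> :: real
    using cauchy[OF that] order_trans[OF energy_mono_set[of \<Omega> UNIV]] by (meson subset_UNIV)
  \<comment> \<open>The gradients of the given sequence converge to some \<open>G\<close>; its later
    identification with \<open>Dv\<close> also supplies the square integrability of
    \<open>Dv\<close>.\<close>
  obtain G where Gm: "G \<in> borel_measurable lebesgue"
    and G: "\<And>\<epsilon>::real. \<epsilon> > 0 \<Longrightarrow> \<exists>N. \<forall>n\<ge>N. energy \<Omega> (\<lambda>x. grad (\<phi> n) x - G x) \<le> ennreal \<epsilon>"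
  proof (rule energy_complete[OF gm(1) \<Omega>l cauchy\<Omega>])
    fix G assume "G \<in> borel_measurable lebesgue"
      "\<And>\<epsilon>::real. \<epsilon> > 0 \<Longrightarrow> \<exists>N. \<forall>n\<ge>N. energy \<Omega> (\<lambda>x. grad (\<phi> n) x - G x) \<le> ennreal \<epsilon>"
    then show thesis by (rule that)
  qed
  have Gfin: "energy \<Omega> G < \<infinity>"
  proof -
    obtain n where n: "energy \<Omega> (\<lambda>x. grad (\<phi> n) x - G x) \<le> ennreal 1" using G[of 1] by auto
    have "energy \<Omega> G = energy \<Omega> (\<lambda>x. grad (\<phi> n) x + - (grad (\<phi> n) x - G x))" by (rule energy_cong) simp
    also have "\<dots> \<le> 2 * (energy \<Omega> (grad (\<phi> n)) + energy \<Omega> (\<lambda>x. - (grad (\<phi> n) x - G x)))"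
      by (intro energy_add_le borel_measurable_uminus borel_measurable_diff gm Gm \<Omega>l)
    also have "energy \<Omega> (\<lambda>x. - (grad (\<phi> n) x - G x)) = energy \<Omega> (\<lambda>x. grad (\<phi> n) x - G x)"
      by (rule energy_cong) (rule norm_minus_cancel)
    also have "2 * (energy \<Omega> (grad (\<phi> n)) + \<dots>) < \<infinity>"
      using gfin(1)[of \<Omega> n] le_less_trans[OF n] by (simp add: ennreal_mult_less_top)
    finally show ?thesis .
  qed
  have wg': "weak_gradient \<Omega> v' Dv"
  proof -
    have "integrable (lebesgue_on K) v' \<longleftrightarrow> integrable (lebesgue_on K) v" if "K \<subseteq> \<Omega>" for K
      using that by (intro Bochner_Integration.integrable_cong) (auto simp: v'_def)
    moreover have "(LINT x|lebesgue_on \<Omega>. v' x $ i * f x) = (LINT x|lebesgue_on \<Omega>. v x $ i * f x)" for i f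
      by (intro Bochner_Integration.integral_cong) (auto simp: v'_def)
    ultimately show ?thesis
      using assms(4) unfolding weak_gradient_def locally_integrable_def by simp
  qed
  have GD: "AE x in lebesgue. x \<in> \<Omega> \<longrightarrow> G x = Dv x"
    by (rule weak_gradient_limit[OF \<Omega> \<phi> wg' v'm vfin loc Gm Gfin G])
  have Dvm: "Dv \<in> borel_measurable (lebesgue_on \<Omega>)"
  proof -
    obtain C :: "nat \<Rightarrow> (real^2) set" where C: "\<And>n. compact (C n)" "\<And>n. C n \<subseteq> \<Omega>"
      "(\<Union>n. C n) = \<Omega>" "\<And>n. C n \<subseteq> interior (C (Suc n))"
      using open_Union_compact_subsets[OF \<Omega>] by metis
    have mono: "C m \<subseteq> C n" if "m \<le> n" for m n
      using that by (induction rule: dec_induct) (use C(4) interior_subset in blast)+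
    have "(\<lambda>x. if x \<in> \<Omega> then Dv x else 0) \<in> borel_measurable lebesgue"
    proof (rule measurable_exhaustion[of C])
      show "\<exists>N. \<forall>n\<ge>N. x \<in> C n" if "x \<in> \<Omega>" for x using that C(3) mono by blast
      show "Dv \<in> borel_measurable (lebesgue_on (C n))" for n
        using assms(4) C(1,2)[of n] unfolding weak_gradient_def locally_integrable_def
        by (meson borel_measurable_integrable)
      show "C n \<in> sets lebesgue" for n by (rule compact_lebesgue[OF C(1)])
      show "C n \<subseteq> \<Omega>" for n by (rule C(2))
    qed
    then show ?thesis using \<Omega>l by (simp add: borel_measurable_if)
  qed
  have eq: "energy \<Omega> (\<lambda>x. f x - G x) = energy \<Omega> (\<lambda>x. f x - Dv x)" for f
    unfolding energy_def
  proof (rule nn_integral_cong_AE)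
    show "AE x in lebesgue. ennreal ((norm (f x - G x))\<^sup>2) * indicator \<Omega> x = ennreal ((norm (f x - Dv x))\<^sup>2) * indicator \<Omega> x"
      using GD by eventually_elim (auto simp: indicator_def)
  qed
  have DvL2: "Dv \<in> L2_space (lebesgue_on \<Omega>)"
  proof -
    have "energy \<Omega> Dv = energy \<Omega> (\<lambda>x. 0 - Dv x)" by (rule energy_cong) simp
    also have "\<dots> = energy \<Omega> (\<lambda>x. 0 - G x)" by (rule eq[symmetric])
    also have "\<dots> = energy \<Omega> G" by (rule energy_cong) simp
    finally show ?thesis using Gfin by (simp add: L2_space_iff[OF \<Omega>l Dvm])
  qed
  have grad_conv: "L2_tendsto (lebesgue_on \<Omega>) (\<lambda>n. grad (vn n)) Dv"
  proof (rule L2_tendstoI_energy[OF \<Omega>l _ DvL2])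
    have "grad (vn n) \<in> borel_measurable (lebesgue_on \<Omega>)" for n
      by (intro measurable_restrict_space1 gm)
    then show "grad (vn n) \<in> L2_space (lebesgue_on \<Omega>)" for n
      by (simp add: L2_space_iff[OF \<Omega>l] gfin(2)[unfolded infinity_ennreal_def])
    fix \<epsilon> :: real assume \<epsilon>: "\<epsilon> > 0"
    obtain N1 where N1: "\<And>n. n \<ge> N1 \<Longrightarrow> energy \<Omega> (\<lambda>x. grad (\<phi> n) x - G x) \<le> ennreal (\<epsilon> / 4)"
      using G[of "\<epsilon> / 4"] \<epsilon> by auto
    obtain N2 where N2: "(1/4::real) ^ N2 < \<epsilon> / 4"
      using real_arch_pow_inv[of "\<epsilon> / 4" "1/4"] \<epsilon> by auto
    have "energy \<Omega> (\<lambda>x. grad (vn n) x - Dv x) \<le> ennreal \<epsilon>" if n: "n \<ge> max N1 N2" for n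
    proof -
      obtain m where m: "m \<ge> n" "energy UNIV (\<lambda>x. grad (vn n) x - grad (\<phi> m) x) \<le> ennreal ((1/4) ^ n)"
        using gr by blast
      have "(1/4::real) ^ n \<le> (1/4) ^ N2" using n by (intro power_decreasing) auto
      then have p: "(1/4::real) ^ n \<le> \<epsilon> / 4" using N2 by linarith
      have "energy \<Omega> (\<lambda>x. grad (vn n) x - Dv x) = energy \<Omega> (\<lambda>x. grad (vn n) x - G x)" by (rule eq[symmetric])
      also have "\<dots> = energy \<Omega> (\<lambda>x. (grad (vn n) x - grad (\<phi> m) x) + (grad (\<phi> m) x - G x))"
        by (rule energy_cong) simp
      also have "\<dots> \<le> 2 * (energy \<Omega> (\<lambda>x. grad (vn n) x - grad (\<phi> m) x) + energy \<Omega> (\<lambda>x. grad (\<phi> m) x - G x))"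
        by (intro energy_add_le borel_measurable_diff gm Gm \<Omega>l)
      also have "\<dots> \<le> 2 * (ennreal (\<epsilon> / 4) + ennreal (\<epsilon> / 4))"
      proof (intro mult_left_mono add_mono)
        show "energy \<Omega> (\<lambda>x. grad (vn n) x - grad (\<phi> m) x) \<le> ennreal (\<epsilon> / 4)"
          using order_trans[OF order_trans[OF energy_mono_set[of \<Omega> UNIV] m(2)] ennreal_leI[OF p]] by simp
        show "energy \<Omega> (\<lambda>x. grad (\<phi> m) x - G x) \<le> ennreal (\<epsilon> / 4)" using n m(1) by (intro N1) simp
      qed simp
      also have "\<dots> = ennreal 2 * ennreal (\<epsilon> / 4 + \<epsilon> / 4)"
        using \<epsilon> by (subst ennreal_plus) simp_all
      also have "\<dots> = ennreal \<epsilon>" using \<epsilon> by (subst ennreal_mult[symmetric]) simp_all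
      finally show ?thesis .
    qed
    then show "\<exists>N. \<forall>n\<ge>N. energy \<Omega> (\<lambda>x. grad (vn n) x - Dv x) \<le> ennreal \<epsilon>" by blast
  qed
  have AEc: "AE x in lebesgue. x \<in> \<Omega> \<longrightarrow> (\<lambda>k. vn k x) \<longlonglongrightarrow> v' x"
  proof -
    let ?d = "\<lambda>k x. vn k x - v' x"
    have dm: "?d k \<in> borel_measurable lebesgue" for k
      by (intro borel_measurable_diff continuous_lebesgue smooth_continuous_on vs v'm)
    \<comment> \<open>On the ball of fixed radius \<open>K\<close> the energy bounds are available
      from index \<open>k = K\<close> on, which is the role of the starting index in the
      lemma.\<close>
    have "AE x in lebesgue. x \<in> \<Omega> \<inter> ball 0 (real K) \<longrightarrow> (\<exists>C. \<forall>k. norm (?d k x) \<le> C * (sqrt (1/2)) ^ k)" for K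
    proof (rule AE_tendsto_of_energy[OF dm ballm])
      fix k assume "K \<le> k"
      then have "energy (\<Omega> \<inter> ball 0 (real K)) (?d k) \<le> energy (\<Omega> \<inter> ball 0 (real k)) (?d k)"
        by (intro energy_mono_set) auto
      then show "energy (\<Omega> \<inter> ball 0 (real K)) (?d k) \<le> ennreal ((1/4) ^ k)" using cl by (rule order_trans)
    qed
    then have "AE x in lebesgue. \<forall>K. x \<in> \<Omega> \<inter> ball 0 (real K) \<longrightarrow> (\<exists>C. \<forall>k. norm (?d k x) \<le> C * (sqrt (1/2)) ^ k)"
      unfolding AE_all_countable by blast
    then show ?thesis
    proof eventually_elim
      case (elim x)
      show ?case
      proof
        assume x: "x \<in> \<Omega>"
        obtain K where "norm x < real K" using reals_Archimedean2 by blast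
        then obtain C where "\<And>k. norm (?d k x) \<le> C * (sqrt (1/2)) ^ k" using elim x by auto
        then have "(\<lambda>k. ?d k x) \<longlonglongrightarrow> 0"
          by (intro Lim_null_comparison[OF _ geometric_sqrt_half(2)[of C]]) auto
        then show "(\<lambda>k. vn k x) \<longlonglongrightarrow> v' x" by (simp add: LIM_zero_iff)
      qed
    qed
  qed
  have wm: "(\<lambda>x. (norm x + 1) *\<^sub>R f x) \<in> borel_measurable (lebesgue_on \<Omega>)"
    if "f \<in> borel_measurable (lebesgue_on \<Omega>)" for f :: "real^2 \<Rightarrow> real^2"
  proof -
    have "(\<lambda>x::real^2. norm x + 1) \<in> borel_measurable (lebesgue_on \<Omega>)"
      by (intro measurable_restrict_space1 continuous_lebesgue continuous_intros)
    then show ?thesis using that by (rule borel_measurable_scaleR)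
  qed
  have vnm: "(\<lambda>x. (norm x + 1) *\<^sub>R vn n x) \<in> borel_measurable (lebesgue_on \<Omega>)" for n
    by (intro wm measurable_restrict_space1 continuous_lebesgue smooth_continuous_on vs)
  have nrm: "norm ((norm x + 1) *\<^sub>R (y::real^2)) = (norm x + 1) * norm y" for x y :: "real^2" by simp
  have weak: "Linf_weak_star_tendsto (lebesgue_on \<Omega>)
             (\<lambda>n x. (norm x + 1) *\<^sub>R vn n x) (\<lambda>x. (norm x + 1) *\<^sub>R v x)"
    unfolding Linf_weak_star_tendsto_def
  proof (intro conjI allI impI)
    show "(\<lambda>x. (norm x + 1) *\<^sub>R vn n x) \<in> Linf_space (lebesgue_on \<Omega>)" for n
    proof -
      have "esssup (lebesgue_on \<Omega>) (\<lambda>x. ereal (norm ((norm x + 1) *\<^sub>R vn n x))) \<le> ereal C1"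
      proof (rule esssup_I)
        show "(\<lambda>x. ereal (norm ((norm x + 1) *\<^sub>R vn n x))) \<in> borel_measurable (lebesgue_on \<Omega>)"
          by (intro borel_measurable_ereal measurable_compose[OF vnm borel_measurable_norm])
        show "AE x in lebesgue_on \<Omega>. ereal (norm ((norm x + 1) *\<^sub>R vn n x)) \<le> ereal C1"
          unfolding nrm by (intro AE_I2) (simp add: bd)
      qed
      then have "esssup (lebesgue_on \<Omega>) (\<lambda>x. ereal (norm ((norm x + 1) *\<^sub>R vn n x))) < \<infinity>"
        by (rule le_less_trans) simp
      then show ?thesis using vnm by (simp only: Linf_space_def mem_Collect_eq)
    qed
    show "(\<lambda>x. (norm x + 1) *\<^sub>R v x) \<in> Linf_space (lebesgue_on \<Omega>)"
      using wm[OF v_on] assms(5) unfolding Linf_space_def mem_Collect_eq nrm by blast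
    fix h :: "real^2 \<Rightarrow> real^2" assume h: "integrable (lebesgue_on \<Omega>) h"
    show "(\<lambda>n. LINT x|lebesgue_on \<Omega>. (norm x + 1) *\<^sub>R vn n x \<bullet> h x) \<longlonglongrightarrow> (LINT x|lebesgue_on \<Omega>. (norm x + 1) *\<^sub>R v x \<bullet> h x)"
    \<comment> \<open>The single weighted bound \<open>C1\<close> for the whole sequence makes
      \<open>C1 * norm (h x)\<close> a dominating function for every integrable
      \<open>h\<close>.\<close>
    proof (rule integral_dominated_convergence[where w = "\<lambda>x. C1 * norm (h x)"])
      show "(\<lambda>x. (norm x + 1) *\<^sub>R v x \<bullet> h x) \<in> borel_measurable (lebesgue_on \<Omega>)"
        by (intro borel_measurable_inner wm v_on borel_measurable_integrable h)
      show "(\<lambda>x. (norm x + 1) *\<^sub>R vn n x \<bullet> h x) \<in> borel_measurable (lebesgue_on \<Omega>)" for n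
        by (intro borel_measurable_inner vnm borel_measurable_integrable h)
      show "integrable (lebesgue_on \<Omega>) (\<lambda>x. C1 * norm (h x))" using h by simp
      show "AE x in lebesgue_on \<Omega>. norm ((norm x + 1) *\<^sub>R vn n x \<bullet> h x) \<le> C1 * norm (h x)" for n
      proof (rule AE_I2)
        fix x
        have "norm ((norm x + 1) *\<^sub>R vn n x \<bullet> h x) \<le> norm ((norm x + 1) *\<^sub>R vn n x) * norm (h x)"
          unfolding real_norm_def by (rule Cauchy_Schwarz_ineq2)
        also have "\<dots> \<le> C1 * norm (h x)" unfolding nrm by (intro mult_right_mono bd) simp
        finally show "norm ((norm x + 1) *\<^sub>R vn n x \<bullet> h x) \<le> C1 * norm (h x)" .
      qed
      have "AE x in lebesgue_on \<Omega>. (\<lambda>k. vn k x) \<longlonglongrightarrow> v x"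
        using AEc \<Omega>l by (simp add: AE_restrict_space_iff v'_def)
      then show "AE x in lebesgue_on \<Omega>. (\<lambda>n. (norm x + 1) *\<^sub>R vn n x \<bullet> h x) \<longlonglongrightarrow> (norm x + 1) *\<^sub>R v x \<bullet> h x"
        by eventually_elim (intro tendsto_inner tendsto_scaleR tendsto_const)
    qed
  qed
  show ?thesis using vn grad_conv weak by blast
qed

end
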